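(* Let $n \geq 2$ and $0 < s < 1$. Let $u \in H^{-r}(\mathbb{R}^n)$ for some $r \in \mathbb{R}$. If both $u$ and $(-\Delta)^s u$ vanish in some nonempty open subset of $\mathbb{R}^n$ (that is, both distributions restrict to zero on one common nonempty open set), then $u \equiv 0$.
   Context: $H^{t}(\mathbb{R}^n)$, $t \in \mathbb{R}$, is the $L^2$-based Sobolev space of tempered distributions $u$ with $(1+|\xi|^2)^{t/2}\hat u \in L^2$. The fractional Laplacian is the Fourier multiplier $(-\Delta)^s u = \mathcal{F}^{-1}\{|\xi|^{2s}\hat u(\xi)\}$, which for $s \ge 0$ is a bounded map $H^t(\mathbb{R}^n) \to H^{t-2s}(\mathbb{R}^n)$ for every $t \in \mathbb{R}$. *)

theory Defs
  imports "HOL-Analysis.Analysis"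
begin

text \<open>The iterated partial derivative of a function along a list of basis vectors; a multi-index
  derivative of order \<open>k\<close> corresponds to a list of length \<open>k\<close> with entries in \<^term>\<open>Basis\<close>.\<close>

primrec iter_pderiv :: "'a list \<Rightarrow> ('a::euclidean_space \<Rightarrow> complex) \<Rightarrow> 'a \<Rightarrow> complex" where
  "iter_pderiv [] f = f"
| "iter_pderiv (b # bs) f = (\<lambda>x. frechet_derivative (iter_pderiv bs f) (at x) b)"

definition smooth :: "('a::euclidean_space \<Rightarrow> complex) \<Rightarrow> bool" where
  "smooth f \<longleftrightarrow> (\<forall>bs \<in> lists Basis. \<forall>x. iter_pderiv bs f differentiable (at x))"

definition schwartz :: "('a::euclidean_space \<Rightarrow> complex) set" where
  "schwartz = {f. smooth f \<and>
     (\<forall>bs \<in> lists Basis. \<forall>k::nat. bounded (range (\<lambda>x. (1 + norm x) ^ k *\<^sub>R iter_pderiv bs f x)))}"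

definition schwartz_norm :: "nat \<Rightarrow> ('a::euclidean_space \<Rightarrow> complex) \<Rightarrow> real" where
  "schwartz_norm N f =
     (\<Sum>bs | bs \<in> lists Basis \<and> length bs \<le> N. SUP x. (1 + norm x) ^ N * norm (iter_pderiv bs f x))"

text \<open>A tempered distribution is a continuous linear functional on the Schwartz space. It is
  represented by a total function on \<^typ>\<open>'a \<Rightarrow> complex\<close>, of which only the values on
  \<^const>\<open>schwartz\<close> are meaningful; in particular, equality of tempered distributions is
  equality on \<^const>\<open>schwartz\<close>. Continuity is domination by one of the increasing
  seminorms \<^const>\<open>schwartz_norm\<close> that generate the topology of the Schwartz space.\<close>

type_synonym 'a dist = "('a \<Rightarrow> complex) \<Rightarrow> complex"

definition tempered :: "('a::euclidean_space) dist set" where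
  "tempered = {u.
     (\<forall>f \<in> schwartz. \<forall>g \<in> schwartz. u (\<lambda>x. f x + g x) = u f + u g) \<and>
     (\<forall>c. \<forall>f \<in> schwartz. u (\<lambda>x. c * f x) = c * u f) \<and>
     (\<exists>C N. \<forall>f \<in> schwartz. norm (u f) \<le> C * schwartz_norm N f)}"

definition vanishes_on :: "('a::euclidean_space) dist \<Rightarrow> 'a set \<Rightarrow> bool" where
  "vanishes_on u U \<longleftrightarrow>
     (\<forall>f. smooth f \<and> compact (closure {x. f x \<noteq> 0}) \<and> closure {x. f x \<noteq> 0} \<subseteq> U \<longrightarrow> u f = 0)"

definition regular_dist :: "('a::euclidean_space \<Rightarrow> complex) \<Rightarrow> 'a dist" where
  "regular_dist g f = (\<integral>x. g x * f x \<partial>lborel)"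

definition represented_by :: "('a::euclidean_space) dist \<Rightarrow> ('a \<Rightarrow> complex) \<Rightarrow> bool" where
  "represented_by u g \<longleftrightarrow> g \<in> borel_measurable lborel \<and>
     (\<forall>f \<in> schwartz. integrable lborel (\<lambda>x. g x * f x) \<and> u f = regular_dist g f)"

text \<open>The function representing a distribution, which is unique up to null sets when it exists.\<close>

definition density_of :: "('a::euclidean_space) dist \<Rightarrow> 'a \<Rightarrow> complex" where
  "density_of u = (SOME g. represented_by u g)"

definition mult_dist :: "('a::euclidean_space \<Rightarrow> complex) \<Rightarrow> 'a dist \<Rightarrow> 'a dist" where
  "mult_dist m u f = u (\<lambda>x. m x * f x)"

definition fourier :: "('a::euclidean_space \<Rightarrow> complex) \<Rightarrow> 'a \<Rightarrow> complex" where
  "fourier f \<xi> = (\<integral>x. exp (- \<i> * of_real (x \<bullet> \<xi>)) * f x \<partial>lborel)"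

definition inv_fourier :: "('a::euclidean_space \<Rightarrow> complex) \<Rightarrow> 'a \<Rightarrow> complex" where
  "inv_fourier f x =
     of_real (1 / (2 * pi) ^ DIM('a)) * (\<integral>\<xi>. exp (\<i> * of_real (x \<bullet> \<xi>)) * f \<xi> \<partial>lborel)"

definition fourier_dist :: "('a::euclidean_space) dist \<Rightarrow> 'a dist" where
  "fourier_dist u f = u (fourier f)"

definition inv_fourier_dist :: "('a::euclidean_space) dist \<Rightarrow> 'a dist" where
  "inv_fourier_dist u f = u (inv_fourier f)"

definition in_L2 :: "('a::euclidean_space) dist \<Rightarrow> bool" where
  "in_L2 u \<longleftrightarrow> (\<exists>h. represented_by u h \<and> integrable lborel (\<lambda>x. (norm (h x))\<^sup>2))"

definition sobolev :: "real \<Rightarrow> ('a::euclidean_space) dist set" where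
  "sobolev t = {u \<in> tempered.
     in_L2 (mult_dist (\<lambda>\<xi>. of_real ((1 + (norm \<xi>)\<^sup>2) powr (t / 2))) (fourier_dist u))}"

text \<open>The multiplier \<open>\<bar>\<xi>\<bar>\<close> to the power \<open>2 s\<close> is not smooth at the origin, so its product with the
  Fourier transform of \<open>u\<close> is formed pointwise, using that this transform is a function
  whenever \<open>u\<close> lies in some Sobolev space.\<close>

definition frac_laplacian :: "real \<Rightarrow> ('a::euclidean_space) dist \<Rightarrow> 'a dist" where
  "frac_laplacian s u = inv_fourier_dist
     (regular_dist (\<lambda>\<xi>. of_real (norm \<xi> powr (2 * s)) * density_of (fourier_dist u) \<xi>))"

end

theory Submission
  imports Defs "HOL-Probability.Characteristic_Functions" "HOL-Probability.Sinc_Integral"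
    "HOL-Computational_Algebra.Polynomial"
begin

text \<open>The proof compares \<open>u\<close> with the heat semigroup. Let \<open>g\<close> be the function representing the Fourier
transform of \<open>u\<close>, let \<open>a\<close> be a point of \<open>U\<close> and let \<open>f\<close> be a test function supported in a small ball
around \<open>a\<close>, with inverse Fourier transform \<open>\<psi>\<close>. The function
\<open>h(t) = \<integral> g \<psi> exp (-t \<bar>\<xi>\<bar>\<^sup>2)\<close> is the pairing of \<open>u\<close> with the heat evolution of \<open>f\<close> at time \<open>t\<close>, and the
heart of the matter is that it vanishes identically.

Two facts force this. Since \<open>u\<close> vanishes near the support of \<open>f\<close>, while the heat kernel is
exponentially small away from it, \<open>h(t)\<close> is \<open>O(exp (-c/t))\<close> as \<open>t\<close> tends to \<open>0\<close>
(\<open>off_diagonal\<close>); the same holds for all derivatives of \<open>h\<close>, because \<open>f\<close> can be replaced by its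
iterated Laplacians. Since \<open>(-\<Delta>)\<^sup>s u\<close> vanishes near the support of \<open>f\<close>, one has
\<open>\<integral> \<bar>\<xi>\<bar> powr (2 s + 2 k) g \<psi> = 0\<close> for every \<open>k\<close>. Writing \<open>\<bar>\<xi>\<bar> powr (2 s - 2)\<close> as a Gamma integral of
\<open>exp (-t \<bar>\<xi>\<bar>\<^sup>2)\<close> over \<open>t\<close> and integrating by parts in \<open>t\<close>, this becomes
\<open>\<integral> h(t) t powr (-1 - s - k) dt = 0\<close> for every \<open>k\<close> (\<open>frac_moment\<close>, \<open>by_parts\<close>). In the variable
\<open>1/t\<close> these are all the moments of a function with exponential decay, and such a function is
determined by its moments (\<open>moments_eq_0\<close>). Hence \<open>h = 0\<close>.

The rest is unique continuation for the heat flow, which is real analytic in space. The identity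
\<open>h = 0\<close> holds for all directional derivatives of \<open>f\<close>; summing an exponential series gives
\<open>\<integral> exp (-i y \<bullet> \<xi>) g \<psi> exp (-t \<bar>\<xi>\<bar>\<^sup>2) = 0\<close> for all \<open>y\<close>, so \<open>g \<psi> exp (-t \<bar>\<xi>\<bar>\<^sup>2)\<close> annihilates
every Schwartz function. Letting \<open>t\<close> tend to \<open>0\<close> and \<open>f\<close> to a point mass at \<open>a\<close>, the same is true
of \<open>g\<close> (\<open>density_pairing_eq_0\<close>), and Fourier inversion on the Schwartz space yields \<open>u = 0\<close>.

The Fourier analysis of the Schwartz space and the smooth cutoff functions are developed from
explicit bounds on iterated derivatives.\<close>


section \<open>Calculus with bounds on iterated derivatives\<close>

definition pd :: "'a \<Rightarrow> ('a::euclidean_space \<Rightarrow> complex) \<Rightarrow> 'a \<Rightarrow> complex" where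
  "pd b f x = frechet_derivative f (at x) b"

lemma pd_eq: "(f has_derivative D) (at x) \<Longrightarrow> pd b f x = D b"
  unfolding pd_def using frechet_derivative_at by metis

lemma iter_pderiv_Cons: "iter_pderiv (b # bs) f = pd b (iter_pderiv bs f)"
  by (simp add: pd_def fun_eq_iff)

declare iter_pderiv.simps(2) [simp del]

lemma iter_pderiv_append: "iter_pderiv (bs @ cs) f = iter_pderiv bs (iter_pderiv cs f)"
  by (induction bs) (simp_all add: iter_pderiv_Cons)

lemma iter_pderiv_snoc: "iter_pderiv (bs @ [b]) f = iter_pderiv bs (pd b f)"
  by (simp add: iter_pderiv_append iter_pderiv_Cons)

text \<open>One weight bounds all derivatives up to a given order. Smoothness, slow growth and rapid decay are
then instances of the same notion, for different families of weights, and sums and products are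
treated once for all three.\<close>

definition dbound :: "nat \<Rightarrow> ('a \<Rightarrow> real) \<Rightarrow> ('a::euclidean_space \<Rightarrow> complex) \<Rightarrow> bool" where
  "dbound n W f \<longleftrightarrow>
     (\<forall>bs\<in>lists Basis. length bs \<le> n \<longrightarrow> (\<forall>x. norm (iter_pderiv bs f x) \<le> W x)) \<and>
     (\<forall>bs\<in>lists Basis. length bs < n \<longrightarrow> (\<forall>x. iter_pderiv bs f differentiable at x))"

lemma dbound_0: "dbound 0 W f \<longleftrightarrow> (\<forall>x. norm (f x) \<le> W x)"
  unfolding dbound_def by auto

text \<open>The last entry of the list is the innermost derivative, so removing it from a list turns a
derivative of \<open>f\<close> into one of a first partial derivative of \<open>f\<close>. All inductions on the
order of differentiability rest on this.\<close>

lemma dbound_Suc: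
  "dbound (Suc n) W f \<longleftrightarrow>
     (\<forall>x. norm (f x) \<le> W x) \<and> (\<forall>x. f differentiable at x) \<and> (\<forall>b\<in>Basis. dbound n W (pd b f))"
  (is "?L \<longleftrightarrow> ?R")
proof
  assume L: ?L
  have "norm (f x) \<le> W x" "f differentiable at x" for x
    using L unfolding dbound_def by (force dest: bspec[of _ _ "[]"])+
  moreover have "dbound n W (pd b f)" if b: "b \<in> Basis" for b
  proof -
    have "norm (iter_pderiv bs (pd b f) x) \<le> W x" if "bs \<in> lists Basis" "length bs \<le> n" for bs x
      using L that b unfolding dbound_def
      by (auto simp flip: iter_pderiv_snoc)
    moreover have "iter_pderiv bs (pd b f) differentiable at x"
      if "bs \<in> lists Basis" "length bs < n" for bs x
      using L that b unfolding dbound_def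
      by (auto simp flip: iter_pderiv_snoc)
    ultimately show ?thesis unfolding dbound_def by blast
  qed
  ultimately show ?R by blast
next
  assume R: ?R
  have "norm (iter_pderiv bs f x) \<le> W x" if "bs \<in> lists Basis" "length bs \<le> Suc n" for bs x
  proof (cases bs rule: rev_cases)
    case Nil then show ?thesis using R by auto
  next
    case (snoc cs b)
    then show ?thesis using R that unfolding dbound_def by (auto simp: iter_pderiv_snoc)
  qed
  moreover have "iter_pderiv bs f differentiable at x" if "bs \<in> lists Basis" "length bs < Suc n" for bs x
  proof (cases bs rule: rev_cases)
    case Nil then show ?thesis using R by auto
  next
    case (snoc cs b)
    then show ?thesis using R that unfolding dbound_def by (auto simp: iter_pderiv_snoc)
  qed
  ultimately show ?L unfolding dbound_def by blast
qed

lemma dbound_mono: "dbound n V f \<Longrightarrow> (\<And>x. V x \<le> W x) \<Longrightarrow> dbound n W f"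
  unfolding dbound_def by (meson order_trans)

lemma dbound_le: "dbound n W f \<Longrightarrow> m \<le> n \<Longrightarrow> dbound m W f"
  unfolding dbound_def by auto

lemma dbound_norm: "dbound n W f \<Longrightarrow> norm (f x) \<le> W x"
  by (cases n) (auto simp: dbound_0 dbound_Suc)

lemma dbound_nonneg: "dbound n W f \<Longrightarrow> 0 \<le> W x"
  using dbound_norm norm_ge_zero order_trans by metis

lemma has_derivative_frechet: "f differentiable at x \<Longrightarrow> (f has_derivative (\<lambda>h. pd h f x)) (at x)"
  unfolding pd_def by (simp add: frechet_derivative_works)

lemma pd_add:
  assumes "f differentiable at x" "g differentiable at x"
  shows "pd b (\<lambda>x. f x + g x) x = pd b f x + pd b g x"
  by (rule pd_eq) (intro has_derivative_add has_derivative_frechet assms)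

lemma pd_mult:
  assumes "f differentiable at x" "g differentiable at x"
  shows "pd b (\<lambda>x. f x * g x) x = f x * pd b g x + pd b f x * g x"
  using pd_eq[OF has_derivative_mult[OF assms[THEN has_derivative_frechet]], of b] by simp

lemma dbound_add:
  "dbound n V f \<Longrightarrow> dbound n W g \<Longrightarrow> dbound n (\<lambda>x. V x + W x) (\<lambda>x. f x + g x)"
proof (induction n arbitrary: f g)
  case 0
  then show ?case by (auto simp: dbound_0 intro: norm_triangle_mono)
next
  case (Suc n)
  have d: "f differentiable at x" "g differentiable at x" for x
    using Suc.prems by (auto simp: dbound_Suc)
  have "pd b (\<lambda>x. f x + g x) = (\<lambda>x. pd b f x + pd b g x)" for b
    by (intro ext pd_add d)
  moreover have "dbound n (\<lambda>x. V x + W x) (pd b (\<lambda>x. f x + g x))" if "b \<in> Basis" for b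
    unfolding calculation using Suc.prems that by (intro Suc.IH) (auto simp: dbound_Suc)
  moreover have "norm (f x + g x) \<le> V x + W x" for x
    using Suc.prems by (intro norm_triangle_mono dbound_norm)
  ultimately show ?case using d by (subst dbound_Suc) (blast intro: differentiable_add)
qed

text \<open>A derivative of order \<open>n\<close> of a product is a sum of \<open>2 ^ n\<close> products, because every further
derivative doubles the number of terms.\<close>

lemma dbound_mult:
  "dbound n V f \<Longrightarrow> dbound n W g \<Longrightarrow> dbound n (\<lambda>x. 2 ^ n * (V x * W x)) (\<lambda>x. f x * g x)"
proof (induction n arbitrary: f g)
  case 0
  then show ?case by (auto simp: dbound_0 norm_mult intro!: mult_mono')
next
  case (Suc n)
  have d: "f differentiable at x" "g differentiable at x" for x
    using Suc.prems by (auto simp: dbound_Suc)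
  have nn: "0 \<le> V x * W x" for x
    using Suc.prems by (intro mult_nonneg_nonneg dbound_nonneg) 
  have eq: "pd b (\<lambda>x. f x * g x) = (\<lambda>x. f x * pd b g x + pd b f x * g x)" for b
    by (intro ext pd_mult d)
  have fg: "dbound n V f" "dbound n W g"
    using Suc.prems dbound_le le_SucI by blast+
  have "dbound n (\<lambda>x. 2 ^ n * (V x * W x) + 2 ^ n * (V x * W x)) (pd b (\<lambda>x. f x * g x))"
    if b: "b \<in> Basis" for b
  proof -
    have "dbound n W (pd b g)" "dbound n V (pd b f)"
      using Suc.prems b by (auto simp: dbound_Suc)
    with fg show ?thesis unfolding eq by (intro dbound_add Suc.IH)
  qed
  then have "dbound n (\<lambda>x. 2 ^ Suc n * (V x * W x)) (pd b (\<lambda>x. f x * g x))" if "b \<in> Basis" for b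
    using that by (simp add: mult_ac)
  moreover have "norm (f x * g x) \<le> 2 ^ Suc n * (V x * W x)" for x
  proof -
    have "norm (f x * g x) \<le> 1 * (V x * W x)"
      using dbound_norm[OF fg(1), of x] dbound_norm[OF fg(2), of x]
      by (auto simp: norm_mult intro!: mult_mono')
    also have "\<dots> \<le> 2 ^ Suc n * (V x * W x)"
      using one_le_power[of "2::real" "Suc n"] by (intro mult_right_mono nn) auto
    finally show ?thesis .
  qed
  moreover have "(\<lambda>x. f x * g x) differentiable at x" for x
    using d by (intro differentiable_mult)
  ultimately show ?case by (subst dbound_Suc) blast
qed

lemma dbound_const: "dbound n (\<lambda>_. norm c) (\<lambda>_. c)"
proof (induction n arbitrary: c)
  case 0 show ?case by (simp add: dbound_0)
next
  case (Suc n)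
  have "pd b (\<lambda>_::'a. c) = (\<lambda>_. 0)" for b by (intro ext) (auto simp: pd_eq[OF has_derivative_const])
  moreover have "dbound n (\<lambda>_. norm c) (\<lambda>_::'a. 0)"
    by (rule dbound_mono[OF Suc.IH]) auto
  ultimately show ?case by (simp add: dbound_Suc)
qed

text \<open>Induction on the order yields one weight for the function and one for each of its partial
derivatives. In a directed family these finitely many weights have a common upper bound.\<close>

definition directed_weights :: "('a \<Rightarrow> real) set \<Rightarrow> bool" where
  "directed_weights \<W> \<longleftrightarrow> \<W> \<noteq> {} \<and> (\<forall>V\<in>\<W>. \<forall>W\<in>\<W>. \<exists>Z\<in>\<W>. \<forall>x. V x \<le> Z x \<and> W x \<le> Z x)"

lemma directed_weights_finite:
  assumes "directed_weights \<W>" "finite F" "\<forall>b\<in>F. w b \<in> \<W>"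
  shows "\<exists>Z\<in>\<W>. \<forall>b\<in>F. \<forall>x. w b x \<le> Z x"
  using assms(2,3)
proof (induction F)
  case empty
  then show ?case using assms(1) by (auto simp: directed_weights_def)
next
  case (insert b F)
  then obtain Z where "Z \<in> \<W>" "\<forall>b\<in>F. \<forall>x. w b x \<le> Z x" by auto
  moreover obtain Y where "Y \<in> \<W>" "\<forall>x. Z x \<le> Y x \<and> w b x \<le> Y x"
    using assms(1) insert.prems calculation(1) unfolding directed_weights_def by (metis insertI1)
  ultimately show ?case by (metis insert_iff order_trans)
qed

lemma dbound_Suc_directed:
  assumes "directed_weights \<W>" "\<exists>W\<in>\<W>. \<forall>x. norm (f x) \<le> W x" "\<And>x. (f has_derivative D x) (at x)"
    and "\<And>b. b \<in> Basis \<Longrightarrow> \<exists>W\<in>\<W>. dbound n W (\<lambda>x. D x b)"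
  shows "\<exists>W\<in>\<W>. dbound (Suc n) W f"
proof -
  have pd: "pd b f = (\<lambda>x. D x b)" for b using assms(3) pd_eq by blast
  have diff: "f differentiable at x" for x using assms(3) unfolding differentiable_def by blast
  obtain w where w: "\<forall>b\<in>Basis. w b \<in> \<W> \<and> dbound n (w b) (pd b f)"
    using bchoice[of Basis "\<lambda>b W. W \<in> \<W> \<and> dbound n W (pd b f)"] assms(4) unfolding pd Bex_def by blast
  then obtain Z where Z: "Z \<in> \<W>" "\<forall>b\<in>Basis. \<forall>x. w b x \<le> Z x"
    using directed_weights_finite[OF assms(1) finite_Basis, of w] by blast
  obtain V where V: "V \<in> \<W>" "\<forall>x. norm (f x) \<le> V x" using assms(2) by auto
  obtain Y where Y: "Y \<in> \<W>" "\<forall>x. Z x \<le> Y x \<and> V x \<le> Y x"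
    using assms(1) V(1) Z(1) unfolding directed_weights_def by metis
  have "dbound n Y (pd b f)" if "b \<in> Basis" for b
    using w Z Y that by (meson dbound_mono order_trans)
  moreover have "norm (f x) \<le> Y x" for x using V Y by (meson order_trans)
  ultimately show ?thesis using Y(1) diff by (auto simp: dbound_Suc intro!: bexI[of _ Y])
qed

lemma finite_lists_Basis: "finite {bs \<in> lists (Basis::'a::euclidean_space set). length bs \<le> n}"
  using finite_lists_length_le[OF finite_Basis, of n] by (simp add: lists_eq_set)

lemma dbound_directedI:
  assumes "directed_weights \<W>" "\<And>bs x. bs \<in> lists Basis \<Longrightarrow> iter_pderiv bs f differentiable at x"
    and "\<And>bs. bs \<in> lists Basis \<Longrightarrow> \<exists>W\<in>\<W>. \<forall>x. norm (iter_pderiv bs f x) \<le> W x"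
  shows "\<exists>W\<in>\<W>. dbound n W f"
proof -
  let ?F = "{bs \<in> lists (Basis::'a set). length bs \<le> n}"
  obtain w where w: "\<forall>bs\<in>?F. w bs \<in> \<W> \<and> (\<forall>x. norm (iter_pderiv bs f x) \<le> w bs x)"
    using assms(3) by (metis (no_types, lifting) mem_Collect_eq)
  then obtain Z where "Z \<in> \<W>" "\<forall>bs\<in>?F. \<forall>x. w bs x \<le> Z x"
    using directed_weights_finite[OF assms(1) finite_lists_Basis, of n w] by blast
  then have "dbound n Z f"
    using assms(2) w unfolding dbound_def by (fastforce intro: order_trans)
  then show ?thesis using \<open>Z \<in> \<W>\<close> by blast
qed

lemma dboundD:
  assumes "dbound n W f" "bs \<in> lists Basis" "length bs \<le> n"
  shows "norm (iter_pderiv bs f x) \<le> W x"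
  using assms unfolding dbound_def by auto

lemma smoothI:
  assumes "\<And>n. \<exists>W. dbound n W f" shows "smooth f"
proof -
  have "iter_pderiv bs f differentiable at x" if "bs \<in> lists Basis" for bs x
    using assms[of "Suc (length bs)"] that unfolding dbound_def by auto
  then show ?thesis unfolding smooth_def by auto
qed

lemma directed_UNIV: "directed_weights UNIV"
  unfolding directed_weights_def
proof (intro conjI ballI)
  fix V W :: "'a \<Rightarrow> real"
  show "\<exists>Z\<in>UNIV. \<forall>x. V x \<le> Z x \<and> W x \<le> Z x" by (intro bexI[of _ "\<lambda>x. max (V x) (W x)"]) auto
qed auto

lemma smooth_iff: "smooth f \<longleftrightarrow> (\<forall>n. \<exists>W. dbound n W f)"
proof
  assume f: "smooth f"
  show "\<forall>n. \<exists>W. dbound n W f"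
  proof
    fix n
    have "\<exists>W\<in>UNIV. dbound n W f"
      by (rule dbound_directedI[OF directed_UNIV]) (use f in \<open>auto simp: smooth_def\<close>)
    then show "\<exists>W. dbound n W f" by blast
  qed
qed (auto intro: smoothI)

lemma smooth_differentiable: "smooth f \<Longrightarrow> f differentiable at x"
  unfolding smooth_def by (metis iter_pderiv.simps(1) lists.Nil)

lemma smooth_pd: "smooth f \<Longrightarrow> b \<in> Basis \<Longrightarrow> smooth (pd b f)"
  unfolding smooth_def by (auto simp flip: iter_pderiv_snoc)

lemma smooth_add: "smooth f \<Longrightarrow> smooth g \<Longrightarrow> smooth (\<lambda>x. f x + g x)"
  unfolding smooth_iff using dbound_add by blast

lemma smooth_mult: "smooth f \<Longrightarrow> smooth g \<Longrightarrow> smooth (\<lambda>x. f x * g x)"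
  unfolding smooth_iff using dbound_mult by blast

lemma smooth_const: "smooth (\<lambda>_. c)"
  unfolding smooth_iff using dbound_const by blast

lemma differentiable_continuous_on: "(\<And>x. f differentiable at x) \<Longrightarrow> continuous_on UNIV f"
  by (simp add: continuous_at_imp_continuous_on differentiable_imp_continuous_within)

lemma smooth_continuous: "smooth f \<Longrightarrow> continuous_on UNIV f"
  using smooth_differentiable differentiable_continuous_on by blast

subsection \<open>Slowly increasing multipliers and Schwartz functions\<close>

definition poly_weights :: "('a::euclidean_space \<Rightarrow> real) set" where
  "poly_weights = {\<lambda>x. C * (1 + norm x) ^ k | C k. 0 \<le> C}"

definition decay_weights :: "nat \<Rightarrow> ('a::euclidean_space \<Rightarrow> real) set" where
  "decay_weights k = {\<lambda>x. C / (1 + norm x) ^ k | C. 0 \<le> C}"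

text \<open>These are the multipliers of the Schwartz space: all derivatives grow at most polynomially, where
the degree of growth may depend on the order.\<close>

definition slow :: "('a::euclidean_space \<Rightarrow> complex) \<Rightarrow> bool" where
  "slow f \<longleftrightarrow> (\<forall>n. \<exists>W\<in>poly_weights. dbound n W f)"

lemma directed_poly_weights: "directed_weights (poly_weights :: ('a::euclidean_space \<Rightarrow> real) set)"
  unfolding directed_weights_def
proof (intro conjI ballI)
  show "poly_weights \<noteq> {}" unfolding poly_weights_def by auto
  fix V W :: "'a \<Rightarrow> real" assume "V \<in> poly_weights" "W \<in> poly_weights"
  then obtain A B k m where AB: "V = (\<lambda>x. A * (1 + norm x) ^ k)" "W = (\<lambda>x. B * (1 + norm x) ^ m)"
    "0 \<le> A" "0 \<le> B" unfolding poly_weights_def by blast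
  have "V x \<le> (A + B) * (1 + norm x) ^ (k + m)" "W x \<le> (A + B) * (1 + norm x) ^ (k + m)" for x
    using AB by (auto intro!: mult_mono power_increasing)
  moreover have "(\<lambda>x::'a. (A + B) * (1 + norm x) ^ (k + m)) \<in> poly_weights"
    using AB unfolding poly_weights_def by (blast intro: add_nonneg_nonneg)
  ultimately show "\<exists>Z\<in>poly_weights. \<forall>x. V x \<le> Z x \<and> W x \<le> Z x"
    by (intro bexI[of _ "\<lambda>x. (A + B) * (1 + norm x) ^ (k + m)"]) auto
qed

lemma directed_decay_weights: "directed_weights (decay_weights k :: ('a::euclidean_space \<Rightarrow> real) set)"
  unfolding directed_weights_def
proof (intro conjI ballI)
  show "decay_weights k \<noteq> {}" unfolding decay_weights_def by auto
  fix V W :: "'a \<Rightarrow> real" assume "V \<in> decay_weights k" "W \<in> decay_weights k"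
  then obtain A B where AB: "V = (\<lambda>x. A / (1 + norm x) ^ k)" "W = (\<lambda>x. B / (1 + norm x) ^ k)"
    "0 \<le> A" "0 \<le> B" unfolding decay_weights_def by blast
  have "V x \<le> (A + B) / (1 + norm x) ^ k" "W x \<le> (A + B) / (1 + norm x) ^ k" for x
    using AB by (auto intro!: divide_right_mono)
  moreover have "(\<lambda>x::'a. (A + B) / (1 + norm x) ^ k) \<in> decay_weights k"
    using AB unfolding decay_weights_def by (blast intro: add_nonneg_nonneg)
  ultimately show "\<exists>Z\<in>decay_weights k. \<forall>x. V x \<le> Z x \<and> W x \<le> Z x"
    by (intro bexI[of _ "\<lambda>x. (A + B) / (1 + norm x) ^ k"]) auto
qed

lemma one_plus_norm_pos [simp]: "0 < 1 + norm x" "0 < (1 + norm x) ^ k" "1 + norm x \<noteq> 0"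
  by (auto simp: add_pos_nonneg intro!: zero_less_power) (smt (verit) norm_ge_zero)

lemma schwartz_iff:
  "f \<in> schwartz \<longleftrightarrow> (\<forall>n k. \<exists>W\<in>decay_weights k. dbound n W f)" (is "_ \<longleftrightarrow> ?R")
proof
  assume f: "f \<in> schwartz"
  then have sm: "iter_pderiv bs f differentiable at x" if "bs \<in> lists Basis" for bs x
    using that unfolding schwartz_def smooth_def by auto
  have "\<exists>W\<in>decay_weights k. \<forall>x. norm (iter_pderiv bs f x) \<le> W x" if bs: "bs \<in> lists Basis" for k bs
  proof -
    have "bounded (range (\<lambda>x. (1 + norm x) ^ k *\<^sub>R iter_pderiv bs f x))"
      using f bs unfolding schwartz_def by auto
    then obtain C where C: "C > 0" "\<And>x. norm ((1 + norm x) ^ k *\<^sub>R iter_pderiv bs f x) \<le> C"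
      unfolding bounded_pos by auto
    have "norm (iter_pderiv bs f x) \<le> C / (1 + norm x) ^ k" for x
    proof -
      have "norm (iter_pderiv bs f x) * (1 + norm x) ^ k \<le> C"
        using C(2)[of x] by (simp add: power_abs mult.commute)
      then show ?thesis by (subst pos_le_divide_eq) auto
    qed
    then show ?thesis unfolding decay_weights_def using C(1)
      by (intro bexI[of _ "\<lambda>x. C / (1 + norm x) ^ k"]) auto
  qed
  then show ?R using dbound_directedI[OF directed_decay_weights sm] by metis
next
  assume R: ?R
  have "smooth f" using R unfolding smooth_iff by blast
  moreover have "bounded (range (\<lambda>x. (1 + norm x) ^ k *\<^sub>R iter_pderiv bs f x))"
    if "bs \<in> lists Basis" for bs k
  proof -
    obtain C where "0 \<le> C" "dbound (length bs) (\<lambda>x. C / (1 + norm x) ^ k) f"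
      using R[rule_format, of k "length bs"] unfolding decay_weights_def by auto
    then have "norm (iter_pderiv bs f x) \<le> C / (1 + norm x) ^ k" for x
      using that by (intro dboundD) auto
    then have "norm ((1 + norm x) ^ k *\<^sub>R iter_pderiv bs f x) \<le> C" for x
      by (simp add: pos_le_divide_eq power_abs mult.commute)
    then show ?thesis unfolding bounded_iff by auto
  qed
  ultimately show "f \<in> schwartz" unfolding schwartz_def by auto
qed

lemma schwartz_smooth: "f \<in> schwartz \<Longrightarrow> smooth f"
  unfolding schwartz_def by auto

lemma schwartz_bound:
  assumes "f \<in> schwartz"
  obtains C where "0 \<le> C" "\<And>x. norm (f x) \<le> C / (1 + norm x) ^ k"
proof -
  from assms obtain W where "W \<in> decay_weights k" "dbound 0 W f" unfolding schwartz_iff by blast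
  then show ?thesis using that unfolding decay_weights_def dbound_0 by auto
qed

lemma schwartz_pd: "f \<in> schwartz \<Longrightarrow> b \<in> Basis \<Longrightarrow> pd b f \<in> schwartz"
  unfolding schwartz_iff by (meson dbound_Suc)

lemma schwartz_add:
  assumes "f \<in> schwartz" "g \<in> schwartz"
  shows "(\<lambda>x. f x + g x) \<in> schwartz"
  unfolding schwartz_iff
proof (intro allI)
  fix n k
  obtain A B where "dbound n (\<lambda>x. A / (1 + norm x) ^ k) f" "dbound n (\<lambda>x. B / (1 + norm x) ^ k) g"
    "0 \<le> A" "0 \<le> B"
    using assms unfolding schwartz_iff decay_weights_def by blast
  then have "dbound n (\<lambda>x. (A + B) / (1 + norm x) ^ k) (\<lambda>x. f x + g x)" "0 \<le> A + B"
    using dbound_add by (fastforce simp: add_divide_distrib)+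
  then show "\<exists>W\<in>decay_weights k. dbound n W (\<lambda>x. f x + g x)" unfolding decay_weights_def by blast
qed

definition slow_upto :: "nat \<Rightarrow> ('a::euclidean_space \<Rightarrow> complex) \<Rightarrow> bool" where
  "slow_upto n f \<longleftrightarrow> (\<exists>W\<in>poly_weights. dbound n W f)"

lemma slow_iff_upto: "slow f \<longleftrightarrow> (\<forall>n. slow_upto n f)"
  by (simp add: slow_def slow_upto_def)

lemma slow_upto_mult: 
  assumes "slow_upto n f" "slow_upto n g" shows "slow_upto n (\<lambda>x. f x * g x)"
proof -
  obtain A j where A: "dbound n (\<lambda>x. A * (1 + norm x) ^ j) f" "0 \<le> A"
    using assms(1) unfolding slow_upto_def poly_weights_def by blast
  obtain B k where B: "dbound n (\<lambda>x. B * (1 + norm x) ^ k) g" "0 \<le> B"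
    using assms(2) unfolding slow_upto_def poly_weights_def by blast
  have "2 ^ n * (A * (1 + norm x) ^ j * (B * (1 + norm x) ^ k)) = (2 ^ n * A * B) * (1 + norm x) ^ (j + k)" for x::'a
    by (simp add: power_add)
  with dbound_mult[OF A(1) B(1)] have "dbound n (\<lambda>x. (2 ^ n * A * B) * (1 + norm x) ^ (j + k)) (\<lambda>x. f x * g x)"
    by simp
  moreover have "0 \<le> 2 ^ n * A * B" using A B by simp
  ultimately show ?thesis unfolding slow_upto_def poly_weights_def by blast
qed

definition rapid_upto :: "nat \<Rightarrow> ('a::euclidean_space \<Rightarrow> complex) \<Rightarrow> bool" where
  "rapid_upto n f \<longleftrightarrow> (\<forall>k. \<exists>W\<in>decay_weights k. dbound n W f)"

lemma schwartz_iff_upto: "f \<in> schwartz \<longleftrightarrow> (\<forall>n. rapid_upto n f)"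
  by (simp add: schwartz_iff rapid_upto_def)

lemma rapid_upto_mult:
  assumes "slow_upto n m" "rapid_upto n f"
  shows "rapid_upto n (\<lambda>x. m x * f x)"
  unfolding rapid_upto_def
proof (intro allI)
  fix k
  obtain A j where A: "dbound n (\<lambda>x. A * (1 + norm x) ^ j) m" "0 \<le> A"
    using assms(1) unfolding slow_upto_def poly_weights_def by blast
  obtain B where B: "dbound n (\<lambda>x. B / (1 + norm x) ^ (k + j)) f" "0 \<le> B"
    using assms(2) unfolding rapid_upto_def decay_weights_def by blast
  have "2 ^ n * (A * (1 + norm x) ^ j * (B / (1 + norm x) ^ (k + j))) = (2 ^ n * A * B) / (1 + norm x) ^ k" for x::'a
    by (simp add: power_add)
  with dbound_mult[OF A(1) B(1)] have "dbound n (\<lambda>x. (2 ^ n * A * B) / (1 + norm x) ^ k) (\<lambda>x. m x * f x)"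
    by simp
  moreover have "0 \<le> 2 ^ n * A * B" using A B by simp
  ultimately show "\<exists>W\<in>decay_weights k. dbound n W (\<lambda>x. m x * f x)" unfolding decay_weights_def by blast
qed

lemma slow_mult_schwartz: "slow m \<Longrightarrow> f \<in> schwartz \<Longrightarrow> (\<lambda>x. m x * f x) \<in> schwartz"
  unfolding schwartz_iff_upto slow_iff_upto by (simp add: rapid_upto_mult)

lemma slow_upto_0: "slow_upto 0 f \<longleftrightarrow> (\<exists>C k. 0 \<le> C \<and> (\<forall>x. norm (f x) \<le> C * (1 + norm x) ^ k))"
proof
  assume "\<exists>C k. 0 \<le> C \<and> (\<forall>x. norm (f x) \<le> C * (1 + norm x) ^ k)"
  then obtain C k where "0 \<le> C" "\<forall>x. norm (f x) \<le> C * (1 + norm x) ^ k" by blast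
  then show "slow_upto 0 f" unfolding slow_upto_def dbound_0 poly_weights_def
    by (intro bexI[of _ "\<lambda>x. C * (1 + norm x) ^ k"]) auto
qed (auto simp: slow_upto_def dbound_0 poly_weights_def)

lemma slow_upto_SucI:
  assumes "slow_upto 0 f" "\<And>x. (f has_derivative D x) (at x)"
    "\<And>b. b \<in> Basis \<Longrightarrow> slow_upto n (\<lambda>x. D x b)"
  shows "slow_upto (Suc n) f"
  using dbound_Suc_directed[OF directed_poly_weights, of f D n] assms
  by (simp add: slow_upto_def dbound_0)

lemma slow_const: "slow (\<lambda>_. c)"
proof -
  have "(\<lambda>_. norm c) \<in> poly_weights"
    unfolding poly_weights_def by (intro CollectI exI[of _ "norm c"] exI[of _ 0]) simp
  then show ?thesis unfolding slow_def using dbound_const by blast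
qed

lemma slow_inner: "slow (\<lambda>x. of_real (x \<bullet> v))"
  unfolding slow_iff_upto
proof
  fix n
  have 0: "slow_upto 0 (\<lambda>x::'a. of_real (x \<bullet> v))"
    unfolding slow_upto_0
  proof (intro exI conjI allI)
    fix x :: 'a
    have "norm (complex_of_real (x \<bullet> v)) \<le> norm x * norm v" using Cauchy_Schwarz_ineq2[of x v] by simp
    also have "\<dots> \<le> norm v * (1 + norm x) ^ 1" by (simp add: distrib_left mult.commute)
    finally show "norm (complex_of_real (x \<bullet> v)) \<le> norm v * (1 + norm x) ^ 1" .
  qed auto
  show "slow_upto n (\<lambda>x::'a. of_real (x \<bullet> v))"
  proof (cases n)
    case (Suc m)
    show ?thesis unfolding Suc
      by (rule slow_upto_SucI[OF 0, of "\<lambda>_ h. of_real (h \<bullet> v)"])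
        (use slow_const in \<open>auto intro!: derivative_eq_intros simp: slow_iff_upto\<close>)
  qed (use 0 in simp)
qed

text \<open>A partial derivative is a coordinate times the same function with exponent \<open>a - 1\<close>, so induction
on the order succeeds for all exponents simultaneously.\<close>

lemma slow_bracket: "slow (\<lambda>x::'a::euclidean_space. of_real ((1 + (norm x)\<^sup>2) powr a))"
  unfolding slow_iff_upto
proof
  fix n show "slow_upto n (\<lambda>x::'a. of_real ((1 + (norm x)\<^sup>2) powr a))"
  proof (induction n arbitrary: a)
    case 0
    show ?case unfolding slow_upto_0
    proof (intro exI conjI allI)
      fix x :: 'a
      have p: "0 < 1 + (norm x)\<^sup>2" by (simp add: add_pos_nonneg)
      have "(1 + (norm x)\<^sup>2) powr a \<le> (1 + (norm x)\<^sup>2) powr \<bar>a\<bar>"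
        by (intro powr_mono) auto
      also have "\<dots> \<le> ((1 + norm x)\<^sup>2) powr \<bar>a\<bar>"
        using p by (intro powr_mono2) (auto simp: power2_eq_square algebra_simps)
      also have "\<dots> = (1 + norm x) powr (2 * \<bar>a\<bar>)"
        by (simp add: powr_powr flip: powr_numeral)
      also have "\<dots> \<le> (1 + norm x) powr (real (nat \<lceil>2 * \<bar>a\<bar>\<rceil>))"
        by (intro powr_mono) auto
      also have "\<dots> = (1 + norm x) ^ (nat \<lceil>2 * \<bar>a\<bar>\<rceil>)"
        by (subst powr_realpow) auto
      finally show "norm (complex_of_real ((1 + (norm x)\<^sup>2) powr a)) \<le> 1 * (1 + norm x) ^ (nat \<lceil>2 * \<bar>a\<bar>\<rceil>)"
        by simp
    qed auto
  next
    case (Suc n)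
    show ?case
    proof (rule slow_upto_SucI)
      show "slow_upto 0 (\<lambda>x::'a. complex_of_real ((1 + (norm x)\<^sup>2) powr a))"
        using Suc.IH dbound_le unfolding slow_upto_def by blast
      fix x :: 'a
      have p: "0 < 1 + x \<bullet> x" by (simp add: add_pos_nonneg)
      show "((\<lambda>x::'a. complex_of_real ((1 + (norm x)\<^sup>2) powr a)) has_derivative
         (\<lambda>h. complex_of_real (x \<bullet> h) * (complex_of_real (2 * a) * complex_of_real ((1 + (norm x)\<^sup>2) powr (a - 1))))) (at x)"
        unfolding power2_norm_eq_inner
      proof (rule has_derivative_eq_rhs)
        have "((\<lambda>x. 1 + x \<bullet> x) has_derivative (\<lambda>h. 2 * (x \<bullet> h))) (at x)"
          by (rule derivative_eq_intros refl)+ (simp add: fun_eq_iff inner_commute)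
        from has_derivative_of_real[OF has_derivative_powr[OF this has_derivative_const[of a] p UNIV_I], where 'a=complex]
        show "((\<lambda>x. complex_of_real ((1 + x \<bullet> x) powr a)) has_derivative
           (\<lambda>h. complex_of_real ((1 + x \<bullet> x) powr a * (0 * ln (1 + x \<bullet> x) + 2 * (x \<bullet> h) * a / (1 + x \<bullet> x))))) (at x)" .
      qed (use p in \<open>auto simp: fun_eq_iff powr_diff\<close>)
    next
      fix b :: 'a
      show "slow_upto n (\<lambda>x. complex_of_real (x \<bullet> b) *
         (complex_of_real (2 * a) * complex_of_real ((1 + (norm x)\<^sup>2) powr (a - 1))))"
        using slow_inner[of b] slow_const[of "of_real (2*a)"] Suc.IH[of "a - 1"]
        unfolding slow_iff_upto by (intro slow_upto_mult) auto
    qed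
  qed
qed

lemma character_has_derivative:
  "((\<lambda>x. exp (\<i> * of_real (x \<bullet> y))) has_derivative
    (\<lambda>h. \<i> * of_real (h \<bullet> y) * exp (\<i> * of_real (x \<bullet> y)))) (at x)"
  by (rule has_derivative_compose[where f="\<lambda>x. \<i> * of_real (x \<bullet> y)" and g=exp, THEN has_derivative_eq_rhs])
    (auto intro!: derivative_eq_intros DERIV_exp[THEN has_field_derivative_imp_has_derivative] simp: fun_eq_iff mult.commute)

lemma slow_character: "slow (\<lambda>x. exp (\<i> * of_real (x \<bullet> y)))"
  unfolding slow_iff_upto
proof
  fix n show "slow_upto n (\<lambda>x. exp (\<i> * of_real (x \<bullet> y)))"
  proof (induction n)
    case 0
    have "norm (exp (\<i> * complex_of_real (x \<bullet> y))) \<le> 1 * (1 + norm x) ^ 0" for x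
      by simp
    then show ?case unfolding slow_upto_0 by (intro exI[of _ 1] exI[of _ 0]) auto
  next
    case (Suc n)
    show ?case
    proof (rule slow_upto_SucI[OF _ character_has_derivative])
      show "slow_upto 0 (\<lambda>x. exp (\<i> * of_real (x \<bullet> y)))"
        using Suc.IH dbound_le unfolding slow_upto_def by blast
      fix b
      show "slow_upto n (\<lambda>x. \<i> * of_real (b \<bullet> y) * exp (\<i> * of_real (x \<bullet> y)))"
        by (rule slow_upto_mult) (use Suc.IH slow_const in \<open>auto simp: slow_iff_upto\<close>)
    qed
  qed
qed

lemma schwartz_cmult: "f \<in> schwartz \<Longrightarrow> (\<lambda>x. c * f x) \<in> schwartz"
  using slow_mult_schwartz[OF slow_const] .

lemma schwartz_inner_mult: "f \<in> schwartz \<Longrightarrow> (\<lambda>x. of_real (x \<bullet> v) * f x) \<in> schwartz"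
  using slow_mult_schwartz[OF slow_inner] .

lemma rapid_upto_0: "rapid_upto 0 f \<longleftrightarrow> (\<forall>k. \<exists>C. \<forall>x. norm (f x) * (1 + norm x) ^ k \<le> C)"
proof
  assume "rapid_upto 0 f"
  then have "\<exists>C. \<forall>x. norm (f x) \<le> C / (1 + norm x) ^ k" for k
    unfolding rapid_upto_def dbound_0 decay_weights_def by fastforce
  then show "\<forall>k. \<exists>C. \<forall>x. norm (f x) * (1 + norm x) ^ k \<le> C"
    by (simp add: pos_le_divide_eq)
next
  assume R: "\<forall>k. \<exists>C. \<forall>x. norm (f x) * (1 + norm x) ^ k \<le> C"
  show "rapid_upto 0 f" unfolding rapid_upto_def dbound_0
  proof
    fix k
    obtain C where C: "\<And>x. norm (f x) * (1 + norm x) ^ k \<le> C" using R by blast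
    have "0 \<le> C" using C[of 0] by (simp add: order_trans[OF norm_ge_zero])
    then show "\<exists>W\<in>decay_weights k. \<forall>x. norm (f x) \<le> W x"
      unfolding decay_weights_def using C
      by (intro bexI[of _ "\<lambda>x. C / (1 + norm x) ^ k"]) (auto simp: pos_le_divide_eq)
  qed
qed

lemma rapid_upto_SucI:
  assumes "rapid_upto 0 f" "\<And>x. (f has_derivative D x) (at x)"
    "\<And>b. b \<in> Basis \<Longrightarrow> rapid_upto n (\<lambda>x. D x b)"
  shows "rapid_upto (Suc n) f"
  using dbound_Suc_directed[OF directed_decay_weights, of _ f D n] assms
  by (simp add: rapid_upto_def dbound_0)

section \<open>The Fourier transform on the Schwartz space\<close>

subsection \<open>Integrability of Schwartz functions\<close>

text \<open>Each factor \<open>(1 + norm x)\<^sup>2\<close> dominates \<open>1 + (x \<bullet> b)\<^sup>2\<close> for one basis vector \<open>b\<close>, which reduces the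
claim to the one-dimensional integral of \<open>1 / (1 + y\<^sup>2)\<close>.\<close>

lemma integrable_inverse_one_plus_norm_power:
  "integrable lborel (\<lambda>x::'a::euclidean_space. 1 / (1 + norm x) ^ (2 * DIM('a)))"
proof (rule Bochner_Integration.integrable_bound)
  let ?q = "\<lambda>y::real. inverse (1 + y\<^sup>2)"
  show "integrable lborel (\<lambda>x::'a. \<Prod>b\<in>Basis. ?q (x \<bullet> b))"
  proof (rule integrableI_nonneg)
    have one: "(\<integral>\<^sup>+y. ennreal (?q y) \<partial>lborel) < \<infinity>"
    proof -
      have "integrable lborel ?q"
        using integrable_inverse_1_plus_square by (simp add: set_integrable_def)
      then show ?thesis
        using integrableD(2)[of lborel ?q] by (simp add: less_top abs_of_nonneg)
    qed
    have "(\<integral>\<^sup>+x. ennreal (\<Prod>b\<in>Basis. ?q (x \<bullet> b)) \<partial>(lborel::'a measure)) =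
        (\<integral>\<^sup>+x. (\<Prod>b\<in>Basis. ennreal (?q (x \<bullet> b))) \<partial>(lborel::'a measure))"
      by (simp add: prod_ennreal)
    also have "\<dots> = (\<Prod>b\<in>(Basis::'a set). \<integral>\<^sup>+y. ennreal (?q y) \<partial>lborel)"
      by (rule nn_integral_lborel_prod) auto
    also have "\<dots> < \<infinity>"
      using one by (simp add: power_less_top_ennreal)
    finally show "(\<integral>\<^sup>+x. ennreal (\<Prod>b\<in>Basis. ?q (x \<bullet> b)) \<partial>(lborel::'a measure)) < \<infinity>" .
  qed (auto intro!: prod_nonneg)
  show "AE x::'a in lborel. norm (1 / (1 + norm x) ^ (2 * DIM('a))) \<le> norm (\<Prod>b\<in>Basis. ?q (x \<bullet> b))"
  proof (rule AE_I2)
    fix x :: 'a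
    have "(\<Prod>b\<in>(Basis::'a set). 1 / (1 + norm x)\<^sup>2) \<le> (\<Prod>b\<in>Basis. ?q (x \<bullet> b))"
    proof (rule prod_mono, safe)
      fix b :: 'a assume b: "b \<in> Basis"
      have "1 + (x \<bullet> b)\<^sup>2 \<le> 1 + (norm x)\<^sup>2"
        using Basis_le_norm[OF b, of x] by (simp add: abs_le_square_iff[symmetric])
      also have "\<dots> \<le> (1 + norm x)\<^sup>2" by (simp add: power2_eq_square algebra_simps)
      finally show "1 / (1 + norm x)\<^sup>2 \<le> ?q (x \<bullet> b)"
        by (simp add: inverse_eq_divide frac_le add_pos_nonneg)
    qed auto
    moreover have "(\<Prod>b\<in>(Basis::'a set). 1 / (1 + norm x)\<^sup>2) = 1 / (1 + norm x) ^ (2 * DIM('a))"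
      by (simp add: power_mult power_divide)
    moreover have "0 \<le> (\<Prod>b\<in>Basis. ?q (x \<bullet> b))" by (intro prod_nonneg) auto
    ultimately show "norm (1 / (1 + norm x) ^ (2 * DIM('a))) \<le> norm (\<Prod>b\<in>Basis. ?q (x \<bullet> b))"
      by simp
  qed
qed auto

lemma one_plus_le_twice_one_plus_sq: "1 + r \<le> 2 * (1 + (r::real)\<^sup>2)"
proof -
  have "2 * (1 + r\<^sup>2) - (1 + r) = 2 * (r - 1 / 4)\<^sup>2 + 7 / 8"
    by (simp add: power2_eq_square field_simps)
  moreover have "0 \<le> (r - 1 / 4)\<^sup>2" by simp
  ultimately show ?thesis by linarith
qed

lemma schwartz_measurable [measurable_dest]: "f \<in> schwartz \<Longrightarrow> f \<in> borel_measurable borel"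
  by (intro borel_measurable_continuous_onI smooth_continuous schwartz_smooth)

lemma schwartz_integrable:
  fixes f :: "'a::euclidean_space \<Rightarrow> complex"
  assumes "f \<in> schwartz" shows "integrable lborel f"
proof -
  obtain C where C: "0 \<le> C" "\<And>x. norm (f x) \<le> C / (1 + norm x) ^ (2 * DIM('a))"
    using schwartz_bound[OF assms] by metis
  have "integrable lborel (\<lambda>x::'a. C * (1 / (1 + norm x) ^ (2 * DIM('a))))"
    by (intro integrable_mult_right integrable_inverse_one_plus_norm_power)
  then show ?thesis
    by (rule Bochner_Integration.integrable_bound)
      (use C schwartz_measurable[OF assms] in \<open>auto simp: abs_of_nonneg\<close>)
qed

lemma schwartz_uminus: "f \<in> schwartz \<Longrightarrow> (\<lambda>x. - f x) \<in> schwartz"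
  using schwartz_cmult[of f "-1"] by simp

lemma schwartz_zero: "(\<lambda>_. 0) \<in> schwartz"
  unfolding schwartz_iff_upto
proof
  fix n show "rapid_upto n (\<lambda>_::'a. 0)"
  proof (induction n)
    case (Suc n)
    have "rapid_upto 0 (\<lambda>_::'a. 0)" by (auto simp: rapid_upto_0)
    then show ?case by (rule rapid_upto_SucI[where D="\<lambda>_ _. 0"]) (use Suc in auto)
  qed (auto simp: rapid_upto_0)
qed

lemma schwartz_sum:
  assumes "\<And>i. i \<in> I \<Longrightarrow> f i \<in> schwartz" shows "(\<lambda>x. \<Sum>i\<in>I. f i x) \<in> schwartz"
  using assms by (induction I rule: infinite_finite_induct) (auto intro: schwartz_zero schwartz_add)

text \<open>From \<open>1 + r \<le> exp r\<close> and completion of the square in \<open>k r - t r\<^sup>2\<close>.\<close>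

lemma gaussian_decay_bound:
  fixes r t :: real assumes "0 < t" "0 \<le> r"
  shows "exp (- t * r\<^sup>2) * (1 + r) ^ k \<le> exp ((real k)\<^sup>2 / (4 * t))"
proof -
  have "(1 + r) ^ k \<le> exp r ^ k" using assms by (intro power_mono exp_ge_add_one_self) auto
  also have "\<dots> = exp (real k * r)" by (simp add: exp_of_nat_mult)
  finally have "exp (- t * r\<^sup>2) * (1 + r) ^ k \<le> exp (- t * r\<^sup>2) * exp (real k * r)" by simp
  also have "\<dots> = exp (real k * r - t * r\<^sup>2)" by (simp add: exp_diff exp_minus field_simps)
  also have "\<dots> \<le> exp ((real k)\<^sup>2 / (4 * t))"
  proof -
    have "0 \<le> (real k - 2 * t * r)\<^sup>2 / (4 * t)" using assms by simp
    also have "\<dots> = (real k)\<^sup>2 / (4 * t) - (real k * r - t * r\<^sup>2)"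
      using assms by (simp add: field_simps power2_eq_square)
    finally show ?thesis by simp
  qed
  finally show ?thesis .
qed

lemma gaussian_has_derivative:
  "((\<lambda>x::'a::euclidean_space. complex_of_real (exp (- t * (norm x)\<^sup>2))) has_derivative
     (\<lambda>h. of_real (x \<bullet> h) * (of_real (- 2 * t) * of_real (exp (- t * (norm x)\<^sup>2))))) (at x)"
  unfolding power2_norm_eq_inner
proof (rule has_derivative_eq_rhs)
  have "((\<lambda>x. - t * (x \<bullet> x)) has_derivative (\<lambda>h. - 2 * t * (x \<bullet> h))) (at x)"
    by (rule derivative_eq_intros refl)+ (simp add: fun_eq_iff inner_commute)
  from has_derivative_of_real[OF has_derivative_exp[OF this]]
  show "((\<lambda>x. complex_of_real (exp (- t * (x \<bullet> x)))) has_derivative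
     (\<lambda>h. complex_of_real (- 2 * t * (x \<bullet> h) * exp (- t * (x \<bullet> x))))) (at x)" .
qed (auto simp: fun_eq_iff)

lemma schwartz_gaussian:
  assumes "0 < t" shows "(\<lambda>x::'a::euclidean_space. complex_of_real (exp (- t * (norm x)\<^sup>2))) \<in> schwartz"
  unfolding schwartz_iff_upto
proof
  have 0: "rapid_upto 0 (\<lambda>x::'a. complex_of_real (exp (- t * (norm x)\<^sup>2)))"
    unfolding rapid_upto_0 using gaussian_decay_bound[OF assms norm_ge_zero]
    by (auto intro!: exI[of _ "exp ((real _)\<^sup>2 / (4 * t))"])
  fix n show "rapid_upto n (\<lambda>x::'a. complex_of_real (exp (- t * (norm x)\<^sup>2)))"
  proof (induction n)
    case (Suc n)
    show ?case
    proof (rule rapid_upto_SucI[OF 0 gaussian_has_derivative])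
      fix b :: 'a
      show "rapid_upto n (\<lambda>x. complex_of_real (x \<bullet> b) *
        (complex_of_real (- 2 * t) * complex_of_real (exp (- t * (norm x)\<^sup>2))))"
        using slow_inner[of b] slow_const[of "of_real (- 2 * t)"] Suc
        by (intro rapid_upto_mult) (auto simp: slow_iff_upto)
    qed
  qed (rule 0)
qed

subsection \<open>Differentiation and the Fourier transform\<close>

lemma schwartz_character_mult: "f \<in> schwartz \<Longrightarrow> (\<lambda>x. exp (- \<i> * of_real (x \<bullet> \<xi>)) * f x) \<in> schwartz"
  using slow_mult_schwartz[OF slow_character[of "- \<xi>"]] by simp

lemma fourier_integrable: "f \<in> schwartz \<Longrightarrow> integrable lborel (\<lambda>x. exp (- \<i> * of_real (x \<bullet> \<xi>)) * f x)"
  by (intro schwartz_integrable schwartz_character_mult)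

lemma fourier_add:
  "f \<in> schwartz \<Longrightarrow> g \<in> schwartz \<Longrightarrow> fourier (\<lambda>x. f x + g x) \<xi> = fourier f \<xi> + fourier g \<xi>"
  unfolding fourier_def distrib_left
  by (intro Bochner_Integration.integral_add fourier_integrable)

lemma fourier_cmult: "fourier (\<lambda>x. c * f x) \<xi> = c * fourier f \<xi>"
  unfolding fourier_def by (simp add: mult.left_commute[of _ c])

lemma fourier_sum:
  assumes "\<And>i. i \<in> I \<Longrightarrow> f i \<in> schwartz"
  shows "fourier (\<lambda>x. \<Sum>i\<in>I. f i x) \<xi> = (\<Sum>i\<in>I. fourier (f i) \<xi>)"
  unfolding fourier_def sum_distrib_left
  by (intro Bochner_Integration.integral_sum fourier_integrable assms)

lemma norm_fourier_le: 
  shows "norm (fourier f \<xi>) \<le> (\<integral>x. norm (f x) \<partial>lborel)"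
proof -
  have "norm (fourier f \<xi>) \<le> (\<integral>x. norm (exp (- \<i> * of_real (x \<bullet> \<xi>)) * f x) \<partial>lborel)"
    unfolding fourier_def by (rule integral_norm_bound)
  then show ?thesis by (simp add: norm_mult)
qed

lemma schwartz_moment: 
  assumes "f \<in> schwartz" shows "(\<lambda>x. - \<i> * of_real (x \<bullet> v) * f x) \<in> schwartz"
  using schwartz_cmult[OF schwartz_inner_mult[OF assms], of "-\<i>" v] by (simp add: mult.assoc)

text \<open>The expansion \<open>exp (i \<theta>) = 1 + i \<theta> + O(\<theta>\<^sup>2)\<close> under the integral gives the total derivative at once:
the remainder is at most \<open>(norm h)\<^sup>2\<close> times the second absolute moment of \<open>f\<close>.\<close>

lemma fourier_has_derivative:
  fixes f :: "'a::euclidean_space \<Rightarrow> complex"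
  assumes f: "f \<in> schwartz"
  shows "(fourier f has_derivative (\<lambda>h. fourier (\<lambda>x. - \<i> * of_real (x \<bullet> h) * f x) \<xi>)) (at \<xi>)"
  unfolding has_derivative_at
proof
  let ?D = "\<lambda>h. fourier (\<lambda>x. - \<i> * of_real (x \<bullet> h) * f x) \<xi>"
  have xx: "integrable lborel (\<lambda>x. (norm x) ^ k * norm (f x))" for k
  proof -
    have "integrable lborel (\<lambda>x. complex_of_real ((1 + (norm x)\<^sup>2) powr (real k)) * f x)"
      by (intro schwartz_integrable slow_mult_schwartz slow_bracket f)
    then show ?thesis
    proof (rule Bochner_Integration.integrable_bound)
      show "AE x in lborel. norm (norm x ^ k * norm (f x))
          \<le> norm (complex_of_real ((1 + (norm x)\<^sup>2) powr real k) * f x)"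
      proof (rule AE_I2)
        fix x :: 'a
        have "norm x \<le> 1 + (norm x)\<^sup>2"
          using zero_le_power2[of "norm x - 1 / 2"] by (simp add: power2_eq_square algebra_simps)
        then have "norm x ^ k \<le> (1 + (norm x)\<^sup>2) ^ k" by (intro power_mono) auto
        also have "\<dots> = (1 + (norm x)\<^sup>2) powr real k"
          by (subst powr_realpow) (auto simp: add_pos_nonneg)
        finally show "norm (norm x ^ k * norm (f x))
          \<le> norm (complex_of_real ((1 + (norm x)\<^sup>2) powr real k) * f x)"
          by (simp add: norm_mult mult_right_mono)
      qed
    qed (use schwartz_measurable[OF f] in measurable)
  qed
  show "bounded_linear ?D"
  proof (rule bounded_linear_intro)
    fix x y :: 'a and r :: real
    have "(\<lambda>z. - \<i> * of_real (z \<bullet> (x + y)) * f z) = (\<lambda>z. - \<i> * of_real (z \<bullet> x) * f z + - \<i> * of_real (z \<bullet> y) * f z)"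
      by (simp add: inner_add_right algebra_simps)
    then show "?D (x + y) = ?D x + ?D y"
      by (simp only: fourier_add schwartz_moment f)
    have "(\<lambda>z. - \<i> * of_real (z \<bullet> (r *\<^sub>R x)) * f z) = (\<lambda>z. of_real r * (- \<i> * of_real (z \<bullet> x) * f z))"
      by (simp add: algebra_simps)
    then show "?D (r *\<^sub>R x) = r *\<^sub>R ?D x"
      by (simp only: fourier_cmult scaleR_conv_of_real)
    have "norm (?D x) \<le> (\<integral>z. norm (- \<i> * of_real (z \<bullet> x) * f z) \<partial>lborel)"
      by (rule norm_fourier_le)
    also have "\<dots> \<le> (\<integral>z. norm x * (norm z ^ 1 * norm (f z)) \<partial>lborel)"
    proof (rule integral_mono)
      show "integrable lborel (\<lambda>z. norm (- \<i> * of_real (z \<bullet> x) * f z))"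
        by (intro integrable_norm schwartz_integrable schwartz_moment f)
      show "integrable lborel (\<lambda>z. norm x * (norm z ^ 1 * norm (f z)))"
        by (intro integrable_mult_right xx)
      show "norm (- \<i> * of_real (z \<bullet> x) * f z) \<le> norm x * (norm z ^ 1 * norm (f z))" for z
        using mult_right_mono[OF Cauchy_Schwarz_ineq2[of z x] norm_ge_zero[of "f z"]]
        by (simp add: norm_mult mult_ac)
    qed
    finally show "norm (?D x) \<le> norm x * (\<integral>z. norm z ^ 1 * norm (f z) \<partial>lborel)" by simp
  qed
  let ?K = "\<integral>x. norm x ^ 2 * norm (f x) \<partial>lborel"
  let ?R = "\<lambda>h x. iexp (- (x \<bullet> h)) - (\<Sum>k\<le>1. (\<i> * of_real (- (x \<bullet> h))) ^ k / fact k)"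
  have rem: "norm (fourier f (\<xi> + h) - fourier f \<xi> - ?D h) \<le> (norm h)\<^sup>2 * ?K" for h
  proof -
    have "fourier f (\<xi> + h) - fourier f \<xi> - ?D h =
      (\<integral>x. exp (- \<i> * of_real (x \<bullet> (\<xi> + h))) * f x - exp (- \<i> * of_real (x \<bullet> \<xi>)) * f x
         - exp (- \<i> * of_real (x \<bullet> \<xi>)) * (- \<i> * of_real (x \<bullet> h) * f x) \<partial>lborel)"
      unfolding fourier_def
      by (subst Bochner_Integration.integral_diff[symmetric] ; (intro Bochner_Integration.integrable_diff fourier_integrable schwartz_moment f)?)+ simp
    also have "\<dots> = (\<integral>x. exp (- \<i> * of_real (x \<bullet> \<xi>)) * ?R h x * f x \<partial>lborel)"
      by (intro Bochner_Integration.integral_cong refl)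
        (simp add: inner_add_right algebra_simps exp_add exp_diff exp_minus field_simps)
    also have "norm \<dots> \<le> (\<integral>x. (norm h)\<^sup>2 * (norm x ^ 2 * norm (f x)) \<partial>lborel)"
    proof (rule order_trans[OF integral_norm_bound integral_mono_AE'])
      show "integrable lborel (\<lambda>x. (norm h)\<^sup>2 * (norm x ^ 2 * norm (f x)))"
        by (intro integrable_mult_right xx)
      show "AE x in lborel. norm (exp (- \<i> * of_real (x \<bullet> \<xi>)) * ?R h x * f x)
         \<le> (norm h)\<^sup>2 * (norm x ^ 2 * norm (f x))"
      proof (rule AE_I2)
        fix x :: 'a
        have "norm (?R h x) \<le> \<bar>- (x \<bullet> h)\<bar> ^ Suc 1 / fact (Suc 1)"
          by (rule iexp_approx1)
        also have "\<dots> \<le> \<bar>x \<bullet> h\<bar>\<^sup>2" by (simp add: numeral_2_eq_2)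
        also have "\<dots> \<le> (norm x * norm h)\<^sup>2" by (intro power_mono Cauchy_Schwarz_ineq2) auto
        finally have *: "norm (?R h x) \<le> (norm h)\<^sup>2 * (norm x)\<^sup>2"
          by (simp add: power_mult_distrib mult.commute)
        have "norm (exp (- \<i> * of_real (x \<bullet> \<xi>))) = 1" by simp
        then show "norm (exp (- \<i> * of_real (x \<bullet> \<xi>)) * ?R h x * f x)
         \<le> (norm h)\<^sup>2 * (norm x ^ 2 * norm (f x))"
          using mult_right_mono[OF * norm_ge_zero[of "f x"]]
          by (simp only: norm_mult mult_1_left mult.assoc)
      qed
    qed auto
    finally show ?thesis by simp
  qed
  show "(\<lambda>h. norm (fourier f (\<xi> + h) - fourier f \<xi> - ?D h) / norm h) \<midarrow>0\<rightarrow> 0"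
  proof (rule Lim_null_comparison)
    have "norm (norm (fourier f (\<xi> + h) - fourier f \<xi> - ?D h) / norm h) \<le> norm h * ?K" for h
      using rem[of h] by (cases "h = 0") (auto simp: divide_le_eq power2_eq_square mult_ac)
    then show "\<forall>\<^sub>F h in at 0. norm (norm (fourier f (\<xi> + h) - fourier f \<xi> - ?D h) / norm h) \<le> norm h * ?K"
      by (intro always_eventually allI)
    show "(\<lambda>h. norm h * ?K) \<midarrow>0\<rightarrow> 0" by (auto intro!: tendsto_eq_intros)
  qed
qed

text \<open>By translation invariance the difference quotients of \<open>g\<close> have integral \<open>0\<close>. They converge
dominatedly: on a segment of length at most \<open>1\<close> starting in \<open>x\<close> the weight \<open>1 + norm x\<close> changes
at most by a factor \<open>2\<close>, so that the mean value theorem provides an integrable bound.\<close>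

lemma integral_pd_eq_0:
  fixes g :: "'a::euclidean_space \<Rightarrow> complex"
  assumes g: "g \<in> schwartz" and b: "b \<in> Basis"
  shows "(\<integral>x. pd b g x \<partial>lborel) = 0"
proof -
  let ?n = "2 * DIM('a)"
  let ?q = "\<lambda>n x. of_real (real (Suc n)) * (g (x + (1 / real (Suc n)) *\<^sub>R b) - g x)"
  have gm [measurable]: "g \<in> borel_measurable borel" by (rule schwartz_measurable[OF g])
  have gD: "(g has_derivative (\<lambda>h. pd h g x)) (at x)" for x
    by (rule has_derivative_frechet[OF smooth_differentiable[OF schwartz_smooth[OF g]]])
  then have pd_scale: "pd (r *\<^sub>R v) g x = r *\<^sub>R pd v g x" for r v x
    using linear_scale[OF has_derivative_linear] by blast
  obtain C where C: "0 \<le> C" "\<And>x. norm (pd b g x) \<le> C / (1 + norm x) ^ ?n"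
    using schwartz_bound[OF schwartz_pd[OF g b]] by metis
  have line: "((\<lambda>t. g (x + t *\<^sub>R b)) has_derivative (\<lambda>t. t *\<^sub>R pd b g (x + s *\<^sub>R b))) (at s)" for x s
  proof -
    have l: "((\<lambda>t. x + t *\<^sub>R b) has_derivative (\<lambda>t. t *\<^sub>R b)) (at s)"
      by (auto intro!: derivative_eq_intros)
    show ?thesis using has_derivative_compose[OF l gD] by (simp add: pd_scale)
  qed
  have int0: "integral\<^sup>L lborel (?q n) = 0" for n
  proof -
    let ?v = "(1 / real (Suc n)) *\<^sub>R b"
    have "integral\<^sup>L lborel g = integral\<^sup>L (distr lborel borel ((+) ?v)) g"
      by (simp add: lborel_distr_plus)
    also have "\<dots> = (\<integral>x. g (x + ?v) \<partial>lborel)"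
      by (subst integral_distr) (auto simp: add.commute)
    finally have 1: "integral\<^sup>L lborel g = (\<integral>x. g (x + ?v) \<partial>lborel)" .
    have "integrable (distr lborel borel ((+) ?v)) g"
      using schwartz_integrable[OF g] by (simp add: lborel_distr_plus)
    then have "integrable lborel (\<lambda>x. g (x + ?v))"
      by (subst (asm) integrable_distr_eq) (auto simp: add.commute)
    then show ?thesis
      using schwartz_integrable[OF g] 1 by simp
  qed
  have "(\<lambda>n. integral\<^sup>L lborel (?q n)) \<longlonglongrightarrow> (\<integral>x. pd b g x \<partial>lborel)"
  proof (rule integral_dominated_convergence[where w = "\<lambda>x. C * 2 ^ ?n * (1 / (1 + norm x) ^ ?n)"])
    show "pd b g \<in> borel_measurable lborel" using schwartz_measurable[OF schwartz_pd[OF g b]] by simp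
    show "integrable lborel (\<lambda>x::'a. C * 2 ^ ?n * (1 / (1 + norm x) ^ ?n))"
      by (intro integrable_mult_right integrable_inverse_one_plus_norm_power)
    show "AE x in lborel. (\<lambda>n. ?q n x) \<longlonglongrightarrow> pd b g x"
    proof (rule AE_I2)
      fix x
      have L: "(\<lambda>h. norm (g (x + h *\<^sub>R b) - g x - h *\<^sub>R pd b g x) / norm h) \<midarrow>0\<rightarrow> 0"
        using line[of x 0] by (simp add: has_derivative_at)
      have E: "norm (g (x + h *\<^sub>R b) - g x - h *\<^sub>R pd b g x) / norm h =
          norm ((1 / h) *\<^sub>R (g (x + h *\<^sub>R b) - g x) - pd b g x)" if "h \<noteq> 0" for h
      proof -
        have "(1 / h) *\<^sub>R (g (x + h *\<^sub>R b) - g x) - pd b g x = (1 / h) *\<^sub>R (g (x + h *\<^sub>R b) - g x - h *\<^sub>R pd b g x)"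
          using that by (simp add: scaleR_diff_right)
        then show ?thesis by (simp add: divide_inverse)
      qed
      have "(\<lambda>h. norm ((1 / h) *\<^sub>R (g (x + h *\<^sub>R b) - g x) - pd b g x)) \<midarrow>0\<rightarrow> 0"
        by (rule Lim_transform_eventually[OF L]) (simp only: eventually_at_filter, intro always_eventually allI impI E)
      then have "((\<lambda>t. (1 / t) *\<^sub>R (g (x + t *\<^sub>R b) - g x)) \<longlongrightarrow> pd b g x) (at 0)"
        by (rule LIM_zero_cancel[OF tendsto_norm_zero_cancel])
      moreover have "filterlim (\<lambda>n. 1 / real (Suc n)) (at 0) sequentially"
        using LIMSEQ_inverse_real_of_nat unfolding filterlim_at
        by (auto simp: inverse_eq_divide intro!: always_eventually)
      ultimately have "(\<lambda>n. (1 / (1 / real (Suc n))) *\<^sub>R (g (x + (1 / real (Suc n)) *\<^sub>R b) - g x)) \<longlonglongrightarrow> pd b g x"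
        by (rule filterlim_compose)
      then show "(\<lambda>n. ?q n x) \<longlonglongrightarrow> pd b g x" by (simp add: scaleR_conv_of_real)
    qed
    show "AE x in lborel. norm (?q n x) \<le> C * 2 ^ ?n * (1 / (1 + norm x) ^ ?n)" for n
    proof (rule AE_I2)
      fix x
      let ?t = "1 / real (Suc n)"
      have "continuous_on {0..?t} (\<lambda>t. g (x + t *\<^sub>R b))"
        using line has_derivative_continuous by (intro continuous_at_imp_continuous_on) blast
      then obtain s where s: "s \<in> {0<..<?t}"
        "norm (g (x + ?t *\<^sub>R b) - g (x + 0 *\<^sub>R b)) \<le> norm ((?t - 0) *\<^sub>R pd b g (x + s *\<^sub>R b))"
        using mvt_general[of 0 ?t "\<lambda>t. g (x + t *\<^sub>R b)", OF _ _ line] by fastforce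
      have "norm x \<le> norm (x + s *\<^sub>R b) + norm (s *\<^sub>R b)"
        using norm_triangle_ineq4[of "x + s *\<^sub>R b" "s *\<^sub>R b"] by simp
      moreover have "norm (s *\<^sub>R b) \<le> 1"
        using s(1) b by (auto simp: norm_Basis) (smt (verit, best) divide_le_eq_1_pos of_nat_0_le_iff)
      ultimately have "1 + norm x \<le> 2 * (1 + norm (x + s *\<^sub>R b))"
        by (smt (verit) norm_ge_zero)
      then have "(1 + norm x) ^ ?n \<le> 2 ^ ?n * (1 + norm (x + s *\<^sub>R b)) ^ ?n"
        unfolding power_mult_distrib[symmetric] by (intro power_mono) auto
      then have "C / (1 + norm (x + s *\<^sub>R b)) ^ ?n \<le> C * 2 ^ ?n / (1 + norm x) ^ ?n"
        using C(1) by (simp add: divide_simps) (metis mult.assoc mult_left_mono)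
      with C(2)[of "x + s *\<^sub>R b"] have P: "norm (pd b g (x + s *\<^sub>R b)) \<le> C * 2 ^ ?n / (1 + norm x) ^ ?n"
        by linarith
      have "norm (?q n x) = real (Suc n) * norm (g (x + ?t *\<^sub>R b) - g x)"
        by (simp only: norm_mult norm_of_real abs_of_nat)
      also have "\<dots> \<le> real (Suc n) * (?t * norm (pd b g (x + s *\<^sub>R b)))"
        using s(2) by (intro mult_left_mono) auto
      also have "\<dots> = norm (pd b g (x + s *\<^sub>R b))" by simp
      finally show "norm (?q n x) \<le> C * 2 ^ ?n * (1 / (1 + norm x) ^ ?n)"
        using P by simp
    qed
  qed measurable
  then show ?thesis unfolding int0 using LIMSEQ_unique tendsto_const by blast
qed

lemma fourier_pd:
  assumes f: "f \<in> schwartz" and b: "b \<in> Basis"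
  shows "fourier (pd b f) \<xi> = \<i> * of_real (\<xi> \<bullet> b) * fourier f \<xi>"
proof -
  let ?e = "\<lambda>x. exp (- \<i> * of_real (x \<bullet> \<xi>))"
  have fd: "f differentiable at x" for x by (rule smooth_differentiable[OF schwartz_smooth[OF f]])
  have eD: "(?e has_derivative (\<lambda>h. - \<i> * of_real (h \<bullet> \<xi>) * ?e x)) (at x)" for x
    using character_has_derivative[of "- \<xi>" x] by simp
  have "pd b (\<lambda>x. ?e x * f x) x = ?e x * pd b f x - \<i> * of_real (\<xi> \<bullet> b) * (?e x * f x)" for x
  proof -
    have "?e differentiable at x" using eD unfolding differentiable_def by blast
    from pd_mult[OF this fd, of b] show ?thesis
      unfolding pd_eq[OF eD] by (simp add: inner_commute[of b] algebra_simps)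
  qed
  then have "0 = (\<integral>x. ?e x * pd b f x - \<i> * of_real (\<xi> \<bullet> b) * (?e x * f x) \<partial>lborel)"
    using integral_pd_eq_0[OF schwartz_character_mult[OF f] b, of \<xi>] by simp
  also have "\<dots> = fourier (pd b f) \<xi> - \<i> * of_real (\<xi> \<bullet> b) * fourier f \<xi>"
    unfolding fourier_def
    by (subst Bochner_Integration.integral_diff)
      (use fourier_integrable[OF f, of \<xi>] fourier_integrable[OF schwartz_pd[OF f b], of \<xi>] in auto)
  finally show ?thesis by simp
qed

text \<open>Multiplication of the transform of \<open>f\<close> by \<open>1 + \<bar>\<xi>\<bar>\<^sup>2\<close> produces the transform of \<open>f - \<Delta> f\<close>, which is
bounded by an \<open>L\<^sup>1\<close> norm. Iterating this gives rapid decay, and derivatives of a transform are again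
transforms of Schwartz functions.\<close>

lemma fourier_schwartz:
  fixes f :: "'a::euclidean_space \<Rightarrow> complex"
  assumes "f \<in> schwartz" shows "fourier f \<in> schwartz"
  unfolding schwartz_iff_upto
proof
  have "\<exists>C. \<forall>\<xi>. norm (fourier g \<xi>) * (1 + (norm \<xi>)\<^sup>2) ^ k \<le> C"
    if "g \<in> schwartz" for k and g :: "'a \<Rightarrow> complex"
    using that
  proof (induction k arbitrary: g)
    case 0
    then show ?case using norm_fourier_le by auto
  next
    case (Suc k)
    let ?L = "\<lambda>x. g x + (-1) * (\<Sum>b\<in>Basis. pd b (pd b g) x)"
    have S: "(\<lambda>x. \<Sum>b\<in>Basis. pd b (pd b g) x) \<in> schwartz"
      by (intro schwartz_sum schwartz_pd Suc.prems)
    then have "?L \<in> schwartz" by (intro schwartz_add schwartz_cmult Suc.prems)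
    then obtain C where C: "\<And>\<xi>. norm (fourier ?L \<xi>) * (1 + (norm \<xi>)\<^sup>2) ^ k \<le> C"
      using Suc.IH by blast
    have "fourier ?L \<xi> = of_real (1 + (norm \<xi>)\<^sup>2) * fourier g \<xi>" for \<xi>
    proof -
      have "fourier ?L \<xi> = fourier g \<xi> + (-1) * (\<Sum>b\<in>Basis. fourier (pd b (pd b g)) \<xi>)"
        by (subst fourier_add[OF Suc.prems schwartz_cmult[OF S]], subst fourier_cmult, subst fourier_sum)
          (auto intro: schwartz_pd Suc.prems)
      also have "(\<Sum>b\<in>Basis. fourier (pd b (pd b g)) \<xi>) = (\<Sum>b\<in>Basis. - of_real ((\<xi> \<bullet> b)\<^sup>2) * fourier g \<xi>)"
        by (intro sum.cong refl)
          (simp add: fourier_pd schwartz_pd Suc.prems power2_eq_square algebra_simps)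
      also have "\<dots> = - of_real ((norm \<xi>)\<^sup>2) * fourier g \<xi>"
        unfolding power2_norm_eq_inner euclidean_inner[of \<xi> \<xi>]
        by (simp add: sum_negf power2_eq_square flip: sum_distrib_right)
      finally show ?thesis by (simp add: algebra_simps)
    qed
    then have "norm (fourier ?L \<xi>) = (1 + (norm \<xi>)\<^sup>2) * norm (fourier g \<xi>)" for \<xi>
      by (simp add: norm_mult del: of_real_add of_real_power)
    then have "norm (fourier g \<xi>) * (1 + (norm \<xi>)\<^sup>2) ^ Suc k \<le> C" for \<xi>
      using C[of \<xi>] by (simp add: mult_ac)
    then show ?case by blast
  qed
  note bd = this
  have 0: "rapid_upto 0 (fourier g)" if g: "g \<in> schwartz" for g :: "'a \<Rightarrow> complex"
    unfolding rapid_upto_0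
  proof
    fix k
    obtain C where C: "\<And>\<xi>. norm (fourier g \<xi>) * (1 + (norm \<xi>)\<^sup>2) ^ k \<le> C"
      using bd[OF g] by blast
    have "norm (fourier g \<xi>) * (1 + norm \<xi>) ^ k \<le> 2 ^ k * C" for \<xi>
    proof -
      have "1 + norm \<xi> \<le> 2 * (1 + (norm \<xi>)\<^sup>2)"
        by (rule one_plus_le_twice_one_plus_sq)
      then have "(1 + norm \<xi>) ^ k \<le> 2 ^ k * (1 + (norm \<xi>)\<^sup>2) ^ k"
        unfolding power_mult_distrib[symmetric] by (intro power_mono) auto
      then have "norm (fourier g \<xi>) * (1 + norm \<xi>) ^ k \<le> norm (fourier g \<xi>) * (2 ^ k * (1 + (norm \<xi>)\<^sup>2) ^ k)"
        by (intro mult_left_mono) auto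
      also have "\<dots> \<le> 2 ^ k * C" using mult_left_mono[OF C[of \<xi>], of "2 ^ k"] by (simp add: mult_ac)
      finally show ?thesis .
    qed
    then show "\<exists>C. \<forall>x. norm (fourier g x) * (1 + norm x) ^ k \<le> C" by blast
  qed
  fix n show "rapid_upto n (fourier f)"
    using assms
  proof (induction n arbitrary: f)
    case (Suc n)
    show ?case
      by (rule rapid_upto_SucI[OF 0[OF Suc.prems] fourier_has_derivative[OF Suc.prems]])
        (intro Suc.IH schwartz_moment Suc.prems)
  qed (rule 0)
qed

lemma schwartz_reflect:
  assumes "f \<in> schwartz" shows "(\<lambda>x. f (- x)) \<in> schwartz"
  unfolding schwartz_iff_upto
proof
  fix n show "rapid_upto n (\<lambda>x. f (- x))" using assms
  proof (induction n arbitrary: f)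
    case 0
    then have "rapid_upto 0 f" by (simp add: schwartz_iff_upto)
    then show ?case unfolding rapid_upto_0 by (metis norm_minus_cancel)
  next
    case (Suc n)
    have "rapid_upto 0 f" using Suc.prems by (simp add: schwartz_iff_upto)
    then have 0: "rapid_upto 0 (\<lambda>x. f (- x))" unfolding rapid_upto_0 by (metis norm_minus_cancel)
    have D: "((\<lambda>x. f (- x)) has_derivative (\<lambda>h. pd (- h) f (- x))) (at x)" for x
    proof -
      have m: "(uminus has_derivative uminus) (at x)"
        by (auto intro!: derivative_eq_intros)
      show ?thesis
        by (rule has_derivative_compose[OF m has_derivative_frechet[OF smooth_differentiable[OF schwartz_smooth[OF Suc.prems]]]])
    qed
    have neg: "pd (- b) f (- x) = - pd b f (- x)" for b x
      using linear_neg[OF has_derivative_linear[OF has_derivative_frechet[OF smooth_differentiable[OF schwartz_smooth[OF Suc.prems]]]]] .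
    show ?case
    proof (rule rapid_upto_SucI[OF 0 D])
      fix b :: 'a assume b: "b \<in> Basis"
      have "(\<lambda>x. - pd b f x) \<in> schwartz" by (intro schwartz_uminus schwartz_pd Suc.prems b)
      from Suc.IH[OF this] show "rapid_upto n (\<lambda>x. pd (- b) f (- x))" by (simp add: neg)
    qed
  qed
qed

lemma inv_fourier_eq_fourier:
  fixes f :: "'a::euclidean_space \<Rightarrow> complex"
  shows "inv_fourier f = (\<lambda>x. of_real (1 / (2 * pi) ^ DIM('a)) * fourier f (- x))"
  unfolding inv_fourier_def fourier_def by (simp add: inner_commute)

lemma inv_fourier_schwartz: "f \<in> schwartz \<Longrightarrow> inv_fourier f \<in> schwartz"
  unfolding inv_fourier_eq_fourier by (intro schwartz_cmult schwartz_reflect fourier_schwartz)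

lemma inv_fourier_pd:
  "f \<in> schwartz \<Longrightarrow> b \<in> Basis \<Longrightarrow> inv_fourier (pd b f) \<xi> = - \<i> * of_real (\<xi> \<bullet> b) * inv_fourier f \<xi>"
  unfolding inv_fourier_eq_fourier by (simp add: fourier_pd)

subsection \<open>Gaussians and the inversion formula\<close>

definition gauss :: "real \<Rightarrow> 'a::euclidean_space \<Rightarrow> complex" where
  "gauss t x = of_real (exp (- t * (norm x)\<^sup>2))"

text \<open>The type argument selects the space over which the Gaussian is integrated.\<close>

definition gauss_mass :: "'a::euclidean_space itself \<Rightarrow> real \<Rightarrow> real" where
  "gauss_mass _ t = (\<integral>x. exp (- t * (norm (x::'a))\<^sup>2) \<partial>lborel)"

lemma gauss_schwartz: "0 < t \<Longrightarrow> gauss t \<in> schwartz"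
  using schwartz_gaussian[of t] unfolding gauss_def[abs_def] .

lemma gauss_has_derivative:
  "(gauss t has_derivative (\<lambda>h. of_real (x \<bullet> h) * (of_real (- 2 * t) * gauss t x))) (at x)"
  using gaussian_has_derivative[of t x] unfolding gauss_def[abs_def] .

lemma gauss_measurable [measurable]: "gauss t \<in> borel_measurable borel"
  unfolding gauss_def[abs_def] by measurable

text \<open>A nonzero value persists on an open set, and nonempty open sets have positive measure.\<close>

lemma integral_norm_pos:
  fixes f :: "'a::euclidean_space \<Rightarrow> complex"
  assumes f: "f \<in> schwartz" and ne: "f a \<noteq> 0"
  shows "0 < (\<integral>x. norm (f x) \<partial>lborel)"
proof -
  have "(\<integral>x. norm (f x) \<partial>lborel) \<noteq> 0"
  proof
    assume "(\<integral>x. norm (f x) \<partial>lborel) = 0"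
    then have "AE x in lborel. norm (f x) = 0"
      by (subst (asm) integral_nonneg_eq_0_iff_AE) (use schwartz_integrable[OF f] in auto)
    then have "AE x in lborel. x \<notin> f -` (- {0})" by eventually_elim auto
    moreover have o: "open (f -` (- {0}))"
      using smooth_continuous[OF schwartz_smooth[OF f]] by (intro open_vimage) auto
    ultimately have "f -` (- {0}) \<in> null_sets lborel" by (simp add: AE_iff_null_sets)
    then have "negligible (f -` (- {0}))"
      by (simp add: negligible_iff_null_sets null_sets_completionI)
    then show False using open_not_negligible[OF o] ne by auto
  qed
  moreover have "0 \<le> (\<integral>x. norm (f x) \<partial>lborel)" by simp
  ultimately show ?thesis by linarith
qed

lemma gauss_mass_pos: "0 < t \<Longrightarrow> 0 < gauss_mass TYPE('a::euclidean_space) t"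
  using integral_norm_pos[OF gauss_schwartz, of t "0::'a"] by (simp add: gauss_def gauss_mass_def)

lemma integral_gauss:
  "(\<integral>x. gauss t (x::'a::euclidean_space) \<partial>lborel) = of_real (gauss_mass TYPE('a) t)"
  unfolding gauss_def gauss_mass_def by (rule integral_complex_of_real)

text \<open>The Fourier transform turns the equation \<open>\<partial>\<^sub>b g = - 2 t x\<^sub>b g\<close> of the Gaussian into
\<open>\<partial>\<^sub>b F = - (\<xi>\<^sub>b / (2 t)) F\<close>. Hence \<open>F\<close> divided by the Gaussian on the right-hand side has derivative
zero, and its constant value is read off at the origin.\<close>

lemma fourier_gauss:
  assumes t: "0 < t"
  shows "fourier (gauss t) (\<xi>::'a::euclidean_space) = of_real (gauss_mass TYPE('a) t) * gauss (1 / (4 * t)) \<xi>"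
proof -
  let ?g = "gauss t :: 'a \<Rightarrow> complex"
  let ?F = "fourier ?g" and ?k = "gauss (- (1 / (4 * t))) :: 'a \<Rightarrow> complex"
  let ?H = "\<lambda>\<xi>. ?F \<xi> * ?k \<xi>"
  have gS: "?g \<in> schwartz" by (rule gauss_schwartz[OF t])
  have FD: "(?F has_derivative (\<lambda>h. fourier (\<lambda>x. - \<i> * of_real (x \<bullet> h) * ?g x) \<xi>)) (at \<xi>)" for \<xi>
    by (rule fourier_has_derivative[OF gS])
  have Fb: "fourier (\<lambda>x. - \<i> * of_real (x \<bullet> b) * ?g x) \<xi> = - of_real (\<xi> \<bullet> b / (2 * t)) * ?F \<xi>"
    if b: "b \<in> Basis" for b \<xi>
  proof -
    have "pd b ?g = (\<lambda>x. of_real (x \<bullet> b) * (of_real (- 2 * t) * ?g x))"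
      by (intro ext pd_eq gauss_has_derivative)
    then have "(\<lambda>x. - \<i> * of_real (x \<bullet> b) * ?g x) = (\<lambda>x. (\<i> / of_real (2 * t)) * pd b ?g x)"
      using t by (auto simp: field_simps)
    then show ?thesis
      using t by (simp only: fourier_cmult fourier_pd[OF gS b]) (simp add: field_simps)
  qed
  have HD: "(?H has_derivative (\<lambda>h. ?F \<xi> * (of_real (\<xi> \<bullet> h) * (of_real (- 2 * (- (1 / (4 * t)))) * ?k \<xi>))
     + fourier (\<lambda>x. - \<i> * of_real (x \<bullet> h) * ?g x) \<xi> * ?k \<xi>)) (at \<xi>)" (is "(_ has_derivative ?D \<xi>) _") for \<xi>
    by (intro has_derivative_mult FD gauss_has_derivative)
  have "?D \<xi> = (\<lambda>h. 0)" for \<xi>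
  proof (rule linear_eq_stdbasis)
    show "linear (?D \<xi>)" using HD has_derivative_linear by blast
    show "linear (\<lambda>_::'a. 0::complex)" by (simp add: linear_zero)
    show "?D \<xi> b = 0" if "b \<in> Basis" for b
      unfolding Fb[OF that] using t by (simp add: field_simps)
  qed
  then have "(?H has_derivative (\<lambda>h. 0)) (at \<xi>)" for \<xi> using HD by metis
  then obtain c where c: "\<And>\<xi>. ?H \<xi> = c"
    using has_derivative_zero_constant[of UNIV ?H] by auto
  have "c = ?F 0" using c[of 0] by (simp add: gauss_def)
  also have "\<dots> = of_real (gauss_mass TYPE('a) t)" by (simp add: fourier_def integral_gauss)
  finally have "?F \<xi> * ?k \<xi> = of_real (gauss_mass TYPE('a) t)" using c by simp
  moreover have "?k \<xi> * gauss (1 / (4 * t)) \<xi> = 1"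
    by (simp add: gauss_def exp_minus flip: of_real_mult)
  ultimately show ?thesis by (metis mult.assoc mult.right_neutral)
qed

lemma integral_lborel_affine:
  fixes h :: "'a::euclidean_space \<Rightarrow> 'b::{banach, second_countable_topology}"
  assumes [measurable]: "h \<in> borel_measurable borel" and a: "0 < a"
  shows "(\<integral>y. h y \<partial>lborel) = a ^ DIM('a) *\<^sub>R (\<integral>w. h (x + a *\<^sub>R w) \<partial>lborel)"
proof -
  have "(\<integral>y. h y \<partial>lborel) = (\<integral>y. h y \<partial>(density (distr lborel borel (\<lambda>w. x + a *\<^sub>R w)) (\<lambda>_. ennreal (\<bar>a\<bar> ^ DIM('a)))))"
    using a lborel_affine[of a x] by simp
  also have "\<dots> = (\<integral>y. a ^ DIM('a) *\<^sub>R h y \<partial>(distr lborel borel (\<lambda>w. x + a *\<^sub>R w)))"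
    using a by (subst integral_density) auto
  also have "\<dots> = (\<integral>w. a ^ DIM('a) *\<^sub>R h (x + a *\<^sub>R w) \<partial>lborel)"
    by (subst integral_distr) auto
  finally show ?thesis by simp
qed

lemma gauss_mass_scale:
  assumes "0 < t" shows "gauss_mass TYPE('a::euclidean_space) 1 = sqrt t ^ DIM('a) * gauss_mass TYPE('a) t"
  unfolding gauss_mass_def
  using assms by (subst integral_lborel_affine[where a="sqrt t" and x=0]) (auto simp: power_mult_distrib)

lemma integrable_lborel_tensor:
  fixes a :: "'a::euclidean_space \<Rightarrow> complex" and b :: "'b::euclidean_space \<Rightarrow> complex"
  assumes a: "integrable lborel a" and b: "integrable lborel b"
    and [measurable]: "(\<lambda>(x, y). e x y) \<in> borel_measurable (lborel \<Otimes>\<^sub>M lborel)"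
    and e: "\<And>x y. norm (e x y) \<le> 1"
  shows "integrable (lborel \<Otimes>\<^sub>M lborel) (\<lambda>(x, y). e x y * a x * b y)"
proof (rule Bochner_Integration.integrable_bound)
  show "integrable (lborel \<Otimes>\<^sub>M lborel) (\<lambda>(x, y). a x * b y)"
    using a b
    by (intro lborel_pair.Fubini_integrable) (auto simp: norm_mult intro!: integrable_mult_left)
  show "AE z in lborel \<Otimes>\<^sub>M lborel. norm (case z of (x, y) \<Rightarrow> e x y * a x * b y) \<le> norm (case z of (x, y) \<Rightarrow> a x * b y)"
  proof (rule AE_I2, clarify)
    fix x y show "norm (e x y * a x * b y) \<le> norm (a x * b y)"
      using mult_right_mono[OF e[of x y] norm_ge_zero[of "a x * b y"]] by (simp add: norm_mult mult.assoc)
  qed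
qed (use a b in measurable)

lemma Fubini_lborel_tensor:
  fixes a :: "'a::euclidean_space \<Rightarrow> complex" and b :: "'b::euclidean_space \<Rightarrow> complex"
  assumes "integrable lborel a" "integrable lborel b"
    "(\<lambda>(x, y). e x y) \<in> borel_measurable (lborel \<Otimes>\<^sub>M lborel)" "\<And>x y. norm (e x y) \<le> 1"
  shows "(\<integral>x. \<integral>y. e x y * a x * b y \<partial>lborel \<partial>lborel) = (\<integral>y. \<integral>x. e x y * a x * b y \<partial>lborel \<partial>lborel)"
  using lborel_pair.Fubini_integral[OF integrable_lborel_tensor[OF assms]] by simp

text \<open>The Gaussian factor makes the double integral absolutely convergent. After an exchange of the
integrations the inner one is the transform of a Gaussian, so the right-hand side is a convolution
with the heat kernel.\<close>

lemma fourier_inv_fourier_gauss: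
  fixes f :: "'a::euclidean_space \<Rightarrow> complex"
  assumes f: "f \<in> schwartz" and t: "0 < t"
  shows "fourier (\<lambda>\<xi>. inv_fourier f \<xi> * gauss t \<xi>) x =
    of_real (gauss_mass TYPE('a) t / (2 * pi) ^ DIM('a)) * (\<integral>y. f y * gauss (1 / (4 * t)) (x - y) \<partial>lborel)"
proof -
  let ?c = "complex_of_real (1 / (2 * pi) ^ DIM('a))"
  let ?e = "\<lambda>\<xi> y. exp (- \<i> * of_real (\<xi> \<bullet> (x - y)))"
  have "fourier (\<lambda>\<xi>. inv_fourier f \<xi> * gauss t \<xi>) x =
      (\<integral>\<xi>. ?c * (\<integral>y. ?e \<xi> y * gauss t \<xi> * f y \<partial>lborel) \<partial>lborel)"
    unfolding fourier_def inv_fourier_def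
    by (intro Bochner_Integration.integral_cong refl)
      (simp add: inner_diff_right exp_diff exp_minus field_simps flip: integral_mult_right_zero)
  also have "\<dots> = ?c * (\<integral>\<xi>. \<integral>y. ?e \<xi> y * gauss t \<xi> * f y \<partial>lborel \<partial>lborel)" by simp
  also have "(\<integral>\<xi>. \<integral>y. ?e \<xi> y * gauss t \<xi> * f y \<partial>lborel \<partial>lborel) = (\<integral>y. \<integral>\<xi>. ?e \<xi> y * gauss t \<xi> * f y \<partial>lborel \<partial>lborel)"
    by (rule Fubini_lborel_tensor) (use f t schwartz_integrable gauss_schwartz in \<open>auto\<close>)
  also have "\<dots> = (\<integral>y. fourier (gauss t) (x - y) * f y \<partial>lborel)"
    unfolding fourier_def by simp
  also have "\<dots> = (\<integral>y. of_real (gauss_mass TYPE('a) t) * (f y * gauss (1 / (4 * t)) (x - y)) \<partial>lborel)"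
    unfolding fourier_gauss[OF t] by (simp add: mult_ac)
  finally show ?thesis by simp
qed

text \<open>This number is \<open>1\<close>, by the value of the Gaussian integral. In the present form its positivity is
apparent, so that the Fourier transform can be inverted up to a nonzero factor.\<close>

definition inversion_const :: "'a::euclidean_space itself \<Rightarrow> real" where
  "inversion_const _ =
     2 ^ DIM('a) * (gauss_mass TYPE('a) 1)\<^sup>2 / (2 * pi) ^ DIM('a)"

lemma inversion_const_nonzero: "inversion_const TYPE('a::euclidean_space) \<noteq> 0"
  using gauss_mass_pos[of 1, where 'a='a] by (simp add: inversion_const_def)

text \<open>Both sides of the regularized inversion formula have a limit as \<open>t\<close> tends to \<open>0\<close>. On the right, the
substitution \<open>y = x + 2 sqrt t w\<close> transforms the heat kernel into a fixed Gaussian.\<close>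

lemma fourier_inv_fourier:
  fixes f :: "'a::euclidean_space \<Rightarrow> complex"
  assumes f: "f \<in> schwartz"
  shows "fourier (inv_fourier f) x = of_real (inversion_const TYPE('a)) * f x"
proof (rule LIMSEQ_unique)
  let ?t = "\<lambda>m. 1 / real (Suc m)"
  let ?M = "gauss_mass TYPE('a)" and ?y = "\<lambda>m w. x + (2 * sqrt (?t m)) *\<^sub>R w"
  have fm [measurable]: "f \<in> borel_measurable borel" by (rule schwartz_measurable[OF f])
  have im [measurable]: "inv_fourier f \<in> borel_measurable borel" by (rule schwartz_measurable[OF inv_fourier_schwartz[OF f]])
  have t0: "?t \<longlonglongrightarrow> 0" using LIMSEQ_inverse_real_of_nat by (simp add: inverse_eq_divide)
  have bound: "norm (gauss t \<xi>) \<le> 1" if "0 < t" for t and \<xi> :: 'a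
    using that by (simp add: gauss_def)
  show "(\<lambda>m. fourier (\<lambda>\<xi>. inv_fourier f \<xi> * gauss (?t m) \<xi>) x) \<longlonglongrightarrow> fourier (inv_fourier f) x"
    unfolding fourier_def
  proof (rule integral_dominated_convergence[where w="\<lambda>\<xi>. norm (inv_fourier f \<xi>)"])
    show "integrable lborel (\<lambda>\<xi>. norm (inv_fourier f \<xi>))"
      by (intro integrable_norm schwartz_integrable inv_fourier_schwartz f)
    show "AE \<xi> in lborel. (\<lambda>m. exp (- \<i> * of_real (\<xi> \<bullet> x)) * (inv_fourier f \<xi> * gauss (?t m) \<xi>))
        \<longlonglongrightarrow> exp (- \<i> * of_real (\<xi> \<bullet> x)) * inv_fourier f \<xi>"
    proof (rule AE_I2)
      fix \<xi> :: 'a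
      have "(\<lambda>m. gauss (?t m) \<xi>) \<longlonglongrightarrow> of_real (exp (- 0 * (norm \<xi>)\<^sup>2))"
        unfolding gauss_def by (intro tendsto_intros t0)
      then have "(\<lambda>m. exp (- \<i> * of_real (\<xi> \<bullet> x)) * (inv_fourier f \<xi> * gauss (?t m) \<xi>))
        \<longlonglongrightarrow> exp (- \<i> * of_real (\<xi> \<bullet> x)) * (inv_fourier f \<xi> * of_real (exp (- 0 * (norm \<xi>)\<^sup>2)))"
        by (intro tendsto_intros)
      then show "(\<lambda>m. exp (- \<i> * of_real (\<xi> \<bullet> x)) * (inv_fourier f \<xi> * gauss (?t m) \<xi>))
        \<longlonglongrightarrow> exp (- \<i> * of_real (\<xi> \<bullet> x)) * inv_fourier f \<xi>" by simp
    qed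
    show "AE \<xi> in lborel. norm (exp (- \<i> * of_real (\<xi> \<bullet> x)) * (inv_fourier f \<xi> * gauss (?t m) \<xi>)) \<le> norm (inv_fourier f \<xi>)" for m
    proof (rule AE_I2)
      fix \<xi> :: 'a
      have "norm (inv_fourier f \<xi>) * norm (gauss (?t m) \<xi>) \<le> norm (inv_fourier f \<xi>)"
        by (rule mult_left_le[OF bound]) auto
      then show "norm (exp (- \<i> * of_real (\<xi> \<bullet> x)) * (inv_fourier f \<xi> * gauss (?t m) \<xi>)) \<le> norm (inv_fourier f \<xi>)"
        by (simp add: norm_mult)
    qed
  qed measurable
  let ?K = "complex_of_real (2 ^ DIM('a) * ?M 1 / (2 * pi) ^ DIM('a))"
  have eq: "fourier (\<lambda>\<xi>. inv_fourier f \<xi> * gauss (?t m) \<xi>) x =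
      ?K * (\<integral>w. f (?y m w) * gauss 1 w \<partial>lborel)" for m
  proof -
    have t: "0 < ?t m" by simp
    have G: "gauss (1 / (4 * ?t m)) (x - (?y m w)) = gauss 1 w" for w
      by (simp add: gauss_def power_mult_distrib)
    have "(\<integral>y. f y * gauss (1 / (4 * ?t m)) (x - y) \<partial>lborel) =
        (2 * sqrt (?t m)) ^ DIM('a) *\<^sub>R (\<integral>w. f (?y m w) * gauss (1 / (4 * ?t m)) (x - (?y m w)) \<partial>lborel)"
      by (rule integral_lborel_affine) auto
    then have "fourier (\<lambda>\<xi>. inv_fourier f \<xi> * gauss (?t m) \<xi>) x =
       of_real (?M (?t m) / (2 * pi) ^ DIM('a)) * (of_real ((2 * sqrt (?t m)) ^ DIM('a)) * (\<integral>w. f (?y m w) * gauss 1 w \<partial>lborel))"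
      by (simp only: fourier_inv_fourier_gauss[OF f t] scaleR_conv_of_real G)
    also have "\<dots> = of_real (?M (?t m) / (2 * pi) ^ DIM('a) * (2 * sqrt (?t m)) ^ DIM('a)) * (\<integral>w. f (?y m w) * gauss 1 w \<partial>lborel)"
      by (simp only: of_real_mult mult.assoc)
    also have "?M (?t m) / (2 * pi) ^ DIM('a) * (2 * sqrt (?t m)) ^ DIM('a) = 2 ^ DIM('a) * (sqrt (?t m) ^ DIM('a) * ?M (?t m)) / (2 * pi) ^ DIM('a)"
      by (simp add: power_mult_distrib mult_ac)
    also have "\<dots> = 2 ^ DIM('a) * ?M 1 / (2 * pi) ^ DIM('a)"
      by (simp only: gauss_mass_scale[OF t])
    finally show ?thesis .
  qed
  obtain B where B: "0 \<le> B" "\<And>x. norm (f x) \<le> B"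
    using schwartz_bound[OF f, of 0] by auto
  have "(\<lambda>m. \<integral>w. f (?y m w) * gauss 1 w \<partial>lborel) \<longlonglongrightarrow> (\<integral>w. f x * gauss 1 (w::'a) \<partial>lborel)"
  proof (rule integral_dominated_convergence[where w="\<lambda>w. B * norm (gauss 1 (w::'a))"])
    show "integrable lborel (\<lambda>w::'a. B * norm (gauss 1 w))"
      by (intro integrable_mult_right integrable_norm schwartz_integrable gauss_schwartz) simp
    show "AE w in lborel. (\<lambda>m. f (?y m w) * gauss 1 w) \<longlonglongrightarrow> f x * gauss 1 w"
    proof (rule AE_I2)
      fix w :: 'a
      have "(\<lambda>m. x + (2 * sqrt (?t m)) *\<^sub>R w) \<longlonglongrightarrow> x + (2 * sqrt 0) *\<^sub>R w"
        by (intro tendsto_intros t0)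
      moreover have "isCont f x"
        using smooth_continuous[OF schwartz_smooth[OF f]] by (simp add: continuous_on_eq_continuous_at)
      ultimately have "(\<lambda>m. f (?y m w)) \<longlonglongrightarrow> f x"
        by (intro isCont_tendsto_compose[of x f]) simp_all
      then show "(\<lambda>m. f (?y m w) * gauss 1 w) \<longlonglongrightarrow> f x * gauss 1 w"
        by (intro tendsto_intros)
    qed
    show "AE w in lborel. norm (f (?y m w) * gauss 1 w) \<le> B * norm (gauss 1 w)" for m
      by (rule AE_I2) (simp add: norm_mult B mult_right_mono)
  qed measurable
  then have "(\<lambda>m. fourier (\<lambda>\<xi>. inv_fourier f \<xi> * gauss (?t m) \<xi>) x) \<longlonglongrightarrow> ?K * (\<integral>w. f x * gauss 1 (w::'a) \<partial>lborel)"
    unfolding eq by (intro tendsto_intros)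
  also have "?K * (\<integral>w. f x * gauss 1 (w::'a) \<partial>lborel) = of_real (inversion_const TYPE('a)) * f x"
    by (simp add: integral_gauss inversion_const_def power2_eq_square)
  finally show "(\<lambda>m. fourier (\<lambda>\<xi>. inv_fourier f \<xi> * gauss (?t m) \<xi>) x) \<longlonglongrightarrow> of_real (inversion_const TYPE('a)) * f x" .
qed

section \<open>Smooth cutoff functions\<close>

text \<open>For \<open>p = 1\<close> this is the usual function \<open>exp (-1/x)\<close>, all of whose derivatives vanish at the origin.
The polynomial factor makes the family closed under differentiation.\<close>

definition flat :: "real poly \<Rightarrow> real \<Rightarrow> real" where
  "flat p x = (if x \<le> 0 then 0 else poly p (1 / x) * exp (- (1 / x)))"

lemma poly_over_exp_tendsto_0: "((\<lambda>y::real. poly p y * exp (- y)) \<longlongrightarrow> 0) at_top"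
proof -
  have "((\<lambda>y::real. \<Sum>i\<le>degree p. coeff p i * (y ^ i / exp y)) \<longlongrightarrow> (\<Sum>i\<le>degree p. coeff p i * 0)) at_top"
    by (intro tendsto_sum tendsto_mult tendsto_const tendsto_power_div_exp_0)
  then show ?thesis
    by (simp add: poly_altdef exp_minus divide_inverse sum_distrib_right mult.assoc)
qed

lemma flat_has_derivative:
  "(flat p has_real_derivative flat ([:0, 0, 1:] * (p - pderiv p)) x) (at x)"
proof -
  consider "x < 0" | "x > 0" | "x = 0" by linarith
  then show ?thesis
  proof cases
    case 1
    have "((\<lambda>_. 0) has_real_derivative 0) (at x)" by simp
    then have "(flat p has_real_derivative 0) (at x)"
      by (rule DERIV_cong_ev[OF refl _ refl, THEN iffD1, rotated])
        (use 1 eventually_nhds_in_open[of "{..<0}" x] in \<open>auto simp: flat_def elim!: eventually_mono\<close>)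
    then show ?thesis using 1 by (simp add: flat_def)
  next
    case 2
    have "((\<lambda>x. poly p (1 / x) * exp (- (1 / x))) has_real_derivative
        poly p (1 / x) * (exp (- (1 / x)) * (1 / x\<^sup>2)) + poly (pderiv p) (1 / x) * (- (1 / x\<^sup>2)) * exp (- (1 / x))) (at x)"
      by (rule derivative_eq_intros poly_DERIV DERIV_chain2[where f="poly p"] refl | use 2 in \<open>simp; fail\<close>)+
        (use 2 in \<open>simp add: power2_eq_square field_simps\<close>)
    then have "(flat p has_real_derivative
        poly p (1 / x) * (exp (- (1 / x)) * (1 / x\<^sup>2)) + poly (pderiv p) (1 / x) * (- (1 / x\<^sup>2)) * exp (- (1 / x))) (at x)"
      by (rule DERIV_cong_ev[OF refl _ refl, THEN iffD1, rotated])
        (use 2 eventually_nhds_in_open[of "{0<..}" x] in \<open>auto simp: flat_def elim!: eventually_mono\<close>)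
    then show ?thesis
      by (rule DERIV_cong) (use 2 in \<open>simp add: flat_def power2_eq_square field_simps\<close>)
  next
    case 3
    have "((\<lambda>h. (flat p (0 + h) - flat p 0) / h) \<longlongrightarrow> 0) (at_right 0)"
    proof -
      have "((\<lambda>h. poly ([:0, 1:] * p) (inverse h) * exp (- inverse h)) \<longlongrightarrow> 0) (at_right (0::real))"
        using filterlim_compose[OF poly_over_exp_tendsto_0 filterlim_inverse_at_top_right] .
      then show ?thesis
      proof (rule Lim_transform_eventually)
        show "\<forall>\<^sub>F h in at_right 0. poly ([:0, 1:] * p) (inverse h) * exp (- inverse h) = (flat p (0 + h) - flat p 0) / h"
          using eventually_at_right_less[of "0::real"]
          by eventually_elim (simp add: flat_def inverse_eq_divide)
      qed
    qed
    moreover have "((\<lambda>h. (flat p (0 + h) - flat p 0) / h) \<longlongrightarrow> 0) (at_left 0)"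
    proof (rule Lim_transform_eventually[OF tendsto_const])
      show "\<forall>\<^sub>F h in at_left 0. 0 = (flat p (0 + h) - flat p 0) / h"
        by (auto simp: flat_def eventually_at_filter)
    qed
    ultimately show ?thesis
      using 3 unfolding DERIV_def by (auto simp: flat_def intro: filterlim_split_at)
  qed
qed

definition smooth_upto :: "nat \<Rightarrow> ('a::euclidean_space \<Rightarrow> complex) \<Rightarrow> bool" where
  "smooth_upto n f \<longleftrightarrow> (\<exists>W. dbound n W f)"

lemma smooth_iff_upto: "smooth f \<longleftrightarrow> (\<forall>n. smooth_upto n f)"
  by (simp add: smooth_iff smooth_upto_def)

lemma smooth_upto_0 [simp]: "smooth_upto 0 f"
  unfolding smooth_upto_def dbound_0 by (intro exI[of _ "\<lambda>x. norm (f x)"]) simp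

lemma smooth_upto_SucI:
  assumes "\<And>x. (f has_derivative D x) (at x)" "\<And>b. b \<in> Basis \<Longrightarrow> smooth_upto n (\<lambda>x. D x b)"
  shows "smooth_upto (Suc n) f"
proof -
  have "\<exists>W\<in>UNIV. \<forall>x. norm (f x) \<le> W x" by (intro bexI[of _ "\<lambda>x. norm (f x)"]) auto
  then show ?thesis
    using dbound_Suc_directed[OF directed_UNIV, of f D n] assms by (simp add: smooth_upto_def)
qed

lemma smooth_upto_mult: "smooth_upto n f \<Longrightarrow> smooth_upto n g \<Longrightarrow> smooth_upto n (\<lambda>x. f x * g x)"
  unfolding smooth_upto_def using dbound_mult by blast

text \<open>By the chain rule a partial derivative of \<open>flat q \<circ> p\<close> is a member of the same family times a partial
derivative of \<open>p\<close>, so induction on the order works for all \<open>q\<close> simultaneously.\<close>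

lemma smooth_compose_flat:
  assumes P: "smooth (\<lambda>x. complex_of_real (p x))"
  shows "smooth (\<lambda>x. complex_of_real (flat q (p x)))"
  unfolding smooth_iff_upto
proof
  let ?P = "\<lambda>x. complex_of_real (p x)"
  have PD: "(?P has_derivative (\<lambda>h. pd h ?P x)) (at x)" for x
    by (rule has_derivative_frechet[OF smooth_differentiable[OF P]])
  have pD: "(p has_derivative (\<lambda>h. Re (pd h ?P x))) (at x)" for x
    using bounded_linear.has_derivative[OF bounded_linear_Re PD] by simp
  have real: "pd b ?P x = complex_of_real (Re (pd b ?P x))" for b x
    using pd_eq[OF has_derivative_of_real[OF pD, where 'a=complex]] by simp
  fix n show "smooth_upto n (\<lambda>x. complex_of_real (flat q (p x)))"
  proof (induction n arbitrary: q)
    case (Suc n)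
    let ?q = "[:0, 0, 1:] * (q - pderiv q)"
    show ?case
    proof (rule smooth_upto_SucI)
      fix x
      have "((\<lambda>x. flat q (p x)) has_derivative (\<lambda>h. flat ?q (p x) * Re (pd h ?P x))) (at x)"
        using has_derivative_compose[OF pD flat_has_derivative[THEN has_field_derivative_imp_has_derivative]] .
      from has_derivative_of_real[OF this, where 'a=complex]
      show "((\<lambda>x. complex_of_real (flat q (p x))) has_derivative (\<lambda>h. complex_of_real (flat ?q (p x)) * complex_of_real (Re (pd h ?P x)))) (at x)"
        by (simp only: of_real_mult)
    next
      fix b :: 'a assume b: "b \<in> Basis"
      have "smooth (\<lambda>x. pd b ?P x)" using smooth_pd[OF P b] .
      then have "smooth_upto n (\<lambda>x. complex_of_real (Re (pd b ?P x)))"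
        unfolding real[symmetric] by (simp add: smooth_iff_upto)
      with Suc.IH show "smooth_upto n (\<lambda>x. complex_of_real (flat ?q (p x)) * complex_of_real (Re (pd b ?P x)))"
        by (intro smooth_upto_mult)
    qed
  qed simp
qed

lemma slow_smooth: "slow f \<Longrightarrow> smooth f"
  unfolding slow_def smooth_iff by blast

lemma smooth_sum:
  assumes "\<And>i. i \<in> I \<Longrightarrow> smooth (f i)" shows "smooth (\<lambda>x. \<Sum>i\<in>I. f i x)"
  using assms by (induction I rule: infinite_finite_induct) (auto intro: smooth_const smooth_add)

lemma smooth_norm_sq: "smooth (\<lambda>x::'a::euclidean_space. complex_of_real ((norm (x - a))\<^sup>2))"
proof -
  have "smooth (\<lambda>x::'a. \<Sum>b\<in>Basis. (complex_of_real (x \<bullet> b) + - of_real (a \<bullet> b)) * (complex_of_real (x \<bullet> b) + - of_real (a \<bullet> b)))"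
    by (intro smooth_sum smooth_mult smooth_add smooth_const slow_smooth slow_inner)
  also have "(\<lambda>x::'a. \<Sum>b\<in>Basis. (complex_of_real (x \<bullet> b) + - of_real (a \<bullet> b)) * (complex_of_real (x \<bullet> b) + - of_real (a \<bullet> b)))
      = (\<lambda>x. complex_of_real ((norm (x - a))\<^sup>2))"
  proof
    fix x :: 'a
    have "(norm (x - a))\<^sup>2 = (\<Sum>b\<in>Basis. (x \<bullet> b - a \<bullet> b) * (x \<bullet> b - a \<bullet> b))"
      using euclidean_inner[of "x - a" "x - a"] by (simp add: power2_norm_eq_inner inner_diff_left)
    then show "(\<Sum>b\<in>Basis. (complex_of_real (x \<bullet> b) + - of_real (a \<bullet> b)) * (complex_of_real (x \<bullet> b) + - of_real (a \<bullet> b)))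
      = complex_of_real ((norm (x - a))\<^sup>2)" by simp
  qed
  finally show ?thesis .
qed

lemma flat_1_mono: "x \<le> y \<Longrightarrow> flat 1 x \<le> flat 1 y"
  by (auto simp: flat_def divide_left_mono)

text \<open>Composing \<open>exp (-1/x)\<close> with itself produces a plateau: with \<open>c = flat 1 1\<close>, the function
\<open>flat 1 (c - flat 1 y)\<close> is constant for \<open>y \<le> 0\<close> and vanishes for \<open>y \<ge> 1\<close>.\<close>

lemma cutoff_exists:
  fixes x0 :: "'a::euclidean_space"
  assumes d: "0 < d"
  obtains \<eta> :: "'a \<Rightarrow> complex" where "smooth \<eta>" "\<And>x. \<eta> x = of_real (norm (\<eta> x))"
    "\<And>x. dist x0 x \<le> d \<Longrightarrow> \<eta> x = 1" "\<And>x. 2 * d \<le> dist x0 x \<Longrightarrow> \<eta> x = 0"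
proof -
  let ?c = "flat 1 1"
  have c: "0 < ?c" "0 < flat 1 ?c" by (auto simp: flat_def)
  let ?p = "\<lambda>x. 1 / (3 * d\<^sup>2) * (norm (x - x0))\<^sup>2 + - (1 / 3)"
  \<comment> \<open>The quantity \<open>?p x\<close> is \<open>0\<close> at distance \<open>d\<close> from \<open>x0\<close> and \<open>1\<close> at distance \<open>2 d\<close>.\<close>
  define r where "r x = flat 1 (?c + (-1) * flat 1 (?p x))" for x
  define \<eta> where "\<eta> x = complex_of_real (1 / flat 1 ?c) * complex_of_real (r x)" for x
  have sp: "smooth (\<lambda>x. complex_of_real (?p x))"
    unfolding of_real_add of_real_mult by (intro smooth_add smooth_mult smooth_const smooth_norm_sq)
  have "smooth (\<lambda>x. complex_of_real ?c + complex_of_real (-1) * complex_of_real (flat 1 (?p x)))"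
    by (intro smooth_add smooth_mult smooth_const smooth_compose_flat sp)
  then have "smooth (\<lambda>x. complex_of_real (?c + (-1) * flat 1 (?p x)))"
    by (simp only: of_real_add of_real_mult)
  then have "smooth \<eta>" unfolding \<eta>_def r_def by (intro smooth_mult smooth_const smooth_compose_flat)
  moreover have "0 \<le> r x" for x unfolding r_def by (simp add: flat_def)
  then have "\<eta> x = of_real (norm (\<eta> x))" for x
    using c unfolding \<eta>_def by (simp add: norm_mult norm_divide abs_of_pos)
  moreover have "\<eta> x = 1" if "dist x0 x \<le> d" for x
  proof -
    have "(norm (x - x0))\<^sup>2 \<le> d\<^sup>2" using that by (intro power_mono) (auto simp: dist_norm norm_minus_commute)
    then have "?p x \<le> 0" using d by (simp add: field_simps)
    then have "flat 1 (?p x) = 0" by (simp add: flat_def)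
    then show ?thesis using c by (simp add: \<eta>_def r_def)
  qed
  moreover have "\<eta> x = 0" if "2 * d \<le> dist x0 x" for x
  proof -
    have "(2 * d)\<^sup>2 \<le> (norm (x - x0))\<^sup>2" using that d by (intro power_mono) (auto simp: dist_norm norm_minus_commute)
    then have "1 \<le> ?p x" using d by (simp add: field_simps)
    then have "?c \<le> flat 1 (?p x)" by (rule flat_1_mono)
    then show ?thesis by (simp add: \<eta>_def r_def flat_def)
  qed
  ultimately show ?thesis using that by blast
qed

subsection \<open>Compactly supported smooth functions\<close>

lemma pd_zero_open:
  assumes "open S" "\<And>x. x \<in> S \<Longrightarrow> f x = 0" "x \<in> S"
  shows "pd b f x = 0"
proof -
  have "((\<lambda>_. 0) has_derivative (\<lambda>_. 0)) (at x)" by simp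
  then have "(f has_derivative (\<lambda>_. 0)) (at x)"
    by (rule has_derivative_transform_within_open[OF _ assms(1,3)]) (use assms(2) in simp)
  then show ?thesis by (rule pd_eq)
qed

lemma iter_pderiv_zero_open:
  assumes "open S" "\<And>x. x \<in> S \<Longrightarrow> f x = 0" "x \<in> S"
  shows "iter_pderiv bs f x = 0"
  using assms(3)
proof (induction bs arbitrary: x)
  case (Cons b bs)
  then show ?case unfolding iter_pderiv_Cons by (intro pd_zero_open[OF assms(1)])
qed (use assms(2) in simp)

definition test_fun :: "'a \<Rightarrow> real \<Rightarrow> ('a::euclidean_space \<Rightarrow> complex) \<Rightarrow> bool" where
  "test_fun a d f \<longleftrightarrow> smooth f \<and> (\<forall>x. x \<notin> cball a d \<longrightarrow> f x = 0)"

lemma test_fun_pd: "test_fun a d f \<Longrightarrow> b \<in> Basis \<Longrightarrow> test_fun a d (pd b f)"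
  unfolding test_fun_def
  by (auto intro!: smooth_pd pd_zero_open[of "- cball a d"] simp: open_Compl)

lemma test_fun_iter_pderiv: "test_fun a d f \<Longrightarrow> bs \<in> lists Basis \<Longrightarrow> test_fun a d (iter_pderiv bs f)"
  by (induction bs) (auto simp: iter_pderiv_Cons intro: test_fun_pd)

lemma test_fun_cmult: "test_fun a d f \<Longrightarrow> test_fun a d (\<lambda>x. c * f x)"
  unfolding test_fun_def by (auto intro: smooth_mult smooth_const)

lemma test_fun_sum:
  assumes "\<And>i. i \<in> I \<Longrightarrow> test_fun a d (f i)" shows "test_fun a d (\<lambda>x. \<Sum>i\<in>I. f i x)"
  using assms unfolding test_fun_def by (auto intro!: smooth_sum sum.neutral)

lemma test_fun_schwartz:
  assumes "test_fun a d f" shows "f \<in> schwartz"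
  unfolding schwartz_def
proof (intro CollectI conjI ballI allI)
  show "smooth f" using assms by (simp add: test_fun_def)
  fix bs :: "'a list" and k :: nat assume bs: "bs \<in> lists Basis"
  let ?h = "\<lambda>x. (1 + norm x) ^ k *\<^sub>R iter_pderiv bs f x"
  have t: "test_fun a d (iter_pderiv bs f)" by (rule test_fun_iter_pderiv[OF assms bs])
  then have "continuous_on (cball a d) ?h"
    using continuous_on_subset[OF smooth_continuous] unfolding test_fun_def
    by (intro continuous_intros) auto
  then have "bounded (?h ` cball a d)"
    by (intro compact_imp_bounded compact_continuous_image) auto
  moreover have "range ?h \<subseteq> insert 0 (?h ` cball a d)" using t unfolding test_fun_def by fastforce
  ultimately show "bounded (range ?h)" using bounded_subset bounded_insert by blast
qed

lemma vanishes_on_test_fun: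
  assumes "vanishes_on u U" "test_fun a d f" "cball a d \<subseteq> U"
  shows "u f = 0"
proof -
  have "closure {x. f x \<noteq> 0} \<subseteq> cball a d"
    using assms(2) unfolding test_fun_def by (intro closure_minimal) auto
  moreover from this have "compact (closure {x. f x \<noteq> 0})"
    by (meson bounded_cball bounded_subset closed_closure compact_eq_bounded_closed)
  ultimately show ?thesis using assms unfolding vanishes_on_def test_fun_def by blast
qed

section \<open>A moment problem on the half-line\<close>

lemma integrable_powr_tail:
  assumes "a < -1"
  shows "integrable lborel (\<lambda>t::real. indicator {1<..} t * t powr a)"
proof -
  have "set_integrable lborel (einterval 1 \<infinity>) (\<lambda>t. t powr a)"
  proof (rule interval_integral_FTC_nonneg(1))
    show "DERIV (\<lambda>t. t powr (a + 1) / (a + 1)) t :> t powr a" if "1 < ereal t" for t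
      using that assms by (auto intro!: derivative_eq_intros simp: one_ereal_def)
    show "isCont (\<lambda>t. t powr a) t" if "1 < ereal t" for t
      using that by (auto intro!: continuous_intros simp: one_ereal_def)
    show "(((\<lambda>t. t powr (a + 1) / (a + 1)) \<circ> real_of_ereal) \<longlongrightarrow> 1 powr (a + 1) / (a + 1)) (at_right 1)"
      unfolding one_ereal_def using assms by (subst ereal_tendsto_simps) (auto intro!: tendsto_eq_intros)
    have "((\<lambda>t::real. t powr (a + 1) / (a + 1)) \<longlongrightarrow> 0 / (a + 1)) at_top"
      using assms by (intro tendsto_intros tendsto_neg_powr filterlim_ident) auto
    then show "(((\<lambda>t. t powr (a + 1) / (a + 1)) \<circ> real_of_ereal) \<longlongrightarrow> 0) (at_left \<infinity>)"
      by (subst ereal_tendsto_simps) simp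
  qed auto
  then show ?thesis
    by (simp add: set_integrable_def einterval_def one_ereal_def greaterThan_def)
qed

lemma power_div_fact_le_exp:
  fixes y :: real assumes "0 \<le> y" shows "y ^ n / fact n \<le> exp y"
proof -
  have "(\<Sum>m\<in>{n}. inverse (fact m) *\<^sub>R y ^ m) \<le> (\<Sum>m. inverse (fact m) *\<^sub>R y ^ m)"
    using assms by (intro sum_le_suminf summable_exp_generic) auto
  then show ?thesis by (simp add: exp_def divide_inverse mult.commute)
qed

lemma power_exp_neg_inverse_bound:
  fixes a c :: real
  assumes "0 < c"
  obtains K where "0 \<le> K" "\<And>t. 0 < t \<Longrightarrow> t \<le> 1 \<Longrightarrow> t powr a * exp (- (c / t)) \<le> K"
proof -
  define n where "n = nat \<lceil>\<bar>a\<bar>\<rceil>"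
  have "t powr a * exp (- (c / t)) \<le> fact n / c ^ n" if t: "0 < t" "t \<le> 1" for t
  proof -
    have "(c / t) ^ n / fact n \<le> exp (c / t)"
      using t assms by (intro power_div_fact_le_exp) auto
    then have "exp (- (c / t)) \<le> fact n * (t / c) ^ n"
      using t assms by (simp add: exp_minus power_divide field_simps)
    moreover have "t powr a \<le> t powr (- real n)"
      using t unfolding n_def by (intro powr_mono') linarith+
    ultimately have "t powr a * exp (- (c / t)) \<le> t powr (- real n) * (fact n * (t / c) ^ n)"
      by (intro mult_mono) auto
    also have "\<dots> = fact n / c ^ n"
      using t by (simp add: powr_minus powr_realpow power_divide field_simps)
    finally show ?thesis .
  qed
  then show ?thesis using that[of "fact n / c ^ n"] assms by auto
qed

text \<open>At the origin exponential smallness compensates every negative power of \<open>t\<close>; at infinity the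
power itself is integrable.\<close>

lemma integrable_small_at_0:
  fixes h :: "real \<Rightarrow> complex"
  assumes [measurable]: "h \<in> borel_measurable borel" and c: "0 < c" and a: "a < -1"
    and B: "\<And>t. 1 < t \<Longrightarrow> norm (h t) \<le> B"
    and C: "\<And>t. 0 < t \<Longrightarrow> t \<le> 1 \<Longrightarrow> norm (h t) \<le> C * exp (- (c / t))"
  shows "integrable lborel (\<lambda>t. indicator {0<..} t *\<^sub>R (h t * of_real (t powr a)))"
proof -
  obtain K where K: "0 \<le> K" "\<And>t. 0 < t \<Longrightarrow> t \<le> 1 \<Longrightarrow> t powr a * exp (- (c / t)) \<le> K"
    using power_exp_neg_inverse_bound[OF c] by metis
  have C0: "0 \<le> C" using C[of 1] norm_ge_zero[of "h 1"] by (smt (verit) exp_gt_zero mult_neg_pos zero_less_one)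
  have "integrable lborel (\<lambda>t. C * K * indicator {0..1::real} t + B * (indicator {1<..} t * t powr a))"
    by (intro Bochner_Integration.integrable_add integrable_mult_right integrable_powr_tail a)
      (simp add: integrable_indicator_iff)
  then show ?thesis
  proof (rule Bochner_Integration.integrable_bound)
    show "AE t in lborel. norm (indicator {0<..} t *\<^sub>R (h t * of_real (t powr a)))
       \<le> norm (C * K * indicator {0..1::real} t + B * (indicator {1<..} t * t powr a))"
    proof (rule AE_I2)
      fix t :: real
      consider "t \<le> 0" | "0 < t" "t \<le> 1" | "1 < t" by linarith
      then show "norm (indicator {0<..} t *\<^sub>R (h t * of_real (t powr a)))
       \<le> norm (C * K * indicator {0..1::real} t + B * (indicator {1<..} t * t powr a))"
      proof cases
        case 2
        have "norm (h t) * t powr a \<le> C * exp (- (c / t)) * t powr a"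
          by (intro mult_right_mono C 2) auto
        also have "\<dots> \<le> C * K" using mult_left_mono[OF K(2)[OF 2] C0] by (simp add: mult_ac)
        finally show ?thesis using 2 by (simp add: norm_mult)
      next
        case 3
        have "norm (h t) * t powr a \<le> B * t powr a" by (intro mult_right_mono B 3) auto
        also have "\<dots> \<le> \<bar>B * t powr a\<bar>" by simp
        finally show ?thesis using 3 by (simp add: norm_mult)
      qed simp
    qed
  qed measurable
qed

lemma continuous_on_AE_zero:
  fixes f :: "real \<Rightarrow> 'b::real_normed_vector"
  assumes "open S" "continuous_on S f" "AE t in lborel. t \<in> S \<longrightarrow> f t = 0" "t \<in> S"
  shows "f t = 0"
proof (rule ccontr)
  assume ne: "f t \<noteq> 0"
  have "open (S \<inter> f -` (- {0}))"
    by (rule continuous_open_preimage[OF assms(2,1)]) auto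
  moreover have "S \<inter> f -` (- {0}) \<in> null_sets lborel"
  proof -
    have "S \<inter> f -` (- {0}) \<in> sets lborel" using calculation by simp
    moreover have "AE t in lborel. t \<notin> S \<inter> f -` (- {0})"
      using assms(3) by eventually_elim auto
    ultimately show ?thesis by (simp add: AE_iff_null_sets)
  qed
  then have "negligible (S \<inter> f -` (- {0}))"
    by (simp add: negligible_iff_null_sets null_sets_completionI)
  moreover have "S \<inter> f -` (- {0}) \<noteq> {}" using ne assms(4) by auto
  ultimately show False using open_not_negligible by blast
qed

text \<open>Used as a majorant when the exponential series is integrated termwise.\<close>

lemma norm_exp_partial_sum_le:
  fixes z :: "'a::{real_normed_field, banach}"
  shows "norm (\<Sum>m<M. z ^ m / fact m) \<le> exp (norm z)"
proof -
  have "norm (\<Sum>m<M. z ^ m / fact m) \<le> (\<Sum>m<M. norm z ^ m / fact m)"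
    by (rule order_trans[OF norm_sum]) (simp add: norm_divide norm_power)
  also have "\<dots> \<le> (\<Sum>m. inverse (fact m) *\<^sub>R norm z ^ m)"
    using sum_le_suminf[OF summable_exp_generic[of "norm z"], of "{..<M}"] by (simp add: divide_inverse mult.commute)
  finally show ?thesis by (simp add: exp_def)
qed

lemma exp_partial_sum_tendsto:
  fixes z :: "'a::{real_normed_field, banach}"
  shows "(\<lambda>M. \<Sum>m<M. z ^ m / fact m) \<longlonglongrightarrow> exp z"
  using exp_converges[of z] by (simp add: sums_def scaleR_conv_of_real divide_inverse mult.commute)

text \<open>In the variable \<open>1/t\<close> the function \<open>W\<close> below has exponential decay of rate \<open>2 d\<close>. Its vanishing
moments therefore persist under multiplication by \<open>exp (-d/t)\<close>, whose power series may be
integrated termwise against \<open>W\<close>, and hence under multiplication by all powers of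
\<open>x = exp (-d/t)\<close>. By the Weierstrass theorem \<open>W\<close> annihilates all continuous functions of \<open>x\<close> on the
unit interval. One of these is \<open>Re (h t) (1 - x)\<close>, and testing with it leaves the integral of a
nonnegative function.\<close>

lemma moments_Re_eq_0:
  fixes h :: "real \<Rightarrow> complex"
  assumes cont: "continuous_on {0<..} h" and hm [measurable]: "h \<in> borel_measurable borel"
    and d: "0 < d" and s: "0 < s"
    and B: "\<And>t. 0 < t \<Longrightarrow> norm (h t) \<le> B"
    and C: "\<And>t. 0 < t \<Longrightarrow> t \<le> 1 \<Longrightarrow> norm (h t) \<le> C * exp (- (2 * d / t))"
    and mom: "\<And>k. (\<integral>t. indicator {0<..} t *\<^sub>R (h t * of_real (t powr (- 1 - s - real k))) \<partial>lborel) = 0"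
    and t: "0 < t"
  shows "Re (h t) = 0"
proof -
  define W where "W t = indicator {0<..} t *\<^sub>R (h t * of_real (t powr (- 1 - s)))" for t
  have Wm [measurable]: "W \<in> borel_measurable borel" unfolding W_def by measurable
  define V where "V a k t = W t * of_real ((1 / t) ^ k * exp (- (a / t)))" for a k t
  have Vm [measurable]: "V a k \<in> borel_measurable borel" for a k unfolding V_def by measurable
  have Veq: "V a k t = indicator {0<..} t *\<^sub>R ((h t * of_real (exp (- (a / t)))) * of_real (t powr (- 1 - s - real k)))" for a k t
    by (cases "0 < t") (simp_all add: V_def W_def powr_diff powr_realpow power_one_over divide_inverse power_inverse)
  have VI: "integrable lborel (\<lambda>t. V a k t * of_real (exp (d / t)))" if a: "0 \<le> a" for a k
  proof -
    have "integrable lborel (\<lambda>t. indicator {0<..} t *\<^sub>R ((h t * of_real (exp (- (a / t)) * exp (d / t))) * of_real (t powr (- 1 - s - real k))))"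
    proof (rule integrable_small_at_0[where B = "B * exp d" and C = C and c = d])
      fix t :: real assume t: "1 < t"
      have "exp (- (a / t)) * exp (d / t) \<le> 1 * exp d"
        using t a d by (intro mult_mono) (auto simp: divide_le_eq)
      then show "norm (h t * of_real (exp (- (a / t)) * exp (d / t))) \<le> B * exp d"
        using B[of t] t by (auto simp: norm_mult intro!: mult_mono')
    next
      fix t :: real assume t: "0 < t" "t \<le> 1"
      have "norm (h t) * (exp (- (a / t)) * exp (d / t)) \<le> (C * exp (- (2 * d / t))) * (1 * exp (d / t))"
        using t a C[OF t] by (intro mult_mono') auto
      also have "\<dots> = C * exp (- (d / t))" using t by (simp add: mult.assoc field_simps flip: exp_add)
      finally show "norm (h t * of_real (exp (- (a / t)) * exp (d / t))) \<le> C * exp (- (d / t))"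
        by (simp add: norm_mult)
    qed (use d s in auto)
    then show ?thesis unfolding Veq by (simp add: mult_ac)
  qed
  have VI0: "integrable lborel (V a k)" if a: "0 \<le> a" for a k
  proof (rule Bochner_Integration.integrable_bound[OF VI[OF a, of k]])
    show "AE t in lborel. norm (V a k t) \<le> norm (V a k t * of_real (exp (d / t)))"
    proof (rule AE_I2)
      fix t show "norm (V a k t) \<le> norm (V a k t * of_real (exp (d / t)))"
      proof (cases "0 < t")
        case True
        then have "norm (V a k t) * 1 \<le> norm (V a k t) * exp (d / t)"
          using d by (intro mult_left_mono) auto
        then show ?thesis by (simp add: norm_mult)
      qed (simp add: V_def W_def)
    qed
  qed measurable
  \<comment> \<open>Termwise integration of the series for \<open>exp (-d/t)\<close>; its partial sums are dominated by \<open>exp (d/t)\<close>,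
      half of the available decay.\<close>
  have Vmom: "(\<integral>t. V (real j * d) k t \<partial>lborel) = 0" for j k
  proof (induction j arbitrary: k)
    case 0
    show ?case using mom[of k] unfolding Veq by simp
  next
    case (Suc j)
    let ?a = "real j * d"
    have a: "0 \<le> ?a" using d by simp
    have "(\<lambda>M. \<integral>t. V ?a k t * of_real (\<Sum>m<M. (- (d / t)) ^ m / fact m) \<partial>lborel) \<longlonglongrightarrow>
      (\<integral>t. V ?a k t * of_real (exp (- (d / t))) \<partial>lborel)"
    proof (rule integral_dominated_convergence[where w="\<lambda>t. norm (V ?a k t * of_real (exp (d / t)))"])
      show "integrable lborel (\<lambda>t. norm (V ?a k t * of_real (exp (d / t))))"
        by (intro integrable_norm VI a)
      show "AE t in lborel. (\<lambda>M. V ?a k t * of_real (\<Sum>m<M. (- (d / t)) ^ m / fact m)) \<longlonglongrightarrow> V ?a k t * of_real (exp (- (d / t)))"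
        by (intro AE_I2 tendsto_mult tendsto_const tendsto_of_real exp_partial_sum_tendsto)
      show "AE t in lborel. norm (V ?a k t * of_real (\<Sum>m<M. (- (d / t)) ^ m / fact m)) \<le> norm (V ?a k t * of_real (exp (d / t)))" for M
      proof (rule AE_I2)
        fix t show "norm (V ?a k t * of_real (\<Sum>m<M. (- (d / t)) ^ m / fact m)) \<le> norm (V ?a k t * of_real (exp (d / t)))"
        proof (cases "0 < t")
          case True
          have "\<bar>\<Sum>m<M. (- (d / t)) ^ m / fact m\<bar> \<le> exp \<bar>- (d / t)\<bar>"
            using norm_exp_partial_sum_le[of "- (d / t)" M] unfolding real_norm_def .
          also have "\<bar>- (d / t)\<bar> = d / t" using True d by simp
          finally show ?thesis
            by (simp only: norm_mult norm_of_real abs_exp_cancel) (rule mult_left_mono, auto)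
        qed (simp add: V_def W_def)
      qed
    qed measurable
    moreover have "(\<integral>t. V ?a k t * of_real (\<Sum>m<M. (- (d / t)) ^ m / fact m) \<partial>lborel) = 0" for M
    proof -
      have "(\<integral>t. V ?a k t * of_real (\<Sum>m<M. (- (d / t)) ^ m / fact m) \<partial>lborel) =
         (\<integral>t. (\<Sum>m<M. of_real ((- d) ^ m / fact m) * V ?a (k + m) t) \<partial>lborel)"
      proof (rule Bochner_Integration.integral_cong[OF refl])
        fix t
        have "V ?a k t * of_real ((- (d / t)) ^ m / fact m) = of_real ((- d) ^ m / fact m) * V ?a (k + m) t" for m
        proof -
          have "(1 / t) ^ k * exp (- (?a / t)) * ((- (d / t)) ^ m / fact m) = (- d) ^ m / fact m * ((1 / t) ^ (k + m) * exp (- (?a / t)))"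
            by (simp add: power_add power_divide power_minus[of "d / t"] power_minus[of d] mult_ac)
          then show ?thesis unfolding V_def by (metis (no_types, opaque_lifting) mult.assoc mult.left_commute of_real_mult)
        qed
        then show "V ?a k t * of_real (\<Sum>m<M. (- (d / t)) ^ m / fact m) = (\<Sum>m<M. of_real ((- d) ^ m / fact m) * V ?a (k + m) t)"
          by (simp only: of_real_sum sum_distrib_left)
      qed
      also have "\<dots> = (\<Sum>m<M. of_real ((- d) ^ m / fact m) * (\<integral>t. V ?a (k + m) t \<partial>lborel))"
        by (subst Bochner_Integration.integral_sum) (use VI0[OF a] in auto)
      finally show ?thesis by (simp add: Suc.IH)
    qed
    ultimately have "(\<integral>t. V ?a k t * of_real (exp (- (d / t))) \<partial>lborel) = 0"
      by (simp add: LIMSEQ_const_iff)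
    also have "(\<lambda>t. V ?a k t * of_real (exp (- (d / t)))) = V (real (Suc j) * d) k"
    proof
      fix t
      have "exp (- (?a / t)) * exp (- (d / t)) = exp (- (real (Suc j) * d / t))"
        by (simp add: add_divide_distrib distrib_right flip: exp_add)
      then show "V ?a k t * of_real (exp (- (d / t))) = V (real (Suc j) * d) k t"
        unfolding V_def by (metis (no_types, opaque_lifting) mult.assoc of_real_mult)
    qed
    finally show ?case .
  qed
  define x where "x t = exp (- (d / t))" for t
  have xm [measurable]: "x \<in> borel_measurable borel" unfolding x_def by measurable
  have xr: "x t \<in> {0..1}" if "0 < t" for t using that d by (auto simp: x_def)
  have WI: "integrable lborel W" using VI0[of 0 0] by (simp add: V_def[abs_def])
  have Wx: "W t * of_real (x t ^ j) = V (real j * d) 0 t" for t j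
    by (simp add: V_def x_def flip: exp_of_nat_mult)
  have Wpoly: "(\<integral>t. W t * of_real (q (x t)) \<partial>lborel) = 0 \<and> integrable lborel (\<lambda>t. W t * of_real (q (x t)))"
    if "real_polynomial_function q" for q
  proof -
    obtain a n where q: "q = (\<lambda>x. \<Sum>i\<le>n. a i * x ^ i)"
      using \<open>real_polynomial_function q\<close> unfolding real_polynomial_function_iff_sum by blast
    have *: "W t * of_real (q (x t)) = (\<Sum>i\<le>n. of_real (a i) * V (real i * d) 0 t)" for t
      unfolding q of_real_sum sum_distrib_left of_real_mult Wx[symmetric] by (simp add: mult_ac)
    have "integrable lborel (V (real i * d) 0)" for i using VI0 d by simp
    then show ?thesis unfolding * by (simp add: Vmom)
  qed
  have Wcont: "(\<integral>t. W t * of_real (q (x t)) \<partial>lborel) = 0"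
    if q: "continuous_on {0..1} q" and qm [measurable]: "q \<in> borel_measurable borel" for q
  proof (rule ccontr)
    let ?J = "\<integral>t. W t * of_real (q (x t)) \<partial>lborel"
    assume J: "?J \<noteq> 0"
    let ?N = "\<integral>t. norm (W t) \<partial>lborel"
    have N: "0 \<le> ?N" by simp
    define e where "e = norm ?J / (?N + 1) / 2"
    have N1: "0 < ?N + 1" using N by linarith
    have e: "0 < e" unfolding e_def using J by (intro divide_pos_pos N1) auto
    obtain p where p: "real_polynomial_function p" "\<And>y. y \<in> {0..1} \<Longrightarrow> \<bar>q y - p y\<bar> < e"
      using Stone_Weierstrass_real_polynomial_function[OF _ q e] by auto
    have ptb: "norm (W t * of_real (q (x t)) - W t * of_real (p (x t))) \<le> norm (W t) * e" for t
    proof (cases "0 < t")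
      case True
      have "norm (W t * of_real (q (x t)) - W t * of_real (p (x t))) = norm (W t) * \<bar>q (x t) - p (x t)\<bar>"
        by (simp flip: right_diff_distrib of_real_diff add: norm_mult)
      then show ?thesis using p(2)[OF xr[OF True]] by (simp add: mult_left_mono)
    qed (simp add: W_def)
    have pm: "(\<lambda>t. W t * of_real (p (x t))) \<in> borel_measurable lborel" using Wpoly[OF p(1)] by auto
    have Idiff: "integrable lborel (\<lambda>t. W t * of_real (q (x t)) - W t * of_real (p (x t)))"
    proof (rule Bochner_Integration.integrable_bound)
      show "integrable lborel (\<lambda>t. norm (W t) * e)" using WI by auto
      show "AE t in lborel. norm (W t * of_real (q (x t)) - W t * of_real (p (x t))) \<le> norm (norm (W t) * e)"
        using ptb e by (auto intro!: AE_I2 order_trans[OF ptb])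
    qed (intro borel_measurable_diff pm, measurable)
    have "integrable lborel (\<lambda>t. (W t * of_real (q (x t)) - W t * of_real (p (x t))) + W t * of_real (p (x t)))"
      by (intro Bochner_Integration.integrable_add Idiff) (use Wpoly[OF p(1)] in auto)
    then have Iq: "integrable lborel (\<lambda>t. W t * of_real (q (x t)))" by simp
    have "?J = (\<integral>t. W t * of_real (q (x t)) - W t * of_real (p (x t)) \<partial>lborel)"
      using Wpoly[OF p(1)] Iq by simp
    also have "norm \<dots> \<le> (\<integral>t. norm (W t) * e \<partial>lborel)"
      by (rule order_trans[OF integral_norm_bound integral_mono])
        (use Idiff WI ptb in auto)
    also have "\<dots> = ?N * e" by simp
    finally have "norm ?J \<le> ?N * e" .
    also have "\<dots> < norm ?J"
    proof -
      have "norm ?J = e * 2 * (?N + 1)" using N1 by (simp add: e_def field_simps)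
      moreover have "?N * e < (?N + 1) * (e * 2)"
        using e N by (simp add: algebra_simps add_pos_nonneg)
      ultimately show ?thesis by (simp add: mult.commute)
    qed
    finally show False by simp
  qed
  \<comment> \<open>\<open>Re (h t) * (1 - x t)\<close> as a function of \<open>x t\<close>; the factor \<open>1 - y\<close> gives continuity at \<open>y = 1\<close>,
      that is, as \<open>t\<close> tends to infinity.\<close>
  define q where "q y = (if 0 < y \<and> y < 1 then Re (h (- (d / ln y))) * (1 - y) else 0)" for y
  have qm: "q \<in> borel_measurable borel" unfolding q_def by measurable
  have qx: "q (x t) = Re (h t) * (1 - x t)" if "0 < t" for t
    using that d by (simp add: q_def x_def)
  have arg: "0 < - (d / ln y)" if "0 < y" "y < 1" for y
    using that d by (simp add: divide_pos_neg)
  have bdry: "isCont q y" if y: "y = 0 \<or> y = 1" for y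
  proof -
    have q0: "\<bar>q z\<bar> \<le> C * z\<^sup>2" if z: "\<bar>z\<bar> < exp (- d)" "0 < z" for z
    proof -
      have z1: "z < 1" using z d by (smt (verit) exp_le_one_iff)
      have l: "ln z < - d" using z by (metis abs_of_pos exp_gt_zero ln_exp ln_less_cancel_iff)
      let ?t = "- (d / ln z)"
      have t: "0 < ?t" "?t \<le> 1" using arg[OF z(2) z1] l d by (auto simp: divide_le_eq field_simps)
      \<comment> \<open>With \<open>t = - d / ln z\<close> the smallness of \<open>h\<close> at the origin reads \<open>\<bar>h t\<bar> \<le> C z\<^sup>2\<close>.\<close>
      have "2 * d / ?t = - (2 * ln z)" using d l by (simp add: field_simps)
      then have "- (2 * d / ?t) = ln z + ln z" by linarith
      then have "exp (- (2 * d / ?t)) = z\<^sup>2"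
        by (simp only: exp_add exp_ln[OF z(2)] power2_eq_square)
      then have "norm (h ?t) \<le> C * z\<^sup>2" using C[OF t] by simp
      moreover have "\<bar>Re (h ?t)\<bar> * (1 - z) \<le> norm (h ?t) * 1"
        using z z1 by (intro mult_mono abs_Re_le_cmod) auto
      ultimately show ?thesis using z z1 by (simp add: q_def abs_mult)
    qed
    have C0: "0 \<le> C" using C[of 1] norm_ge_zero[of "h 1"] by (smt (verit) exp_gt_zero mult_neg_pos zero_less_one)
    have q0': "\<bar>q z\<bar> \<le> C * z\<^sup>2" if "\<bar>z\<bar> < exp (- d)" for z
      using q0[OF that] C0 by (cases "0 < z") (auto simp: q_def)
    have q1: "\<bar>q z\<bar> \<le> \<bar>B\<bar> * \<bar>1 - z\<bar>" for z
    proof (cases "0 < z \<and> z < 1")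
      case True
      then have "\<bar>Re (h (- (d / ln z)))\<bar> \<le> \<bar>B\<bar>"
        using B[OF arg[of z]] abs_Re_le_cmod[of "h (- (d / ln z))"] by linarith
      then show ?thesis using True by (auto simp: q_def abs_mult intro!: mult_mono)
    qed (auto simp: q_def)
    have "q y = 0" using y by (auto simp: q_def)
    moreover have "q \<midarrow>y\<rightarrow> 0"
    proof (cases "y = 0")
      case True
      have "(\<lambda>z. C * z\<^sup>2) \<midarrow>0\<rightarrow> 0" by (auto intro!: tendsto_eq_intros)
      moreover have "\<forall>\<^sub>F z in at 0. norm (q z) \<le> C * z\<^sup>2"
        unfolding eventually_at using q0' by (intro exI[of _ "exp (- d)"]) auto
      ultimately show ?thesis unfolding True by (rule Lim_null_comparison[rotated])
    next
      case False
      then have "y = 1" using y by simp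
      have "(\<lambda>z. \<bar>B\<bar> * \<bar>1 - z\<bar>) \<midarrow>1\<rightarrow> 0" by (auto intro!: tendsto_eq_intros)
      moreover have "\<forall>\<^sub>F z in at 1. norm (q z) \<le> \<bar>B\<bar> * \<bar>1 - z\<bar>" using q1 by (auto intro!: always_eventually)
      ultimately show ?thesis unfolding \<open>y = 1\<close> by (rule Lim_null_comparison[rotated])
    qed
    ultimately show ?thesis by (simp add: isCont_def)
  qed
  have qc: "continuous_on {0..1} q"
  proof -
    have "continuous_on {0<..<1} (\<lambda>y. Re (h (- (d / ln y))) * (1 - y))"
      using arg by (intro continuous_intros continuous_on_compose2[OF cont]) auto
    then have "continuous_on {0<..<1} q"
      by (rule continuous_on_eq) (simp add: q_def)
    then have "isCont q y" if "0 < y" "y < 1" for y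
      using that by (simp add: continuous_on_eq_continuous_at)
    then have "isCont q y" if "y \<in> {0..1}" for y using bdry that by (cases "y = 0 \<or> y = 1") auto
    then show ?thesis by (simp add: continuous_at_imp_continuous_on)
  qed
  let ?G = "\<lambda>t. indicator {0<..} t * ((Re (h t))\<^sup>2 * (t powr (- 1 - s) * (1 - x t)))"
  have GW: "Re (W t * of_real (q (x t))) = ?G t" for t
    by (cases "0 < t") (simp_all add: W_def qx power2_eq_square)
  have Iq: "integrable lborel (\<lambda>t. W t * of_real (q (x t)))"
  proof (rule Bochner_Integration.integrable_bound)
    show "integrable lborel (\<lambda>t. norm (W t) * B)" using WI by auto
    show "AE t in lborel. norm (W t * of_real (q (x t))) \<le> norm (norm (W t) * B)"
    proof (rule AE_I2)
      fix t show "norm (W t * of_real (q (x t))) \<le> norm (norm (W t) * B)"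
      proof (cases "0 < t")
        case True
        have "\<bar>Re (h t)\<bar> * (1 - x t) \<le> B * 1"
          using B[OF True] xr[OF True] abs_Re_le_cmod[of "h t"] by (intro mult_mono) auto
        then have "\<bar>q (x t)\<bar> \<le> B" using xr[OF True] by (simp add: qx[OF True] abs_mult)
        then show ?thesis by (simp add: norm_mult abs_mult mult_left_mono)
      qed (simp add: W_def)
    qed
  qed (use qm in measurable)
  have "integrable lborel ?G" using integrable_Re[OF Iq] by (simp only: GW)
  moreover have "integral\<^sup>L lborel ?G = 0"
    using integral_Re[OF Iq] Wcont[OF qc qm] by (simp only: GW) simp
  moreover have "0 \<le> ?G t" for t
    using xr[of t] by (cases "0 < t") auto
  ultimately have "AE t in lborel. ?G t = 0"
    using integral_nonneg_eq_0_iff_AE[of lborel ?G] by auto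
  then have "AE t in lborel. t \<in> {0<..} \<longrightarrow> Re (h t) = 0"
  proof (rule AE_mp, intro AE_I2 impI)
    fix t :: real assume t: "?G t = 0" "t \<in> {0<..}"
    have "x t < 1" using t d by (simp add: x_def)
    then show "Re (h t) = 0" using t by auto
  qed
  then show ?thesis
    using continuous_on_AE_zero[of "{0<..}" "\<lambda>t. Re (h t)" t] cont t by (auto intro!: continuous_intros)
qed

lemma moments_eq_0:
  fixes h :: "real \<Rightarrow> complex"
  assumes cont: "continuous_on {0<..} h" and hm: "h \<in> borel_measurable borel"
    and d: "0 < d" and s: "0 < s"
    and B: "\<And>t. 0 < t \<Longrightarrow> norm (h t) \<le> B"
    and C: "\<And>t. 0 < t \<Longrightarrow> t \<le> 1 \<Longrightarrow> norm (h t) \<le> C * exp (- (2 * d / t))"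
    and mom: "\<And>k. (\<integral>t. indicator {0<..} t *\<^sub>R (h t * of_real (t powr (- 1 - s - real k))) \<partial>lborel) = 0"
    and t: "0 < t"
  shows "h t = 0"
proof (rule complex_eqI)
  show "Re (h t) = Re 0" using moments_Re_eq_0[OF assms] by simp
  have "Re ((- \<i>) * h t) = 0"
  proof (rule moments_Re_eq_0[where h = "\<lambda>t. - \<i> * h t" and d=d and s=s and B=B and C=C])
    show "continuous_on {0<..} (\<lambda>t. - \<i> * h t)" by (intro continuous_intros cont)
    show "(\<lambda>t. - \<i> * h t) \<in> borel_measurable borel" using hm by measurable
    have "(\<integral>t. indicator {0<..} t *\<^sub>R (- \<i> * h t * of_real (t powr (- 1 - s - real k))) \<partial>lborel) =
      (\<integral>t. - \<i> * (indicator {0<..} t *\<^sub>R (h t * of_real (t powr (- 1 - s - real k)))) \<partial>lborel)" for k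
      by (simp add: mult_ac)
    then show "(\<integral>t. indicator {0<..} t *\<^sub>R (- \<i> * h t * of_real (t powr (- 1 - s - real k))) \<partial>lborel) = 0" for k
      by (simp only: integral_mult_right_zero mom mult_zero_right)
  qed (use d s B C t in \<open>auto simp: norm_mult\<close>)
  then show "Im (h t) = Im 0" by simp
qed

section \<open>Heat evolution with vanishing fractional moments\<close>

text \<open>A Taylor estimate that is uniform for nonnegative arguments. It follows from
\<open>exp (-u) \<le> 1 - u + u\<^sup>2\<close> if \<open>u = b - a\<close> is nonnegative, and otherwise from \<open>1 - v \<le> exp (-v)\<close> with
\<open>v = a - b\<close>, after extracting the factor \<open>exp (-b)\<close>.\<close>

lemma exp_neg_remainder:
  fixes a b :: real
  assumes "0 \<le> a" "0 \<le> b"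
  shows "\<bar>exp (- b) - exp (- a) + (b - a) * exp (- a)\<bar> \<le> (b - a)\<^sup>2"
proof -
  have *: "\<bar>exp (- u) - 1 + u\<bar> \<le> u\<^sup>2" if "0 \<le> u" for u :: real
  proof -
    have "1 \<le> 1 + u ^ 3" using that by simp
    also have "\<dots> = (1 - u + u\<^sup>2) * (1 + u)" by (simp add: algebra_simps power2_eq_square power3_eq_cube)
    also have "\<dots> \<le> (1 - u + u\<^sup>2) * exp u"
    proof (intro mult_left_mono exp_ge_add_one_self)
      have "0 \<le> (1 - u / 2)\<^sup>2 + 3 / 4 * u\<^sup>2" by (intro add_nonneg_nonneg) auto
      then show "0 \<le> 1 - u + u\<^sup>2" by (simp add: power2_eq_square algebra_simps)
    qed
    finally have "exp (- u) \<le> 1 - u + u\<^sup>2" by (simp add: exp_minus field_simps)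
    moreover have "1 + (- u) \<le> exp (- u)" by (rule exp_ge_add_one_self)
    ultimately show ?thesis by linarith
  qed
  show ?thesis
  proof (cases "a \<le> b")
    case True
    have "exp (- b) - exp (- a) + (b - a) * exp (- a) = exp (- a) * (exp (- (b - a)) - 1 + (b - a))"
      by (simp add: algebra_simps flip: exp_add)
    also have "\<bar>\<dots>\<bar> \<le> 1 * (b - a)\<^sup>2"
      unfolding abs_mult by (intro mult_mono *) (use assms True in auto)
    finally show ?thesis by simp
  next
    case False
    define v where "v = a - b"
    have v: "0 \<le> v" using False by (simp add: v_def)
    have "exp (- b) - exp (- a) + (b - a) * exp (- a) = exp (- b) * (1 - exp (- v) * (1 + v))"
      by (simp add: v_def algebra_simps flip: exp_add)
    moreover have "exp (- v) * (1 + v) \<le> 1"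
      using exp_ge_add_one_self[of v] by (simp add: exp_minus field_simps)
    moreover have "1 - v\<^sup>2 \<le> exp (- v) * (1 + v)"
      using mult_right_mono[OF exp_ge_add_one_self[of "- v"], of "1 + v"] v by (simp add: power2_eq_square algebra_simps)
    ultimately have "\<bar>exp (- b) - exp (- a) + (b - a) * exp (- a)\<bar> \<le> exp (- b) * v\<^sup>2"
      by (simp add: abs_mult)
    also have "\<dots> \<le> 1 * v\<^sup>2" using assms by (intro mult_right_mono) auto
    finally show ?thesis by (simp add: v_def power2_commute)
  qed
qed

text \<open>The substitution \<open>t \<mapsto> t / \<tau>\<close> reduces the integral to the Gamma integral at \<open>1 - s\<close>.\<close>

lemma Gamma_kernel:
  assumes s: "s < (1::real)"
  obtains \<gamma> where "\<And>\<tau>. 0 < \<tau> \<Longrightarrow> has_bochner_integral lborel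
      (\<lambda>t. indicator {0<..} t * (t powr (- s) * exp (- (t * \<tau>)))) (\<gamma> * \<tau> powr (s - 1))"
proof -
  let ?f = "\<lambda>t::real. indicator {0<..} t * (t powr (- s) * exp (- t))"
  have "(\<integral>\<^sup>+t. ennreal (?f t) \<partial>lborel) = (\<integral>\<^sup>+t. ennreal (indicator {0..} t * t powr (1 - s - 1) / exp t) \<partial>lborel)"
    by (intro nn_integral_cong) (auto simp: indicator_def exp_minus divide_inverse)
  also have "\<dots> = Gamma (1 - s)" using Gamma_conv_nn_integral_real[of "1 - s"] s by simp
  also have "\<dots> < \<infinity>" by simp
  finally have int: "integrable lborel ?f"
    by (intro integrableI_nonneg) auto
  show ?thesis
  proof (rule that[of "integral\<^sup>L lborel ?f"])
    fix \<tau> :: real assume \<tau>: "0 < \<tau>"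
    have eq: "indicator {0<..} t * (t powr (- s) * exp (- (t * \<tau>))) = \<tau> powr s * ?f (0 + \<tau> * t)" for t
      using \<tau> by (cases "0 < t") (simp_all add: powr_mult powr_minus field_simps zero_less_mult_iff)
    have "integral\<^sup>L lborel ?f = \<tau> * (\<integral>t. ?f (0 + \<tau> * t) \<partial>lborel)"
      using \<tau> by (subst lborel_integral_real_affine[where c=\<tau> and t=0]) auto
    then have "\<tau> powr s * (\<integral>t. ?f (0 + \<tau> * t) \<partial>lborel) = integral\<^sup>L lborel ?f * \<tau> powr (s - 1)"
      using \<tau> by (simp add: powr_diff)
    moreover have "integrable lborel (\<lambda>t. ?f (0 + \<tau> * t))"
      using \<tau> by (intro lborel_integrable_real_affine int) auto
    ultimately show "has_bochner_integral lborel
      (\<lambda>t. indicator {0<..} t * (t powr (- s) * exp (- (t * \<tau>)))) (integral\<^sup>L lborel ?f * \<tau> powr (s - 1))"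
      unfolding eq has_bochner_integral_iff by simp
  qed
qed

text \<open>In the application \<open>g\<close> is the product of the representing function of the Fourier transform of \<open>u\<close>
with the inverse Fourier transform of a test function. Then \<open>\<tau>\<close> is the symbol of \<open>-\<Delta>\<close>, and \<open>H j t\<close> is,
up to sign, the derivative of order \<open>j\<close> in time of the pairing of \<open>u\<close> with the heat evolution of the
test function.\<close>

locale heat_moments =
  fixes g :: "'a::euclidean_space \<Rightarrow> complex" and s :: real
  assumes s: "0 < s" "s < 1"
    and gm [measurable]: "g \<in> borel_measurable borel"
    and gint: "\<And>k. integrable lborel (\<lambda>x. of_real ((norm x)\<^sup>2 ^ k) * g x)"
begin

abbreviation \<tau> :: "'a \<Rightarrow> real" where "\<tau> x \<equiv> (norm x)\<^sup>2"

definition H :: "nat \<Rightarrow> real \<Rightarrow> complex" where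
  "H j t = (\<integral>x. of_real (\<tau> x ^ j * exp (- (t * \<tau> x))) * g x \<partial>lborel)"

definition Bd :: "nat \<Rightarrow> real" where
  "Bd j = (\<integral>x. norm (of_real (\<tau> x ^ j) * g x) \<partial>lborel)"

lemma H_integrand_le:
  assumes "0 \<le> t"
  shows "norm (of_real (\<tau> x ^ j * exp (- (t * \<tau> x))) * g x) \<le> norm (of_real (\<tau> x ^ j) * g x)"
proof -
  have "\<tau> x ^ j * exp (- (t * \<tau> x)) \<le> \<tau> x ^ j * 1" using assms by (intro mult_left_mono) auto
  then show ?thesis by (simp add: norm_mult norm_power mult_right_mono)
qed

lemma Hint:
  assumes "0 \<le> t" shows "integrable lborel (\<lambda>x. of_real (\<tau> x ^ j * exp (- (t * \<tau> x))) * g x)"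
  by (rule Bochner_Integration.integrable_bound[OF gint[of j]])
    (use H_integrand_le[OF assms] in auto)

lemma H_bound: "0 \<le> t \<Longrightarrow> norm (H j t) \<le> Bd j"
  unfolding H_def Bd_def
  by (rule order_trans[OF integral_norm_bound integral_mono])
    (intro integrable_norm Hint gint H_integrand_le, assumption?)+

lemma H_measurable [measurable]: "H j \<in> borel_measurable borel"
  unfolding H_def[abs_def] by measurable

lemma H_deriv:
  assumes t: "0 < t"
  shows "(H j has_vector_derivative - H (Suc j) t) (at t)"
  unfolding has_vector_derivative_def has_derivative_at
proof
  show "bounded_linear (\<lambda>x. x *\<^sub>R - H (Suc j) t)" by (rule bounded_linear_scaleR_left)
  have rem: "norm (H j (t + u) - H j t - u *\<^sub>R - H (Suc j) t) \<le> u\<^sup>2 * Bd (j + 2)" if u: "\<bar>u\<bar> < t" for u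
  proof -
    have tu: "0 \<le> t + u" "0 \<le> t" using u t by auto
    have "H j (t + u) - H j t - u *\<^sub>R - H (Suc j) t = H j (t + u) - H j t + of_real u * H (Suc j) t"
      by (simp add: scaleR_conv_of_real)
    also have "\<dots> = (\<integral>x. of_real (\<tau> x ^ j * exp (- ((t + u) * \<tau> x))) * g x - of_real (\<tau> x ^ j * exp (- (t * \<tau> x))) * g x
        + of_real u * (of_real (\<tau> x ^ Suc j * exp (- (t * \<tau> x))) * g x) \<partial>lborel)"
      unfolding H_def
      using Hint[OF tu(1), of j] Hint[OF tu(2), of j] Hint[OF tu(2), of "Suc j"]
      by (subst Bochner_Integration.integral_add)
         (auto intro!: Bochner_Integration.integrable_diff integrable_mult_right simp del: power_Suc of_real_mult simp: Bochner_Integration.integral_diff)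
    finally have R: "H j (t + u) - H j t - u *\<^sub>R - H (Suc j) t =
      (\<integral>x. of_real (\<tau> x ^ j * exp (- ((t + u) * \<tau> x))) * g x - of_real (\<tau> x ^ j * exp (- (t * \<tau> x))) * g x
        + of_real u * (of_real (\<tau> x ^ Suc j * exp (- (t * \<tau> x))) * g x) \<partial>lborel)" .
    have "norm (H j (t + u) - H j t - u *\<^sub>R - H (Suc j) t) \<le> (\<integral>x. u\<^sup>2 * norm (of_real (\<tau> x ^ (j + 2)) * g x) \<partial>lborel)"
      unfolding R
    proof (rule order_trans[OF integral_norm_bound integral_mono_AE'])
      show "integrable lborel (\<lambda>x. u\<^sup>2 * norm (of_real (\<tau> x ^ (j + 2)) * g x))"
        by (intro integrable_mult_right integrable_norm gint)
      show "AE x in lborel. norm (of_real (\<tau> x ^ j * exp (- ((t + u) * \<tau> x))) * g x - of_real (\<tau> x ^ j * exp (- (t * \<tau> x))) * g x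
        + of_real u * (of_real (\<tau> x ^ Suc j * exp (- (t * \<tau> x))) * g x)) \<le> u\<^sup>2 * norm (of_real (\<tau> x ^ (j + 2)) * g x)"
      proof (rule AE_I2)
        fix x
        let ?b = "(t + u) * \<tau> x" and ?a = "t * \<tau> x"
        have E: "\<bar>exp (- ?b) - exp (- ?a) + (?b - ?a) * exp (- ?a)\<bar> \<le> (?b - ?a)\<^sup>2"
          using tu by (intro exp_neg_remainder) auto
        have eq: "of_real (\<tau> x ^ j * exp (- ?b)) * g x - of_real (\<tau> x ^ j * exp (- ?a)) * g x
           + of_real u * (of_real (\<tau> x ^ Suc j * exp (- ?a)) * g x) =
           of_real (\<tau> x ^ j * (exp (- ?b) - exp (- ?a) + (?b - ?a) * exp (- ?a))) * g x"
          by (simp add: algebra_simps)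
        have "norm (of_real (\<tau> x ^ j * (exp (- ?b) - exp (- ?a) + (?b - ?a) * exp (- ?a))) * g x)
          \<le> (\<tau> x ^ j * (?b - ?a)\<^sup>2) * norm (g x)"
          unfolding norm_mult norm_of_real abs_mult using E
          by (intro mult_right_mono mult_mono) auto
        also have "\<dots> = u\<^sup>2 * norm (of_real (\<tau> x ^ (j + 2)) * g x)"
          by (simp add: norm_mult norm_power algebra_simps power2_eq_square power_add)
        finally show "norm (of_real (\<tau> x ^ j * exp (- ((t + u) * \<tau> x))) * g x - of_real (\<tau> x ^ j * exp (- (t * \<tau> x))) * g x
          + of_real u * (of_real (\<tau> x ^ Suc j * exp (- (t * \<tau> x))) * g x)) \<le> u\<^sup>2 * norm (of_real (\<tau> x ^ (j + 2)) * g x)"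
          unfolding eq .
      qed
    qed auto
    then show ?thesis unfolding Bd_def by simp
  qed
  show "(\<lambda>u. norm (H j (t + u) - H j t - u *\<^sub>R - H (Suc j) t) / norm u) \<midarrow>0\<rightarrow> 0"
  proof (rule Lim_null_comparison)
    show "\<forall>\<^sub>F u in at 0. norm (norm (H j (t + u) - H j t - u *\<^sub>R - H (Suc j) t) / norm u) \<le> \<bar>u\<bar> * Bd (j + 2)"
      unfolding eventually_at
    proof (intro exI[of _ t] conjI t ballI impI)
      fix u :: real assume "u \<noteq> 0 \<and> dist u 0 < t"
      then show "norm (norm (H j (t + u) - H j t - u *\<^sub>R - H (Suc j) t) / norm u) \<le> \<bar>u\<bar> * Bd (j + 2)"
        using rem[of u] by (simp add: divide_le_eq power2_eq_square mult_ac)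
    qed
    show "(\<lambda>u. \<bar>u\<bar> * Bd (j + 2)) \<midarrow>0\<rightarrow> 0" by (auto intro!: tendsto_eq_intros)
  qed
qed

lemma H_isCont: "0 < t \<Longrightarrow> isCont (H j) t"
  using H_deriv has_vector_derivative_continuous by blast

abbreviation J :: "nat \<Rightarrow> real \<Rightarrow> real \<Rightarrow> complex" where
  "J j a t \<equiv> indicator {0<..} t *\<^sub>R (H j t * of_real (t powr a))"

text \<open>The power \<open>\<tau> powr (s + k)\<close> is \<open>\<tau> ^ Suc k\<close> times \<open>\<tau> powr (s - 1)\<close>, and the second factor is a multiple
of the integral of \<open>t powr (- s) * exp (- t \<tau>)\<close>, which converges at \<open>t = 0\<close> because \<open>s < 1\<close>. By
Fubini a vanishing fractional moment of \<open>g\<close> is a vanishing moment of \<open>H (Suc k)\<close> in time.\<close>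

lemma frac_moment:
  assumes frac: "(\<integral>x. of_real (\<tau> x powr s * \<tau> x ^ k) * g x \<partial>lborel) = 0"
  shows "integrable lborel (J (Suc k) (- s))" "integral\<^sup>L lborel (J (Suc k) (- s)) = 0"
proof -
  obtain \<gamma> where \<gamma>: "\<And>\<tau>. 0 < \<tau> \<Longrightarrow> has_bochner_integral lborel
      (\<lambda>t. indicator {0<..} t * (t powr (- s) * exp (- (t * \<tau>)))) (\<gamma> * \<tau> powr (s - 1))"
    using Gamma_kernel[OF s(2)] by blast
  let ?s = "\<lambda>x. of_real (\<tau> x powr s * \<tau> x ^ k) * g x"
  let ?r = "\<lambda>x t. indicator {0<..} t * (t powr (- s) * exp (- (t * \<tau> x)))"
  let ?F = "\<lambda>x t. of_real (?r x t) * (of_real (\<tau> x ^ Suc k) * g x)"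
  have r: "integrable lborel (?r x)" "(\<integral>t. ?r x t \<partial>lborel) = \<gamma> * \<tau> x powr (s - 1)" if "x \<noteq> 0" for x
    using \<gamma>[of "\<tau> x"] that by (auto simp: has_bochner_integral_iff)
  have F: "integrable lborel (?F x)" "(\<integral>t. ?F x t \<partial>lborel) = of_real \<gamma> * (?s x)"
     "(\<integral>t. norm (?F x t) \<partial>lborel) = \<gamma> * norm (?s x)" for x
  proof -
    have pw: "\<tau> x powr (s - 1) * \<tau> x ^ Suc k = \<tau> x powr s * \<tau> x ^ k"
      by (cases "x = 0") (simp_all add: powr_diff)
    show "integrable lborel (?F x)"
      by (cases "x = 0") (simp, intro integrable_mult_left integrable_of_real r)
    show "(\<integral>t. ?F x t \<partial>lborel) = of_real \<gamma> * (?s x)"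
    proof (cases "x = 0")
      case False
      have "(\<integral>t. ?F x t \<partial>lborel) = of_real (\<gamma> * \<tau> x powr (s - 1)) * (of_real (\<tau> x ^ Suc k) * g x)"
        by (simp only: integral_mult_left_zero integral_complex_of_real r(2)[OF False])
      also have "\<dots> = of_real \<gamma> * (of_real (\<tau> x powr (s - 1) * \<tau> x ^ Suc k) * g x)"
        by (simp only: of_real_mult mult.assoc)
      finally show ?thesis by (simp only: pw)
    qed simp
    show "(\<integral>t. norm (?F x t) \<partial>lborel) = \<gamma> * norm (?s x)"
    proof (cases "x = 0")
      case False
      have nr: "norm (of_real (?r x t) :: complex) = ?r x t" for t
        by (simp only: norm_of_real, rule abs_of_nonneg) simp
      have "(\<integral>t. norm (?F x t) \<partial>lborel) = (\<gamma> * \<tau> x powr (s - 1)) * norm (of_real (\<tau> x ^ Suc k) * g x)"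
        unfolding norm_mult[of "of_real (?r x _)"] nr by (simp only: integral_mult_left_zero r(2)[OF False])
      also have "norm (of_real (\<tau> x ^ Suc k) * g x) = \<tau> x ^ Suc k * norm (g x)"
        by (simp only: norm_mult norm_of_real) simp
      also have "(\<gamma> * \<tau> x powr (s - 1)) * (\<tau> x ^ Suc k * norm (g x)) = \<gamma> * ((\<tau> x powr (s - 1) * \<tau> x ^ Suc k) * norm (g x))"
        by (simp only: mult.assoc)
      also have "\<dots> = \<gamma> * norm (?s x)"
        unfolding pw by (simp only: norm_mult[of "of_real _"] norm_of_real) simp
      finally show ?thesis .
    qed simp
  qed
  have gs: "integrable lborel (\<lambda>x. ?s x)"
  proof (rule Bochner_Integration.integrable_bound)
    show "integrable lborel (\<lambda>x. norm (of_real (\<tau> x ^ k) * g x) + norm (of_real (\<tau> x ^ Suc k) * g x))"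
      by (intro Bochner_Integration.integrable_add integrable_norm gint)
    show "AE x in lborel. norm (?s x) \<le> norm (norm (of_real (\<tau> x ^ k) * g x) + norm (of_real (\<tau> x ^ Suc k) * g x))"
    proof (rule AE_I2)
      fix x
      have "\<tau> x powr s \<le> 1 + \<tau> x"
      proof (cases "\<tau> x \<le> 1")
        case True
        then have "\<tau> x powr s \<le> 1" using s by (intro powr_le1) auto
        then show ?thesis by (simp add: add_increasing2)
      next
        case False
        then have "\<tau> x powr s \<le> \<tau> x powr 1" using s by (intro powr_mono) auto
        then show ?thesis using False by simp
      qed
      then have "\<tau> x powr s * (\<tau> x ^ k * norm (g x)) \<le> (1 + \<tau> x) * (\<tau> x ^ k * norm (g x))"
        by (intro mult_right_mono) auto
      then show "norm (?s x) \<le> norm (norm (of_real (\<tau> x ^ k) * g x) + norm (of_real (\<tau> x ^ Suc k) * g x))"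
        by (simp add: norm_mult norm_power algebra_simps)
    qed
  qed measurable
  have I: "integrable (lborel \<Otimes>\<^sub>M lborel) (\<lambda>(x, t). ?F x t)"
  proof (rule lborel_pair.Fubini_integrable)
    show "(\<lambda>(x, t). ?F x t) \<in> borel_measurable (lborel \<Otimes>\<^sub>M lborel)" by measurable
    show "integrable lborel (\<lambda>x. \<integral>t. norm (case (x, t) of (x, t) \<Rightarrow> ?F x t) \<partial>lborel)"
      unfolding prod.case F(3) by (intro integrable_mult_right integrable_norm gs)
    show "AE x in lborel. integrable lborel (\<lambda>t. case (x, t) of (x, t) \<Rightarrow> ?F x t)"
      using F(1) by simp
  qed
  have Jeq: "J (Suc k) (- s) t = (\<integral>x. ?F x t \<partial>lborel)" for t
  proof (cases "0 < t")
    case True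
    have "(\<integral>x. ?F x t \<partial>lborel) = (\<integral>x. of_real (t powr (- s)) * (of_real (\<tau> x ^ Suc k * exp (- (t * \<tau> x))) * g x) \<partial>lborel)"
      using True by (intro Bochner_Integration.integral_cong refl) (simp add: mult_ac)
    then show ?thesis using True by (simp add: H_def mult.commute)
  qed simp
  show "integrable lborel (J (Suc k) (- s))"
    unfolding Jeq using lborel_pair.integrable_snd[OF I] .
  show "integral\<^sup>L lborel (J (Suc k) (- s)) = 0"
    unfolding Jeq lborel_pair.Fubini_integral[OF I] F(2) by (simp only: integral_mult_right_zero frac mult_zero_right)
qed

text \<open>The boundary terms vanish: at \<open>0\<close> by the exponential smallness of \<open>H j\<close>, at infinity because \<open>H j\<close>
is bounded and \<open>a\<close> is negative.\<close>

lemma by_parts: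
  assumes a: "a < 0" and c: "0 < c"
    and small: "\<And>j. \<exists>C. \<forall>t. 0 < t \<longrightarrow> t \<le> 1 \<longrightarrow> norm (H j t) \<le> C * exp (- (c / t))"
    and I: "integrable lborel (J (Suc j) a)"
  shows "integral\<^sup>L lborel (J (Suc j) a) = of_real a * integral\<^sup>L lborel (J j (a - 1))"
    and "integrable lborel (J j (a - 1))"
proof -
  obtain C where C: "\<And>t. 0 < t \<Longrightarrow> t \<le> 1 \<Longrightarrow> norm (H j t) \<le> C * exp (- (c / t))"
    using small[of j] by blast
  show I2: "integrable lborel (J j (a - 1))"
    by (rule integrable_small_at_0[where B="Bd j", OF _ c _ _ C]) (use a H_bound in auto)
  let ?f = "\<lambda>t. H j t * of_real (a * t powr (a - 1)) + - H (Suc j) t * of_real (t powr a)"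
  have ind: "indicator (einterval 0 \<infinity>) t = indicator {0<..} t" for t
    by (auto simp: indicator_def einterval_def zero_ereal_def)
  have eq: "indicator (einterval 0 \<infinity>) t *\<^sub>R ?f t = of_real a * J j (a - 1) t - J (Suc j) a t" for t
    unfolding ind by (cases "0 < t") (simp_all add: algebra_simps)
  have "(LBINT t=0..\<infinity>. ?f t) = 0 - 0"
  proof (rule interval_integral_FTC_integrable[where F = "\<lambda>t. H j t * of_real (t powr a)"])
    show "((\<lambda>t. H j t * of_real (t powr a)) has_vector_derivative ?f t) (at t)" if "0 < ereal t" for t
    proof -
      have t: "0 < t" using that by (simp add: zero_ereal_def)
      have "((\<lambda>t. complex_of_real (t powr a)) has_vector_derivative of_real (a * t powr (a - 1))) (at t)"
        using t by (intro has_vector_derivative_of_real has_real_derivative_powr)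
      from has_vector_derivative_mult[OF H_deriv[OF t] this] show ?thesis by simp
    qed
    show "isCont ?f t" if "0 < ereal t" for t
      using that H_isCont by (auto simp: zero_ereal_def intro!: continuous_intros)
    show "set_integrable lborel (einterval 0 \<infinity>) ?f"
      unfolding set_integrable_def eq
      by (intro Bochner_Integration.integrable_diff integrable_mult_right I I2)
    obtain K where K: "0 \<le> K" "\<And>t. 0 < t \<Longrightarrow> t \<le> 1 \<Longrightarrow> t powr (a - 1) * exp (- (c / t)) \<le> K"
      using power_exp_neg_inverse_bound[OF c] by metis
    have C0: "0 \<le> C" using C[of 1] norm_ge_zero[of "H j 1"] by (smt (verit) exp_gt_zero mult_neg_pos zero_less_one)
    have "((\<lambda>t. H j t * of_real (t powr a)) \<longlongrightarrow> 0) (at_right 0)"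
    proof (rule Lim_null_comparison)
      show "\<forall>\<^sub>F t in at_right 0. norm (H j t * of_real (t powr a)) \<le> C * K * t"
        unfolding eventually_at_right_field
      proof (intro exI[of _ 1] conjI allI impI)
        fix t :: real assume t: "0 < t" "t < 1"
        have "norm (H j t * of_real (t powr a)) \<le> C * exp (- (c / t)) * t powr a"
          using C[of t] t by (simp add: norm_mult mult_right_mono)
        also have "\<dots> = C * (t powr (a - 1) * exp (- (c / t))) * t"
          using t by (simp add: powr_diff)
        also have "\<dots> \<le> C * K * t"
          using t C0 K(2)[of t] by (intro mult_right_mono mult_left_mono) auto
        finally show "norm (H j t * of_real (t powr a)) \<le> C * K * t" .
      qed simp
      show "((\<lambda>t. C * K * t) \<longlongrightarrow> 0) (at_right 0)" by (auto intro!: tendsto_eq_intros)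
    qed
    then show "(((\<lambda>t. H j t * of_real (t powr a)) \<circ> real_of_ereal) \<longlongrightarrow> 0) (at_right 0)"
      unfolding zero_ereal_def by (subst ereal_tendsto_simps)
    have "((\<lambda>t. H j t * of_real (t powr a)) \<longlongrightarrow> 0) at_top"
    proof (rule Lim_null_comparison)
      show "\<forall>\<^sub>F t in at_top. norm (H j t * of_real (t powr a)) \<le> Bd j * t powr a"
        using eventually_gt_at_top[of 0]
        by eventually_elim (simp add: norm_mult H_bound mult_right_mono)
      have "((\<lambda>t. Bd j * t powr a) \<longlongrightarrow> Bd j * 0) at_top"
        using a by (intro tendsto_intros tendsto_neg_powr filterlim_ident)
      then show "((\<lambda>t. Bd j * t powr a) \<longlongrightarrow> 0) at_top" by simp
    qed
    then show "(((\<lambda>t. H j t * of_real (t powr a)) \<circ> real_of_ereal) \<longlongrightarrow> 0) (at_left \<infinity>)"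
      by (subst ereal_tendsto_simps)
  qed simp
  then have "(\<integral>t. of_real a * J j (a - 1) t - J (Suc j) a t \<partial>lborel) = 0"
    by (simp only: interval_lebesgue_integral_def set_lebesgue_integral_def eq) simp
  then show "integral\<^sup>L lborel (J (Suc j) a) = of_real a * integral\<^sup>L lborel (J j (a - 1))"
    by (simp only: Bochner_Integration.integral_diff[OF integrable_mult_right[OF I2] I]
        integral_mult_right_zero eq_iff_diff_eq_0[symmetric])
qed

text \<open>Each integration by parts lowers the order of the time derivative and the exponent of \<open>t\<close> by one, at
the cost of a factor \<open>- s - m\<close>, which is nonzero as \<open>s > 0\<close>. This leads from the moments of \<open>H (Suc k)\<close>
with exponent \<open>- s\<close> to those of \<open>H 0\<close> with exponents \<open>- s - 1 - k\<close>.\<close>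

lemma heat_eq_0:
  assumes frac: "\<And>k. (\<integral>x. of_real (\<tau> x powr s * \<tau> x ^ k) * g x \<partial>lborel) = 0"
    and c: "0 < c"
    and small: "\<And>j. \<exists>C. \<forall>t. 0 < t \<longrightarrow> t \<le> 1 \<longrightarrow> norm (H j t) \<le> C * exp (- (c / t))"
    and t: "0 < t"
  shows "H 0 t = 0"
proof -
  have ne: "complex_of_real (- s - real m) \<noteq> 0" for m
    using s by (subst of_real_eq_0_iff) linarith
  have mom: "integrable lborel (J j (- s - real m - 1)) \<and> integral\<^sup>L lborel (J j (- s - real m - 1)) = 0" for j m
  proof (induction m arbitrary: j)
    case 0
    have "- s < 0" using s by simp
    from by_parts[OF this c small frac_moment(1)[OF frac, of j]] frac_moment(2)[OF frac, of j] ne[of 0]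
    show ?case by simp
  next
    case (Suc m)
    have a: "- s - real m - 1 < 0" using s by linarith
    have i: "integrable lborel (J (Suc j) (- s - real m - 1))" and z: "integral\<^sup>L lborel (J (Suc j) (- s - real m - 1)) = 0"
      using Suc.IH[of "Suc j"] by auto
    have e: "- s - real m - 1 - 1 = - s - real (Suc m) - 1" "- s - real m - 1 = - s - real (Suc m)" by simp_all
    have "of_real (- s - real (Suc m)) * integral\<^sup>L lborel (J j (- s - real (Suc m) - 1)) = 0"
      using by_parts(1)[OF a c small i] z by (simp only: e)
    with ne[of "Suc m"] have "integral\<^sup>L lborel (J j (- s - real (Suc m) - 1)) = 0"
      by (simp only: mult_eq_0_iff simp_thms)
    then show ?case using by_parts(2)[OF a c small i] unfolding e by blast
  qed
  obtain C where C: "\<And>t. 0 < t \<Longrightarrow> t \<le> 1 \<Longrightarrow> norm (H 0 t) \<le> C * exp (- (c / t))"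
    using small[of 0] by blast
  show ?thesis
  proof (rule moments_eq_0[where d = "c / 2" and s = s and B = "Bd 0" and C = C and h = "H 0"])
    show "continuous_on {0<..} (H 0)"
      using H_isCont by (intro continuous_at_imp_continuous_on) auto
    have e: "- 1 - s - real k = - s - real k - 1" for k by simp
    show "integral\<^sup>L lborel (J 0 (- 1 - s - real k)) = 0" for k
      using mom[of 0 k] unfolding e by simp
  qed (use s c t C H_bound in auto)
qed

end

section \<open>Vanishing distributions\<close>

lemma schwartz_slow: "f \<in> schwartz \<Longrightarrow> slow f"
  unfolding slow_def
proof
  fix n assume "f \<in> schwartz"
  then obtain C where "dbound n (\<lambda>x. C / (1 + norm x) ^ 0) f" "0 \<le> C"
    unfolding schwartz_iff decay_weights_def by blast
  then have "dbound n (\<lambda>x. C * (1 + norm x) ^ 0) f" by simp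
  moreover have "(\<lambda>x. C * (1 + norm x) ^ 0) \<in> poly_weights"
    unfolding poly_weights_def using \<open>0 \<le> C\<close> by blast
  ultimately show "\<exists>W\<in>poly_weights. dbound n W f" by blast
qed

lemma schwartz_mult: "f \<in> schwartz \<Longrightarrow> g \<in> schwartz \<Longrightarrow> (\<lambda>x. f x * g x) \<in> schwartz"
  by (intro slow_mult_schwartz schwartz_slow)

text \<open>The Sobolev condition supplies a representing function for the weighted Fourier transform. Division
by the weight is possible because the inverse weight, too, multiplies the Schwartz space into
itself. Hence the choice in \<^const>\<open>density_of\<close> is made from a nonempty set.\<close>

lemma density_of_represents:
  fixes u :: "('a::euclidean_space) dist"
  assumes "u \<in> sobolev (- r)"
  shows "represented_by (fourier_dist u) (density_of (fourier_dist u))"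
proof -
  let ?w = "\<lambda>p (\<xi>::'a). complex_of_real ((1 + (norm \<xi>)\<^sup>2) powr p)"
  obtain h where h: "represented_by (mult_dist (?w (- r / 2)) (fourier_dist u)) h"
    using assms unfolding sobolev_def in_L2_def by auto
  then have [measurable]: "h \<in> borel_measurable borel" by (simp add: represented_by_def)
  have inv: "?w (- r / 2) \<xi> * (?w (r / 2) \<xi> * z) = z" for \<xi> z
  proof -
    have "0 < 1 + (norm \<xi>)\<^sup>2" by (simp add: add_pos_nonneg)
    then have "(1 + (norm \<xi>)\<^sup>2) powr (- r / 2) * (1 + (norm \<xi>)\<^sup>2) powr (r / 2) = 1"
      by (simp flip: powr_add)
    then have "?w (- r / 2) \<xi> * ?w (r / 2) \<xi> = 1" by (metis of_real_1 of_real_mult)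
    then show ?thesis by (simp add: mult.assoc[symmetric])
  qed
  have "represented_by (fourier_dist u) (\<lambda>\<xi>. h \<xi> * ?w (r / 2) \<xi>)"
    unfolding represented_by_def
  proof (intro conjI ballI)
    show "(\<lambda>\<xi>. h \<xi> * ?w (r / 2) \<xi>) \<in> borel_measurable lborel" by measurable
    fix f :: "'a \<Rightarrow> complex" assume "f \<in> schwartz"
    then have wf: "(\<lambda>\<xi>. ?w (r / 2) \<xi> * f \<xi>) \<in> schwartz"
      by (intro slow_mult_schwartz slow_bracket)
    show "integrable lborel (\<lambda>\<xi>. h \<xi> * ?w (r / 2) \<xi> * f \<xi>)"
      using h wf unfolding represented_by_def by (auto simp: mult.assoc)
    have "mult_dist (?w (- r / 2)) (fourier_dist u) (\<lambda>\<xi>. ?w (r / 2) \<xi> * f \<xi>) = regular_dist h (\<lambda>\<xi>. ?w (r / 2) \<xi> * f \<xi>)"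
      using h wf unfolding represented_by_def by blast
    then show "fourier_dist u f = regular_dist (\<lambda>\<xi>. h \<xi> * ?w (r / 2) \<xi>) f"
      unfolding mult_dist_def inv regular_dist_def by (simp add: mult.assoc)
  qed
  then show ?thesis unfolding density_of_def by (rule someI[of "represented_by (fourier_dist u)"])
qed

lemma schwartz_norm_le:
  fixes f :: "'a::euclidean_space \<Rightarrow> complex"
  assumes "\<And>bs x. bs \<in> lists Basis \<Longrightarrow> length bs \<le> N \<Longrightarrow> (1 + norm x) ^ N * norm (iter_pderiv bs f x) \<le> B"
  shows "schwartz_norm N f \<le> real (card {bs \<in> lists (Basis::'a set). length bs \<le> N}) * B"
  unfolding schwartz_norm_def
  by (rule order_trans[OF sum_bounded_above]) (auto intro!: cSUP_least assms)

definition neg_laplacian :: "('a::euclidean_space \<Rightarrow> complex) \<Rightarrow> 'a \<Rightarrow> complex" where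
  "neg_laplacian f x = - 1 * (\<Sum>b\<in>Basis. pd b (pd b f) x)"

definition dir_deriv :: "'a \<Rightarrow> ('a::euclidean_space \<Rightarrow> complex) \<Rightarrow> 'a \<Rightarrow> complex" where
  "dir_deriv y f x = (\<Sum>b\<in>Basis. of_real (y \<bullet> b) * pd b f x)"

lemma test_fun_neg_laplacian: "test_fun a d f \<Longrightarrow> test_fun a d (neg_laplacian f)"
  unfolding neg_laplacian_def[abs_def]
  by (intro test_fun_cmult test_fun_sum test_fun_pd)

lemma test_fun_dir_deriv: "test_fun a d f \<Longrightarrow> test_fun a d (dir_deriv y f)"
  unfolding dir_deriv_def[abs_def]
  by (intro test_fun_cmult test_fun_sum test_fun_pd)

lemma inv_fourier_cmult: "inv_fourier (\<lambda>x. c * f x) \<xi> = c * inv_fourier f \<xi>"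
  unfolding inv_fourier_eq_fourier by (simp add: fourier_cmult)

lemma inv_fourier_sum:
  "(\<And>i. i \<in> I \<Longrightarrow> f i \<in> schwartz) \<Longrightarrow> inv_fourier (\<lambda>x. \<Sum>i\<in>I. f i x) \<xi> = (\<Sum>i\<in>I. inv_fourier (f i) \<xi>)"
  unfolding inv_fourier_eq_fourier by (simp add: fourier_sum sum_distrib_left)

lemma inv_fourier_neg_laplacian:
  fixes f :: "'a::euclidean_space \<Rightarrow> complex"
  assumes f: "f \<in> schwartz"
  shows "inv_fourier (neg_laplacian f) \<xi> = of_real ((norm \<xi>)\<^sup>2) * inv_fourier f \<xi>"
proof -
  have "inv_fourier (neg_laplacian f) \<xi> = - 1 * (\<Sum>b\<in>Basis. inv_fourier (pd b (pd b f)) \<xi>)"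
    unfolding neg_laplacian_def[abs_def] inv_fourier_cmult
    by (subst inv_fourier_sum) (auto intro: schwartz_pd f)
  also have "\<dots> = (\<Sum>b\<in>Basis. of_real ((\<xi> \<bullet> b) * (\<xi> \<bullet> b)) * inv_fourier f \<xi>)"
    unfolding sum_distrib_left
    by (intro sum.cong refl) (simp add: inv_fourier_pd schwartz_pd f algebra_simps)
  also have "\<dots> = of_real ((norm \<xi>)\<^sup>2) * inv_fourier f \<xi>"
    unfolding power2_norm_eq_inner euclidean_inner[of \<xi> \<xi>]
    by (simp only: of_real_sum sum_distrib_right)
  finally show ?thesis .
qed

lemma inv_fourier_dir_deriv:
  fixes f :: "'a::euclidean_space \<Rightarrow> complex"
  assumes f: "f \<in> schwartz"
  shows "inv_fourier (dir_deriv y f) \<xi> = - \<i> * of_real (y \<bullet> \<xi>) * inv_fourier f \<xi>"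
proof -
  have "inv_fourier (dir_deriv y f) \<xi> = (\<Sum>b\<in>Basis. of_real (y \<bullet> b) * inv_fourier (pd b f) \<xi>)"
    unfolding dir_deriv_def[abs_def]
    by (subst inv_fourier_sum) (auto intro: schwartz_pd schwartz_cmult f simp: inv_fourier_cmult)
  also have "\<dots> = (\<Sum>b\<in>Basis. (- \<i> * inv_fourier f \<xi>) * of_real ((y \<bullet> b) * (\<xi> \<bullet> b)))"
    by (intro sum.cong refl) (simp add: inv_fourier_pd f algebra_simps)
  also have "\<dots> = - \<i> * of_real (y \<bullet> \<xi>) * inv_fourier f \<xi>"
    unfolding euclidean_inner[of y \<xi>] by (simp add: sum_distrib_left sum_distrib_right mult_ac)
  finally show ?thesis .
qed

subsection \<open>Heat evolution of a test function\<close>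

text \<open>This is \<open>exp (t \<Delta>) f\<close>.\<close>

definition heat :: "real \<Rightarrow> ('a::euclidean_space \<Rightarrow> complex) \<Rightarrow> 'a \<Rightarrow> complex" where
  "heat t f = fourier (\<lambda>\<xi>. inv_fourier f \<xi> * gauss t \<xi>)"

lemma heat_symbol_schwartz:
  "f \<in> schwartz \<Longrightarrow> 0 < t \<Longrightarrow> (\<lambda>\<xi>. inv_fourier f \<xi> * gauss t \<xi>) \<in> schwartz"
  by (intro schwartz_mult inv_fourier_schwartz gauss_schwartz)

lemma heat_schwartz: "f \<in> schwartz \<Longrightarrow> 0 < t \<Longrightarrow> heat t f \<in> schwartz"
  unfolding heat_def by (intro fourier_schwartz heat_symbol_schwartz)

lemma pd_heat:
  assumes "f \<in> schwartz" "0 < t" "b \<in> Basis"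
  shows "pd b (heat t f) = heat t (pd b f)"
proof
  fix x
  have "pd b (heat t f) x = fourier (\<lambda>\<xi>. - \<i> * of_real (\<xi> \<bullet> b) * (inv_fourier f \<xi> * gauss t \<xi>)) x"
    unfolding heat_def by (rule pd_eq[OF fourier_has_derivative[OF heat_symbol_schwartz[OF assms(1,2)]]])
  also have "(\<lambda>\<xi>. - \<i> * of_real (\<xi> \<bullet> b) * (inv_fourier f \<xi> * gauss t \<xi>)) = (\<lambda>\<xi>. inv_fourier (pd b f) \<xi> * gauss t \<xi>)"
    by (simp only: inv_fourier_pd[OF assms(1,3)] mult.assoc)
  finally show "pd b (heat t f) x = heat t (pd b f) x" by (simp add: heat_def)
qed

lemma iter_pderiv_schwartz: "f \<in> schwartz \<Longrightarrow> bs \<in> lists Basis \<Longrightarrow> iter_pderiv bs f \<in> schwartz"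
  by (induction bs) (auto simp: iter_pderiv_Cons intro: schwartz_pd)

lemma iter_pderiv_heat:
  assumes "f \<in> schwartz" "0 < t" "bs \<in> lists Basis"
  shows "iter_pderiv bs (heat t f) = heat t (iter_pderiv bs f)"
  using assms(3)
  by (induction bs) (auto simp: iter_pderiv_Cons pd_heat iter_pderiv_schwartz assms)

text \<open>For \<open>y\<close> in the support of \<open>f\<close> one has \<open>\<bar>x - y\<bar> \<ge> \<bar>x - a\<bar> - d \<ge> \<bar>x - a\<bar> / 2\<close>, so the exponent
\<open>\<bar>x - y\<bar>\<^sup>2 / (4 t)\<close> of the heat kernel is at least \<open>\<bar>x - a\<bar>\<^sup>2 / (16 t)\<close>.\<close>

lemma heat_far:
  fixes f :: "'a::euclidean_space \<Rightarrow> complex"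
  assumes f: "test_fun a d f" and t: "0 < t" and d: "0 < d" and x: "2 * d \<le> dist a x"
  shows "norm (heat t f x) \<le> gauss_mass TYPE('a) t / (2 * pi) ^ DIM('a) * (\<integral>y. norm (f y) \<partial>lborel)
     * exp (- ((dist a x)\<^sup>2 / (16 * t)))"
proof -
  let ?K = "gauss_mass TYPE('a) t / (2 * pi) ^ DIM('a)" and ?e = "exp (- ((dist a x)\<^sup>2 / (16 * t)))"
  have fS: "f \<in> schwartz" by (rule test_fun_schwartz[OF f])
  have K: "0 \<le> ?K" using gauss_mass_pos[OF t, where 'a='a] by simp
  have "norm (\<integral>y. f y * gauss (1 / (4 * t)) (x - y) \<partial>lborel) \<le> (\<integral>y. norm (f y) * ?e \<partial>lborel)"
  proof (rule order_trans[OF integral_norm_bound integral_mono_AE'])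
    show "integrable lborel (\<lambda>y. norm (f y) * ?e)"
      using schwartz_integrable[OF fS] by simp
    show "AE y in lborel. norm (f y * gauss (1 / (4 * t)) (x - y)) \<le> norm (f y) * ?e"
    proof (rule AE_I2)
      fix y show "norm (f y * gauss (1 / (4 * t)) (x - y)) \<le> norm (f y) * ?e"
      proof (cases "y \<in> cball a d")
        case True
        have "dist a x \<le> d + norm (x - y)"
          using True dist_triangle[of a x y] by (simp add: dist_norm norm_minus_commute)
        then have "dist a x / 2 \<le> norm (x - y)" using x by linarith
        then have "(dist a x / 2)\<^sup>2 \<le> (norm (x - y))\<^sup>2" by (intro power_mono) auto
        then have "(dist a x)\<^sup>2 / (16 * t) \<le> (norm (x - y))\<^sup>2 / (4 * t)"
          using t by (simp add: power_divide field_simps)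
        then show ?thesis
          unfolding norm_mult gauss_def by (intro mult_left_mono) auto
      qed (use f in \<open>simp add: test_fun_def\<close>)
    qed
  qed auto
  then have "?K * norm (\<integral>y. f y * gauss (1 / (4 * t)) (x - y) \<partial>lborel) \<le> ?K * ((\<integral>y. norm (f y) \<partial>lborel) * ?e)"
    by (intro mult_left_mono K) simp
  then show ?thesis
    unfolding heat_def fourier_inv_fourier_gauss[OF fS t] norm_mult norm_of_real abs_of_nonneg[OF K]
    by (simp only: mult.assoc)
qed

text \<open>The distribution is known to vanish on a ball larger than the one that carries the test
functions \<open>f\<close>; the cutoff function that separates the support of \<open>f\<close> from the region where the
heat evolution of \<open>f\<close> is small lives in between.\<close>

locale vanishing =
  fixes u :: "('a::euclidean_space) dist" and g :: "'a \<Rightarrow> complex" and a :: 'a and d s :: real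
  assumes u: "u \<in> tempered" and d: "0 < d" and s: "0 < s" "s < 1"
    and gm [measurable]: "g \<in> borel_measurable borel"
    and gint: "\<And>f. f \<in> schwartz \<Longrightarrow> integrable lborel (\<lambda>\<xi>. g \<xi> * f \<xi>)"
    and rep: "\<And>f. f \<in> schwartz \<Longrightarrow> u (fourier f) = (\<integral>\<xi>. g \<xi> * f \<xi> \<partial>lborel)"
    and van: "\<And>f. test_fun a (4 * d) f \<Longrightarrow> u f = 0"
    and fvan: "\<And>f. test_fun a d f \<Longrightarrow>
        (\<integral>\<xi>. of_real (norm \<xi> powr (2 * s)) * g \<xi> * inv_fourier f \<xi> \<partial>lborel) = 0"
begin

lemma u_add: "f \<in> schwartz \<Longrightarrow> h \<in> schwartz \<Longrightarrow> u (\<lambda>x. f x + h x) = u f + u h"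
  using u unfolding tempered_def by blast

lemma u_cmult: "f \<in> schwartz \<Longrightarrow> u (\<lambda>x. c * f x) = c * u f"
  using u unfolding tempered_def by blast

text \<open>Let \<open>\<eta>\<close> be a cutoff function that is \<open>1\<close> on the ball of radius \<open>2 d\<close> and supported in the ball of
radius \<open>4 d\<close>, where \<open>u\<close> vanishes. Then \<open>u\<close> takes the same value on the heat evolution of \<open>f\<close> and on
its product with \<open>1 - \<eta>\<close>. That product lives at distance at least \<open>2 d\<close> from \<open>a\<close>, where the heat
evolution and all its derivatives, being heat evolutions of derivatives of \<open>f\<close>, are exponentially
small. Continuity of \<open>u\<close> transfers the bound to the pairing.\<close>

lemma off_diagonal:
  assumes f: "test_fun a d f"
  shows "\<exists>C. \<forall>t. 0 < t \<longrightarrow> t \<le> 1 \<longrightarrow> norm (u (heat t f)) \<le> C * exp (- (d\<^sup>2 / 16 / t))"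
proof -
  let ?E = "\<lambda>t. exp (- (d\<^sup>2 / 16 / t))"
  have fS: "f \<in> schwartz" by (rule test_fun_schwartz[OF f])
  obtain C0 N where C0: "\<And>f. f \<in> schwartz \<Longrightarrow> norm (u f) \<le> C0 * schwartz_norm N f"
    using u unfolding tempered_def by blast
  let ?F = "{bs \<in> lists (Basis::'a set). length bs \<le> N}"
  have finF: "finite ?F" by (rule finite_lists_Basis)
  obtain \<eta> where \<eta>: "smooth \<eta>" "\<And>x. dist a x \<le> 2 * d \<Longrightarrow> \<eta> x = 1" "\<And>x. 2 * (2 * d) \<le> dist a x \<Longrightarrow> \<eta> x = 0"
    using cutoff_exists[of "2 * d" a] d by (metis mult_pos_pos zero_less_numeral)
  have \<eta>t: "test_fun a (4 * d) \<eta>" unfolding test_fun_def using \<eta> by auto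
  define \<kappa> where "\<kappa> x = 1 + (- 1) * \<eta> x" for x
  obtain K0 where K0: "dbound N (\<lambda>x. K0 / (1 + norm x) ^ 0) \<eta>" "0 \<le> K0"
    using test_fun_schwartz[OF \<eta>t] unfolding schwartz_iff decay_weights_def by blast
  have "dbound N (\<lambda>x. norm (1::complex) + 2 ^ N * (norm (-1::complex) * (K0 / (1 + norm x) ^ 0))) \<kappa>"
    unfolding \<kappa>_def[abs_def] by (intro dbound_add dbound_const dbound_mult K0)
  then obtain K where K: "dbound N (\<lambda>_. K) \<kappa>" by auto
  have K_nonneg: "0 \<le> K" using dbound_nonneg[OF K] .
  have K': "dbound N (\<lambda>x. if 2 * d \<le> dist a x then K else 0) \<kappa>"
    unfolding dbound_def
  proof (intro conjI ballI impI allI)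
    fix bs :: "'a list" and x assume bs: "bs \<in> lists Basis" "length bs \<le> N"
    have "iter_pderiv bs \<kappa> x = 0" if "dist a x < 2 * d"
      by (rule iter_pderiv_zero_open[of "ball a (2 * d)"]) (use that \<eta> in \<open>auto simp: \<kappa>_def\<close>)
    then show "norm (iter_pderiv bs \<kappa> x) \<le> (if 2 * d \<le> dist a x then K else 0)"
      using dboundD[OF K bs, of x] by auto
  next
    fix bs :: "'a list" and x assume "bs \<in> lists Basis" "length bs < N"
    then show "iter_pderiv bs \<kappa> differentiable at x" using K unfolding dbound_def by blast
  qed
  define L where "L = (\<Sum>bs\<in>?F. \<integral>y. norm (iter_pderiv bs f y) \<partial>lborel)"
  have L0: "0 \<le> L" unfolding L_def by (intro sum_nonneg) simp
  define P where "P = exp ((real N)\<^sup>2 / (4 * (1 / 32)))"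
  obtain Q where Q: "0 \<le> Q" "\<And>t. 0 < t \<Longrightarrow> t \<le> 1 \<Longrightarrow> t powr (- (real DIM('a) / 2)) * ?E t \<le> Q"
    using power_exp_neg_inverse_bound[of "d\<^sup>2 / 16"] d by (metis divide_pos_pos zero_less_numeral zero_less_power)
  define M1 where "M1 = gauss_mass TYPE('a) 1 / (2 * pi) ^ DIM('a)"
  have M1: "0 \<le> M1" unfolding M1_def using gauss_mass_pos[of 1, where 'a='a] by simp
  let ?B = "2 ^ N * K * L * (1 + norm a) ^ N * P * M1 * Q"
  define C where "C = \<bar>C0\<bar> * (real (card ?F) * (?B))"
  have "norm (u (heat t f)) \<le> C * ?E t" if t: "0 < t" "t \<le> 1" for t
  proof -
    let ?v = "heat t f"
    have vS: "?v \<in> schwartz" by (rule heat_schwartz[OF fS t(1)])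
    define A where "A = gauss_mass TYPE('a) t / (2 * pi) ^ DIM('a) * L"
    have A0: "0 \<le> A" unfolding A_def using L0 gauss_mass_pos[OF t(1), where 'a='a] by simp
    \<comment> \<open>Inside the ball any finite weight will do, because it is multiplied by \<open>0\<close>.\<close>
    let ?W = "\<lambda>x. if 2 * d \<le> dist a x then A * exp (- ((dist a x)\<^sup>2 / (16 * t)))
        else (\<Sum>bs\<in>?F. norm (iter_pderiv bs ?v x))"
    have W: "dbound N ?W ?v"
      unfolding dbound_def
    proof (intro conjI ballI impI allI)
      fix bs :: "'a list" and x assume bs: "bs \<in> lists Basis" "length bs \<le> N"
      show "norm (iter_pderiv bs ?v x) \<le> ?W x"
      proof (cases "2 * d \<le> dist a x")
        case True
        have le: "(\<integral>y. norm (iter_pderiv bs f y) \<partial>lborel) \<le> L"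
          unfolding L_def using bs finF by (intro member_le_sum) auto
        have "norm (iter_pderiv bs ?v x) \<le> gauss_mass TYPE('a) t / (2 * pi) ^ DIM('a) *
            (\<integral>y. norm (iter_pderiv bs f y) \<partial>lborel) * exp (- ((dist a x)\<^sup>2 / (16 * t)))"
          unfolding iter_pderiv_heat[OF fS t(1) bs(1)]
          by (rule heat_far[OF test_fun_iter_pderiv[OF f bs(1)] t(1) d True])
        also have "\<dots> \<le> A * exp (- ((dist a x)\<^sup>2 / (16 * t)))"
          unfolding A_def using gauss_mass_pos[OF t(1), where 'a='a]
          by (intro mult_right_mono mult_left_mono le) auto
        finally show ?thesis using True by simp
      next
        case False
        have "norm (iter_pderiv bs ?v x) \<le> (\<Sum>bs\<in>?F. norm (iter_pderiv bs ?v x))"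
          using bs finF by (intro member_le_sum[of bs ?F "\<lambda>bs. norm (iter_pderiv bs ?v x)"]) auto
        then show ?thesis using False by simp
      qed
    next
      fix bs :: "'a list" and x assume "bs \<in> lists Basis" "length bs < N"
      then show "iter_pderiv bs ?v differentiable at x"
        using schwartz_smooth[OF vS] unfolding smooth_def by blast
    qed
    let ?w = "\<lambda>x. \<kappa> x * ?v x"
    note prod = dbound_mult[OF K' W]
    have \<eta>v: "test_fun a (4 * d) (\<lambda>x. \<eta> x * ?v x)"
      using \<eta>t schwartz_smooth[OF vS] unfolding test_fun_def by (auto intro: smooth_mult)
    have eq: "?w = (\<lambda>x. ?v x + (- 1) * (\<eta> x * ?v x))"
      by (simp add: \<kappa>_def algebra_simps)
    have kvS: "?w \<in> schwartz"
      unfolding eq by (intro schwartz_add vS schwartz_cmult test_fun_schwartz[OF \<eta>v])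
    have "u ?w = u ?v"
      unfolding eq using u_add[OF vS schwartz_cmult[OF test_fun_schwartz[OF \<eta>v], of "-1"]]
        u_cmult[OF test_fun_schwartz[OF \<eta>v], of "-1"] van[OF \<eta>v] by simp
    then have "norm (u ?v) \<le> C0 * schwartz_norm N ?w"
      using C0[OF kvS] by simp
    also have "\<dots> \<le> \<bar>C0\<bar> * schwartz_norm N ?w"
    proof (rule mult_right_mono)
      have "0 \<le> (SUP x. (1 + norm x) ^ N * norm (iter_pderiv bs ?w x))" if "bs \<in> lists Basis" for bs
      proof -
        have "bounded (range (\<lambda>x. (1 + norm x) ^ N *\<^sub>R iter_pderiv bs ?w x))"
          using kvS that unfolding schwartz_def by auto
        then obtain B where "\<And>x. norm ((1 + norm x) ^ N *\<^sub>R iter_pderiv bs ?w x) \<le> B"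
          unfolding bounded_iff by auto
        then have "bdd_above (range (\<lambda>x. (1 + norm x) ^ N * norm (iter_pderiv bs ?w x)))"
          by (intro bdd_aboveI[of _ B]) (auto simp: power_abs)
        then show ?thesis by (intro cSUP_upper2[where x=0]) auto
      qed
      then show "0 \<le> schwartz_norm N ?w"
        unfolding schwartz_norm_def by (intro sum_nonneg) auto
    qed simp
    finally have 1: "norm (u ?v) \<le> \<bar>C0\<bar> * schwartz_norm N ?w" .
    have 2: "schwartz_norm N ?w \<le> real (card ?F) * (?B * ?E t)"
    proof (rule schwartz_norm_le)
      fix bs :: "'a list" and x assume bs: "bs \<in> lists Basis" "length bs \<le> N"
      have nn: "0 \<le> ?B * ?E t"
        using K_nonneg L0 M1 Q(1) by (simp add: P_def)
      have p: "norm (iter_pderiv bs ?w x) \<le> 2 ^ N * ((if 2 * d \<le> dist a x then K else 0) * ?W x)"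
        using dboundD[OF prod bs] .
      show "(1 + norm x) ^ N * norm (iter_pderiv bs ?w x)
         \<le> ?B * ?E t"
      proof (cases "2 * d \<le> dist a x")
        case False
        then have "norm (iter_pderiv bs ?w x) = 0" using p by simp
        then show ?thesis using nn by simp
      next
        case True
        let ?\<rho> = "dist a x"
        \<comment> \<open>One half of the exponent is kept for decay in \<open>x\<close>, uniformly in \<open>t \<le> 1\<close>. The other half is at least
            \<open>d\<^sup>2 / (8 t)\<close>; one half of this absorbs the power \<open>t powr (- n / 2)\<close> and the rest survives.\<close>
        have "(2 * d)\<^sup>2 \<le> ?\<rho>\<^sup>2" using True d by (intro power_mono) auto
        then have "4 * d\<^sup>2 / (32 * t) \<le> ?\<rho>\<^sup>2 / (32 * t)"
          using t by (intro divide_right_mono) (auto simp: power_mult_distrib)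
        moreover have "?\<rho>\<^sup>2 / 32 \<le> ?\<rho>\<^sup>2 / (32 * t)"
          using t by (intro divide_left_mono) auto
        moreover have "4 * d\<^sup>2 / (32 * t) = d\<^sup>2 / 16 / t + d\<^sup>2 / 16 / t"
          "?\<rho>\<^sup>2 / (16 * t) = ?\<rho>\<^sup>2 / (32 * t) + ?\<rho>\<^sup>2 / (32 * t)" using t by (simp_all add: field_simps)
        ultimately have "- (?\<rho>\<^sup>2 / (16 * t)) \<le> - (1 / 32) * ?\<rho>\<^sup>2 + (- (d\<^sup>2 / 16 / t) + - (d\<^sup>2 / 16 / t))"
          by linarith
        then have e: "exp (- (?\<rho>\<^sup>2 / (16 * t))) \<le> exp (- (1 / 32) * ?\<rho>\<^sup>2) * (?E t * ?E t)"
          by (simp only: exp_add[symmetric] exp_le_cancel_iff)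
        have "norm x \<le> norm a + ?\<rho>"
          using norm_triangle_ineq[of a "x - a"] by (simp add: dist_norm norm_minus_commute)
        moreover have "0 \<le> norm a * ?\<rho>" by simp
        ultimately have "1 + norm x \<le> (1 + norm a) * (1 + ?\<rho>)"
          unfolding distrib_left distrib_right mult_1_left mult_1_right by linarith
        then have n: "(1 + norm x) ^ N \<le> (1 + norm a) ^ N * (1 + ?\<rho>) ^ N"
          unfolding power_mult_distrib[symmetric] by (intro power_mono) auto
        have P: "(1 + ?\<rho>) ^ N * exp (- (1 / 32) * ?\<rho>\<^sup>2) \<le> P"
          using gaussian_decay_bound[of "1/32" ?\<rho> N] unfolding P_def by (simp add: mult.commute)
        have Mt: "gauss_mass TYPE('a) t / (2 * pi) ^ DIM('a) = M1 * t powr (- (real DIM('a) / 2))"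
        proof -
          have "sqrt t ^ DIM('a) = t powr (real DIM('a) / 2)"
            using t by (simp add: powr_half_sqrt[symmetric] powr_powr flip: powr_realpow)
          then show ?thesis
            using gauss_mass_scale[OF t(1), where 'a='a] t by (simp add: M1_def powr_minus field_simps)
        qed
        have "(1 + norm x) ^ N * norm (iter_pderiv bs ?w x)
            \<le> ((1 + norm a) ^ N * (1 + ?\<rho>) ^ N) * (2 ^ N * (K * (A * exp (- (?\<rho>\<^sup>2 / (16 * t))))))"
          using p True n by (intro mult_mono') auto
        also have "\<dots> \<le> ((1 + norm a) ^ N * (1 + ?\<rho>) ^ N) * (2 ^ N * (K * (A *
            (exp (- (1 / 32) * ?\<rho>\<^sup>2) * (?E t * ?E t)))))"
          using A0 K_nonneg by (intro mult_left_mono e) auto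
        also have "\<dots> = (2 ^ N * K * L * (1 + norm a) ^ N * M1 * ?E t) *
            (((1 + ?\<rho>) ^ N * exp (- (1 / 32) * ?\<rho>\<^sup>2)) * (t powr (- (real DIM('a) / 2)) * ?E t))"
          unfolding A_def Mt by (simp only: mult_ac)
        also have "\<dots> \<le> (2 ^ N * K * L * (1 + norm a) ^ N * M1 * ?E t) * (P * Q)"
          using K_nonneg L0 M1 Q(2)[OF t] P by (intro mult_left_mono mult_mono) (auto simp: P_def)
        also have "\<dots> = ?B * ?E t"
          by (simp only: mult_ac)
        finally show ?thesis .
      qed
    qed
    show ?thesis
      using order_trans[OF 1 mult_left_mono[OF 2 abs_ge_zero]] unfolding C_def by (simp only: mult.assoc)
  qed
  then show ?thesis by blast
qed

lemma neg_laplacian_pow: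
  assumes f: "test_fun a d f"
  shows "test_fun a d ((neg_laplacian ^^ k) f)"
    "inv_fourier ((neg_laplacian ^^ k) f) \<xi> = of_real ((norm \<xi>)\<^sup>2 ^ k) * inv_fourier f \<xi>"
proof (induction k)
  case (Suc k)
  case 1 show ?case using Suc by (simp add: test_fun_neg_laplacian)
  case 2 show ?case
    using Suc by (simp add: inv_fourier_neg_laplacian[OF test_fun_schwartz[OF Suc(1)]] mult.assoc)
qed (use f in auto)

text \<open>The powers of \<open>\<bar>\<xi>\<bar>\<^sup>2\<close> in the moments are absorbed into the test function as powers of \<open>-\<Delta>\<close>, which do
not enlarge its support.\<close>

lemma heat_pairing_eq_0:
  assumes f: "test_fun a d f" and t: "0 < t"
  shows "(\<integral>\<xi>. g \<xi> * (inv_fourier f \<xi> * gauss t \<xi>) \<partial>lborel) = 0"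
proof -
  let ?\<psi> = "inv_fourier f"
  note L = neg_laplacian_pow[OF f]
  have [measurable]: "?\<psi> \<in> borel_measurable borel"
    by (intro schwartz_measurable inv_fourier_schwartz test_fun_schwartz[OF f])
  interpret heat_moments "\<lambda>\<xi>. g \<xi> * ?\<psi> \<xi>" s
  proof
    show "integrable lborel (\<lambda>\<xi>. of_real ((norm \<xi>)\<^sup>2 ^ k) * (g \<xi> * ?\<psi> \<xi>))" for k
      using gint[OF inv_fourier_schwartz[OF test_fun_schwartz[OF L(1)[of k]]]]
      unfolding L(2) by (simp add: mult_ac)
  qed (use s in auto)
  have HL: "H j t = u (heat t ((neg_laplacian ^^ j) f))" if t: "0 < t" for j t
  proof -
    have S: "(neg_laplacian ^^ j) f \<in> schwartz" by (rule test_fun_schwartz[OF L(1)])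
    have "u (heat t ((neg_laplacian ^^ j) f)) = (\<integral>\<xi>. g \<xi> * (inv_fourier ((neg_laplacian ^^ j) f) \<xi> * gauss t \<xi>) \<partial>lborel)"
      unfolding heat_def by (rule rep[OF heat_symbol_schwartz[OF S t]])
    then show ?thesis
      unfolding L(2) H_def gauss_def by (simp add: mult_ac)
  qed
  have "H 0 t = 0"
  proof (rule heat_eq_0[where c = "d\<^sup>2 / 16"])
    fix k
    have "(norm \<xi>)\<^sup>2 powr s = norm \<xi> powr (2 * s)" for \<xi> :: 'a
      by (cases "\<xi> = 0") (simp_all add: powr_powr flip: powr_numeral)
    then show "(\<integral>\<xi>. of_real ((norm \<xi>)\<^sup>2 powr s * (norm \<xi>)\<^sup>2 ^ k) * (g \<xi> * ?\<psi> \<xi>) \<partial>lborel) = 0"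
      using fvan[OF L(1)[of k]] unfolding L(2) by (simp add: mult_ac)
  next
    fix j show "\<exists>C. \<forall>t. 0 < t \<longrightarrow> t \<le> 1 \<longrightarrow> norm (H j t) \<le> C * exp (- (d\<^sup>2 / 16 / t))"
      using off_diagonal[OF L(1)[of j]] HL by auto
  qed (use d t in auto)
  then show ?thesis
    unfolding H_def gauss_def by (simp add: mult_ac)
qed

lemma dir_deriv_pow:
  assumes f: "test_fun a d f"
  shows "test_fun a d ((dir_deriv y ^^ k) f)"
    "inv_fourier ((dir_deriv y ^^ k) f) \<xi> = (- \<i> * of_real (y \<bullet> \<xi>)) ^ k * inv_fourier f \<xi>"
proof (induction k)
  case (Suc k)
  case 1 show ?case using Suc by (simp add: test_fun_dir_deriv)
  case 2 show ?case
    using Suc by (simp add: inv_fourier_dir_deriv[OF test_fun_schwartz[OF Suc(1)]] mult.assoc)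
qed (use f in auto)

text \<open>Analyticity of the heat flow in space: the terms of the exponential series are the symbols of
iterated derivatives of \<open>f\<close> in the direction \<open>y\<close>, for which the pairing vanishes, and the Gaussian
dominates the growth \<open>exp (\<bar>y\<bar> \<bar>\<xi>\<bar>)\<close> of the partial sums.\<close>

lemma heat_pairing_translate_eq_0:
  assumes f: "test_fun a d f" and t: "0 < t"
  shows "(\<integral>\<xi>. exp (- \<i> * of_real (y \<bullet> \<xi>)) * (g \<xi> * (inv_fourier f \<xi> * gauss t \<xi>)) \<partial>lborel) = 0"
proof -
  let ?G = "\<lambda>\<xi>. g \<xi> * (inv_fourier f \<xi> * gauss t \<xi>)"
  let ?z = "\<lambda>\<xi>. - \<i> * complex_of_real (y \<bullet> \<xi>)"
  let ?S = "\<lambda>M \<xi>. \<Sum>m<M. ?z \<xi> ^ m / fact m"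
  let ?E = "exp ((norm y)\<^sup>2 / (4 * t))"
  have \<psi>S: "inv_fourier f \<in> schwartz" by (intro inv_fourier_schwartz test_fun_schwartz[OF f])
  then have [measurable]: "inv_fourier f \<in> borel_measurable borel" by (rule schwartz_measurable)
  have intG: "integrable lborel (\<lambda>\<xi>. g \<xi> * (inv_fourier h \<xi> * gauss t \<xi>))" if "test_fun a d h" for h
    by (intro gint heat_symbol_schwartz test_fun_schwartz[OF that] t)
  have "(\<lambda>M. \<integral>\<xi>. ?S M \<xi> * ?G \<xi> \<partial>lborel) \<longlonglongrightarrow> (\<integral>\<xi>. exp (?z \<xi>) * ?G \<xi> \<partial>lborel)"
  proof (rule integral_dominated_convergence[where w = "\<lambda>\<xi>. ?E * norm (g \<xi> * inv_fourier f \<xi>)"])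
    show "integrable lborel (\<lambda>\<xi>. ?E * norm (g \<xi> * inv_fourier f \<xi>))"
      by (intro integrable_mult_right integrable_norm gint \<psi>S)
    show "AE \<xi> in lborel. (\<lambda>M. ?S M \<xi> * ?G \<xi>) \<longlonglongrightarrow> exp (?z \<xi>) * ?G \<xi>"
      by (intro AE_I2 tendsto_mult tendsto_const exp_partial_sum_tendsto)
    show "AE \<xi> in lborel. norm (?S M \<xi> * ?G \<xi>) \<le> ?E * norm (g \<xi> * inv_fourier f \<xi>)" for M
    proof (rule AE_I2)
      fix \<xi> :: 'a
      let ?r = "norm \<xi>"
      have "norm (?S M \<xi>) \<le> exp (norm (?z \<xi>))" by (rule norm_exp_partial_sum_le)
      also have "\<dots> \<le> exp (norm y * ?r)" using Cauchy_Schwarz_ineq2[of y \<xi>] by (simp add: norm_mult)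
      finally have "norm (?S M \<xi>) * norm (gauss t \<xi>) \<le> exp (norm y * ?r) * exp (- t * ?r\<^sup>2)"
        by (intro mult_mono) (auto simp: gauss_def)
      also have "\<dots> = exp (norm y * ?r + - t * ?r\<^sup>2)" by (simp only: exp_add)
      also have "\<dots> \<le> ?E"
      proof -
        have "0 \<le> (norm y - 2 * t * ?r)\<^sup>2 / (4 * t)" using t by simp
        also have "\<dots> = (norm y)\<^sup>2 / (4 * t) - (norm y * ?r + - t * ?r\<^sup>2)"
          using t by (simp add: field_simps power2_eq_square)
        finally show ?thesis by simp
      qed
      finally have "(norm (?S M \<xi>) * norm (gauss t \<xi>)) * norm (g \<xi> * inv_fourier f \<xi>) \<le> ?E * norm (g \<xi> * inv_fourier f \<xi>)"
        by (intro mult_right_mono) auto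
      then show "norm (?S M \<xi> * ?G \<xi>) \<le> ?E * norm (g \<xi> * inv_fourier f \<xi>)"
        by (simp only: norm_mult mult_ac)
    qed
  qed measurable
  moreover have "(\<integral>\<xi>. ?S M \<xi> * ?G \<xi> \<partial>lborel) = 0" for M
  proof -
    have "(\<integral>\<xi>. ?S M \<xi> * ?G \<xi> \<partial>lborel) =
      (\<integral>\<xi>. (\<Sum>m<M. inverse (fact m) * (g \<xi> * (inv_fourier ((dir_deriv y ^^ m) f) \<xi> * gauss t \<xi>))) \<partial>lborel)"
      unfolding dir_deriv_pow(2)[OF f] sum_distrib_right
      by (intro Bochner_Integration.integral_cong sum.cong refl) (simp add: divide_inverse mult_ac)
    also have "\<dots> = (\<Sum>m<M. inverse (fact m) * (\<integral>\<xi>. g \<xi> * (inv_fourier ((dir_deriv y ^^ m) f) \<xi> * gauss t \<xi>) \<partial>lborel))"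
      by (subst Bochner_Integration.integral_sum)
        (auto intro!: integrable_mult_right intG dir_deriv_pow(1)[OF f])
    also have "\<dots> = 0"
      by (intro sum.neutral ballI) (simp only: heat_pairing_eq_0[OF dir_deriv_pow(1)[OF f] t] mult_zero_right)
    finally show ?thesis .
  qed
  ultimately show ?thesis by (simp add: LIMSEQ_const_iff)
qed

text \<open>Superposing the translates with weight \<^term>\<open>inv_fourier h\<close> gives the Fourier transform of the weight,
which is a nonzero multiple of \<open>h\<close>.\<close>

lemma heat_pairing_schwartz_eq_0:
  assumes f: "test_fun a d f" and t: "0 < t" and h: "h \<in> schwartz"
  shows "(\<integral>\<xi>. g \<xi> * (inv_fourier f \<xi> * gauss t \<xi>) * h \<xi> \<partial>lborel) = 0"
proof -
  let ?G = "\<lambda>\<xi>. g \<xi> * (inv_fourier f \<xi> * gauss t \<xi>)"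
  have G: "integrable lborel ?G"
    by (intro gint heat_symbol_schwartz test_fun_schwartz[OF f] t)
  let ?k = "inv_fourier h"
  have k: "integrable lborel ?k" by (intro schwartz_integrable inv_fourier_schwartz h)
  have "(\<integral>y. \<integral>\<xi>. exp (- \<i> * of_real (y \<bullet> \<xi>)) * ?k y * ?G \<xi> \<partial>lborel \<partial>lborel) =
      (\<integral>y. ?k y * (\<integral>\<xi>. exp (- \<i> * of_real (y \<bullet> \<xi>)) * ?G \<xi> \<partial>lborel) \<partial>lborel)"
    by (simp add: mult.assoc mult.left_commute[of _ "?k _"] flip: integral_mult_right_zero)
  also have "\<dots> = 0" by (simp only: heat_pairing_translate_eq_0[OF f t] mult_zero_right) simp
  finally have "0 = (\<integral>y. \<integral>\<xi>. exp (- \<i> * of_real (y \<bullet> \<xi>)) * ?k y * ?G \<xi> \<partial>lborel \<partial>lborel)" by simp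
  also have "\<dots> = (\<integral>\<xi>. \<integral>y. exp (- \<i> * of_real (y \<bullet> \<xi>)) * ?k y * ?G \<xi> \<partial>lborel \<partial>lborel)"
    by (rule Fubini_lborel_tensor[OF k G]) auto
  also have "\<dots> = (\<integral>\<xi>. fourier ?k \<xi> * ?G \<xi> \<partial>lborel)" by (simp add: fourier_def)
  also have "\<dots> = of_real (inversion_const TYPE('a)) * (\<integral>\<xi>. ?G \<xi> * h \<xi> \<partial>lborel)"
    by (simp add: fourier_inv_fourier[OF h] mult_ac flip: integral_mult_right_zero)
  finally show ?thesis using inversion_const_nonzero[where 'a='a] by simp
qed

end

subsection \<open>Approximation of a point mass\<close>

text \<open>A normalized nonnegative bump of radius \<open>d\<close>: its transform differs from that of a unit mass at \<open>a\<close> by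
the average of \<open>exp (i \<xi> \<bullet> (x - a)) - 1\<close>, which is at most \<open>d \<bar>\<xi>\<bar>\<close>.\<close>

lemma point_mass_approx:
  fixes a :: "'a::euclidean_space"
  assumes d: "0 < d"
  obtains f where "test_fun a d f"
    "\<And>\<xi>. norm (inv_fourier f \<xi>) \<le> 1 / (2 * pi) ^ DIM('a)"
    "\<And>\<xi>. norm (inv_fourier f \<xi> - of_real (1 / (2 * pi) ^ DIM('a)) * exp (\<i> * of_real (\<xi> \<bullet> a))) \<le> d * norm \<xi> / (2 * pi) ^ DIM('a)"
proof -
  let ?c = "1 / (2 * pi) ^ DIM('a)"
  obtain \<eta> :: "'a \<Rightarrow> complex" where \<eta>: "smooth \<eta>" "\<And>x. \<eta> x = of_real (norm (\<eta> x))"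
    "\<And>x. dist a x \<le> d / 2 \<Longrightarrow> \<eta> x = 1" "\<And>x. 2 * (d / 2) \<le> dist a x \<Longrightarrow> \<eta> x = 0"
    using cutoff_exists[of "d / 2" a] d by (metis half_gt_zero)
  have \<eta>t: "test_fun a d \<eta>" unfolding test_fun_def using \<eta> by auto
  have \<eta>I: "integrable lborel \<eta>" by (rule schwartz_integrable[OF test_fun_schwartz[OF \<eta>t]])
  define m where "m = (\<integral>x. norm (\<eta> x) \<partial>lborel)"
  have m: "0 < m"
    unfolding m_def
    by (rule integral_norm_pos[OF test_fun_schwartz[OF \<eta>t], of a]) (use \<eta>(3)[of a] d in simp)
  define f where "f x = of_real (1 / m) * \<eta> x" for x
  have ft: "test_fun a d f" unfolding f_def[abs_def] by (rule test_fun_cmult[OF \<eta>t])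
  have fI: "integrable lborel f" by (rule schwartz_integrable[OF test_fun_schwartz[OF ft]])
  have nf: "norm (f x) = norm (\<eta> x) / m" for x using m by (simp add: f_def norm_divide)
  have f1: "(\<integral>x. norm (f x) \<partial>lborel) = 1" unfolding nf using m by (simp add: m_def)
  have freal: "f x = of_real (norm (f x))" for x
    unfolding nf using \<eta>(2)[of x] by (simp add: f_def)
  have f1': "integral\<^sup>L lborel f = 1"
  proof -
    have "integral\<^sup>L lborel f = (\<integral>x. complex_of_real (norm (f x)) \<partial>lborel)"
      using freal by (intro Bochner_Integration.integral_cong) auto
    then show ?thesis by (simp add: f1)
  qed
  have fS: "f \<in> schwartz" by (rule test_fun_schwartz[OF ft])
  show ?thesis
  proof (rule that[OF ft])
    fix \<xi> :: 'a
    show "norm (inv_fourier f \<xi>) \<le> ?c"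
      unfolding inv_fourier_eq_fourier norm_mult norm_of_real
      using norm_fourier_le[of f "- \<xi>"] by (simp add: f1 divide_right_mono)
    let ?I = "\<lambda>x. exp (\<i> * of_real (\<xi> \<bullet> x)) * f x - exp (\<i> * of_real (\<xi> \<bullet> a)) * f x"
    have int1: "integrable lborel (\<lambda>x. exp (\<i> * of_real (\<xi> \<bullet> x)) * f x)"
      using fourier_integrable[OF fS, of "- \<xi>"] by (simp add: inner_commute)
    have "inv_fourier f \<xi> - of_real ?c * exp (\<i> * of_real (\<xi> \<bullet> a)) =
      of_real ?c * ((\<integral>x. exp (\<i> * of_real (\<xi> \<bullet> x)) * f x \<partial>lborel) - exp (\<i> * of_real (\<xi> \<bullet> a)) * integral\<^sup>L lborel f)"
      unfolding inv_fourier_def f1' by (simp only: right_diff_distrib mult_1_right)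
    also have "\<dots> = of_real ?c * (\<integral>x. ?I x \<partial>lborel)"
      using int1 fI by (subst Bochner_Integration.integral_diff) auto
    finally have eq: "inv_fourier f \<xi> - of_real ?c * exp (\<i> * of_real (\<xi> \<bullet> a)) = of_real ?c * (\<integral>x. ?I x \<partial>lborel)" .
    have "norm (\<integral>x. ?I x \<partial>lborel) \<le> (\<integral>x. (d * norm \<xi>) * norm (f x) \<partial>lborel)"
    proof (rule order_trans[OF integral_norm_bound integral_mono_AE'])
      show "integrable lborel (\<lambda>x. (d * norm \<xi>) * norm (f x))"
        by (intro integrable_mult_right integrable_norm fI)
      show "AE x in lborel. norm (?I x) \<le> (d * norm \<xi>) * norm (f x)"
      proof (rule AE_I2)
        fix x show "norm (?I x) \<le> (d * norm \<xi>) * norm (f x)"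
        proof (cases "x \<in> cball a d")
          case True
          have "?I x = exp (\<i> * of_real (\<xi> \<bullet> a)) * (iexp (\<xi> \<bullet> (x - a)) - 1) * f x"
            by (simp add: inner_diff_right exp_diff algebra_simps)
          then have "norm (?I x) = norm (iexp (\<xi> \<bullet> (x - a)) - 1) * norm (f x)"
            by (simp add: norm_mult)
          also have "norm (iexp (\<xi> \<bullet> (x - a)) - 1) \<le> \<bar>\<xi> \<bullet> (x - a)\<bar>"
            using iexp_approx1[of "\<xi> \<bullet> (x - a)" 0] by simp
          also have "\<dots> \<le> norm \<xi> * norm (x - a)" by (rule Cauchy_Schwarz_ineq2)
          also have "\<dots> \<le> d * norm \<xi>"
            using True by (subst mult.commute, intro mult_right_mono) (auto simp: dist_norm norm_minus_commute)
          finally show ?thesis by (simp add: mult_right_mono)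
        qed (use ft in \<open>simp add: test_fun_def\<close>)
      qed
    qed (use d in auto)
    then have "norm (\<integral>x. ?I x \<partial>lborel) \<le> d * norm \<xi>" by (simp add: f1)
    then show "norm (inv_fourier f \<xi> - of_real ?c * exp (\<i> * of_real (\<xi> \<bullet> a))) \<le> d * norm \<xi> / (2 * pi) ^ DIM('a)"
      unfolding eq norm_mult norm_of_real by (simp add: divide_right_mono)
  qed
qed

lemma test_fun_mono: "test_fun a d f \<Longrightarrow> d \<le> e \<Longrightarrow> test_fun a e f"
  unfolding test_fun_def by auto

subsection \<open>Unique continuation\<close>

context vanishing
begin

text \<open>The time tends to \<open>0\<close> and the test functions tend to a point mass at \<open>a\<close> simultaneously. The
character \<open>exp (-i \<xi> \<bullet> a)\<close> is put into the Schwartz function to cancel the one that arises in the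
limit.\<close>

lemma density_pairing_eq_0:
  assumes h: "h \<in> schwartz"
  shows "(\<integral>\<xi>. g \<xi> * h \<xi> \<partial>lborel) = 0"
proof -
  let ?c = "1 / (2 * pi) ^ DIM('a)"
  let ?e = "\<lambda>\<xi>. of_real ?c * exp (\<i> * of_real (\<xi> \<bullet> a))"
  let ?\<delta> = "\<lambda>m. d * (1 / real (Suc m))" and ?t = "\<lambda>m. 1 / real (Suc m)"
  have t0: "?t \<longlonglongrightarrow> 0" using LIMSEQ_inverse_real_of_nat by (simp add: inverse_eq_divide)
  have "\<exists>f. test_fun a (?\<delta> m) f \<and> (\<forall>\<xi>. norm (inv_fourier f \<xi>) \<le> ?c) \<and>
      (\<forall>\<xi>. norm (inv_fourier f \<xi> - ?e \<xi>) \<le> ?\<delta> m * norm \<xi> / (2 * pi) ^ DIM('a))" for m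
  proof -
    have "0 < ?\<delta> m" using d by simp
    from point_mass_approx[OF this, of a] show ?thesis by metis
  qed
  then obtain f where f: "\<And>m. test_fun a (?\<delta> m) (f m)" "\<And>m \<xi>. norm (inv_fourier (f m) \<xi>) \<le> ?c"
    "\<And>m \<xi>. norm (inv_fourier (f m) \<xi> - ?e \<xi>) \<le> ?\<delta> m * norm \<xi> / (2 * pi) ^ DIM('a)"
    by metis
  have ft: "test_fun a d (f m)" for m
    by (rule test_fun_mono[OF f(1)]) (use d in \<open>simp add: divide_le_eq\<close>)
  have [measurable]: "inv_fourier (f m) \<in> borel_measurable borel" for m
    by (intro schwartz_measurable inv_fourier_schwartz test_fun_schwartz[OF ft])
  let ?p = "\<lambda>m \<xi>. inv_fourier (f m) \<xi> * gauss (?t m) \<xi>"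
  let ?k = "\<lambda>\<xi>. exp (- \<i> * of_real (\<xi> \<bullet> a)) * h \<xi>"
  have kS: "?k \<in> schwartz" by (rule schwartz_character_mult[OF h])
  then have [measurable]: "?k \<in> borel_measurable borel" by (rule schwartz_measurable)
  have [measurable]: "h \<in> borel_measurable borel" by (rule schwartz_measurable[OF h])
  have "(\<lambda>m. \<integral>\<xi>. g \<xi> * ?p m \<xi> * ?k \<xi> \<partial>lborel) \<longlonglongrightarrow>
      (\<integral>\<xi>. of_real ?c * (g \<xi> * h \<xi>) \<partial>lborel)"
  proof (rule integral_dominated_convergence[where w = "\<lambda>\<xi>. ?c * norm (g \<xi> * ?k \<xi>)"])
    show "integrable lborel (\<lambda>\<xi>. ?c * norm (g \<xi> * ?k \<xi>))"
      by (intro integrable_mult_right integrable_norm gint kS)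
    show "AE \<xi> in lborel. (\<lambda>m. g \<xi> * ?p m \<xi> * ?k \<xi>) \<longlonglongrightarrow> of_real ?c * (g \<xi> * h \<xi>)"
    proof (rule AE_I2)
      fix \<xi> :: 'a
      have "(\<lambda>m. d * ?t m * norm \<xi> / (2 * pi) ^ DIM('a)) \<longlonglongrightarrow> d * 0 * norm \<xi> / (2 * pi) ^ DIM('a)"
        by (intro tendsto_intros t0) auto
      then have L: "(\<lambda>m. d * ?t m * norm \<xi> / (2 * pi) ^ DIM('a)) \<longlonglongrightarrow> 0" by simp
      have "(\<lambda>m. inv_fourier (f m) \<xi> - ?e \<xi>) \<longlonglongrightarrow> 0"
        by (rule Lim_null_comparison[OF always_eventually[OF allI[OF f(3)]] L])
      then have 1: "(\<lambda>m. inv_fourier (f m) \<xi>) \<longlonglongrightarrow> ?e \<xi>"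
        by (rule LIM_zero_cancel)
      have 2: "(\<lambda>m. gauss (?t m) \<xi>) \<longlonglongrightarrow> of_real (exp (- 0 * (norm \<xi>)\<^sup>2))"
        unfolding gauss_def by (intro tendsto_intros t0)
      have "(\<lambda>m. g \<xi> * ?p m \<xi> * ?k \<xi>) \<longlonglongrightarrow>
          g \<xi> * (?e \<xi> * of_real (exp (- 0 * (norm \<xi>)\<^sup>2))) * ?k \<xi>"
        by (intro tendsto_mult tendsto_const 1 2)
      also have "g \<xi> * (?e \<xi> * of_real (exp (- 0 * (norm \<xi>)\<^sup>2))) * ?k \<xi> = of_real ?c * (g \<xi> * h \<xi>)"
        by (simp add: exp_minus)
      finally show "(\<lambda>m. g \<xi> * ?p m \<xi> * ?k \<xi>) \<longlonglongrightarrow> of_real ?c * (g \<xi> * h \<xi>)" .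
    qed
    show "AE \<xi> in lborel. norm (g \<xi> * ?p m \<xi> * ?k \<xi>) \<le> ?c * norm (g \<xi> * ?k \<xi>)" for m
    proof (rule AE_I2)
      fix \<xi> :: 'a
      have "norm (inv_fourier (f m) \<xi>) * norm (gauss (?t m) \<xi>) \<le> ?c * 1"
        by (intro mult_mono f(2)) (auto simp: gauss_def)
      then have "(norm (inv_fourier (f m) \<xi>) * norm (gauss (?t m) \<xi>)) * (norm (g \<xi>) * norm (?k \<xi>)) \<le> ?c * 1 * (norm (g \<xi>) * norm (?k \<xi>))"
        by (intro mult_right_mono) auto
      then show "norm (g \<xi> * ?p m \<xi> * ?k \<xi>) \<le> ?c * norm (g \<xi> * ?k \<xi>)"
        by (simp only: norm_mult mult_ac mult_1_right)
    qed
  qed measurable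
  moreover have "(\<integral>\<xi>. g \<xi> * ?p m \<xi> * ?k \<xi> \<partial>lborel) = 0" for m
    by (rule heat_pairing_schwartz_eq_0[OF ft _ kS]) simp
  ultimately have "(\<integral>\<xi>. of_real ?c * (g \<xi> * h \<xi>) \<partial>lborel) = 0"
    by (simp only: LIMSEQ_const_iff)
  then show ?thesis by simp
qed

lemma u_eq_0:
  assumes h: "h \<in> schwartz" shows "u h = 0"
proof -
  have "of_real (inversion_const TYPE('a)) * u h = u (fourier (inv_fourier h))"
    unfolding ext[of "fourier (inv_fourier h)", OF fourier_inv_fourier[OF h]] by (rule u_cmult[OF h, symmetric])
  also have "\<dots> = 0"
    by (simp add: rep[OF inv_fourier_schwartz[OF h]] density_pairing_eq_0[OF inv_fourier_schwartz[OF h]])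
  finally show ?thesis using inversion_const_nonzero[where 'a='a] by simp
qed

end

theorem theorem1p2:
  fixes u :: "(real ^ 'n) dist" and s r :: real and U :: "(real ^ 'n) set"
  assumes "CARD('n) \<ge> 2"
    and "0 < s" and "s < 1"
    and "u \<in> sobolev (- r)"
    and "open U" and "U \<noteq> {}"
    and "vanishes_on u U"
    and "vanishes_on (frac_laplacian s u) U"
  shows "\<forall>f \<in> schwartz. u f = 0"
proof
  fix f :: "real ^ 'n \<Rightarrow> complex" assume f: "f \<in> schwartz"
  let ?g = "density_of (fourier_dist u)"
  have g: "represented_by (fourier_dist u) ?g" by (rule density_of_represents[OF assms(4)])
  obtain a e where e: "0 < e" "cball a e \<subseteq> U"
    using assms(5,6) open_contains_cball by (metis ex_in_conv)
  interpret vanishing u ?g a "e / 4" s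
  proof
    show "u \<in> tempered" using assms(4) by (simp add: sobolev_def)
    show "?g \<in> borel_measurable borel" using g by (simp add: represented_by_def)
    show "integrable lborel (\<lambda>\<xi>. ?g \<xi> * h \<xi>)" if "h \<in> schwartz" for h
      using g that by (simp add: represented_by_def)
    show "u (fourier h) = (\<integral>\<xi>. ?g \<xi> * h \<xi> \<partial>lborel)" if "h \<in> schwartz" for h
      using g that by (simp add: represented_by_def fourier_dist_def regular_dist_def)
    show "u h = 0" if "test_fun a (4 * (e / 4)) h" for h
      using vanishes_on_test_fun[OF assms(7) _ e(2)] that by simp
    show "(\<integral>\<xi>. of_real (norm \<xi> powr (2 * s)) * ?g \<xi> * inv_fourier h \<xi> \<partial>lborel) = 0" if "test_fun a (e / 4) h" for h
    proof -
      have "test_fun a e h" by (rule test_fun_mono[OF that]) (use e in simp)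
      from vanishes_on_test_fun[OF assms(8) this e(2)] show ?thesis
        by (simp add: frac_laplacian_def inv_fourier_dist_def regular_dist_def)
    qed
  qed (use e assms in auto)
  show "u f = 0" by (rule u_eq_0[OF f])
qed

end
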